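(* Fix an arbitrary PID $\mathbf{k}$ and a $\mathbf{k}$-Lie algebra $\mathfrak{L}$ (free of finite rank over $\mathbf{k}$). Let $S^s$ be the $\mathfrak{L}$-module of symmetric degree $s$ polynomials on $\mathfrak{L}$, equipped with the dual adjoint action. Then there is a first quadrant spectral sequence $$E_0^{s,t}=\Lambda^t(\mathfrak{L},S^s)$$ with differentials $d_r:E_r^{s,t}\to E_r^{s+r,\,t-(2r-1)}$ which are derivations with respect to the algebra structure induced from $$E_0^{*,*}=\Lambda^*(\mathfrak{L}^* )\otimes S^*(\mathfrak{L}^* ).$$ The differential $d_r$ raises polynomial degree $s$ by $r$ and raises total degree $2s+t$ by one (hence lowers exterior degree $t$ by $2r-1$). The spectral sequence converges to the cohomology of a point: $E_\infty^{0,0}=\mathbf{k}$ and $E_\infty^{s,t}=0$ for $(s,t)\ne(0,0)$. Explicitly, let $e_1,\dots,e_n$ be a $\mathbf{k}$-basis of $\mathfrak{L}$ with structure constants $[e_i,e_j]=\sum_kc_{ij}^ke_k$, let $x_i\in E_0^{0,1}$ be the dual basis, and let $y_i\in E_0^{1,0}$ be the same dual basis viewed in $S^1(\mathfrak{L}^* )$. Then $d_0$ is the derivation with $d_0(x_i)=-\sum_{j<k}c_{jk}^ix_jx_k$ and $d_0(y_i)=\sum_{j,k}c_{jk}^iy_jx_k$; $d_1$ is induced by the derivation of $E_0$ with $x_i\mapsto y_i$, $y_i\mapsto0$, which anticommutes with $d_0$; and the higher differentials are obtained from these two by the standard zig-zag construction for a double complex.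
   Context: $\Lambda^t(\mathfrak{L},S^s)$ denotes the module of $S^s$-valued alternating $t$-forms on $\mathfrak{L}$, the degree $t$ term of the Koszul (Chevalley–Eilenberg) complex computing $H^*(\mathfrak{L},S^s)$. The dual adjoint action on $\mathfrak{L}^*$ is $(u\cdot\alpha)(v)=\alpha([v,u])$, and it is extended to $S^s=S^s(\mathfrak{L}^* )$ by derivations. Graded commutativity and signs in the derivation rule are determined by total degree: $d(ab)=d(a)b+(-1)^{|a|}a\,d(b)$ with $|a|=2s+t$ for $a\in E^{s,t}$. *)

theory Defs
  imports
    Complex_Main
    "HOL-Library.Poly_Mapping"
    "HOL-Library.Function_Algebras"
    "HOL-Library.Set_Algebras"
begin

section \<open>The base ring and the Lie algebra\<close>

(* The ideals of 'k are the submodules of 'k over itself. *)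
definition is_PID :: "'k::idom itself \<Rightarrow> bool" where
  "is_PID _ \<longleftrightarrow>
     (\<forall>I :: 'k set. module.subspace (*) I \<longrightarrow> (\<exists>a. I = module.span (*) {a}))"

locale lie_algebra = module scale
  for scale :: "'k::comm_ring_1 \<Rightarrow> 'l::ab_group_add \<Rightarrow> 'l" +
  fixes bracket :: "'l \<Rightarrow> 'l \<Rightarrow> 'l"
  assumes bracket_hom_left: "module_hom scale scale (\<lambda>u. bracket u v)"
    and bracket_hom_right: "module_hom scale scale (\<lambda>v. bracket u v)"
    and bracket_self: "bracket u u = 0"
    and jacobi: "bracket u (bracket v w) + bracket v (bracket w u) + bracket w (bracket u v) = 0"

(* Indices run over 0, ..., n - 1, so that rank 0 is included. *)
definition is_basis :: "('k::comm_ring_1 \<Rightarrow> 'l::ab_group_add \<Rightarrow> 'l) \<Rightarrow> nat \<Rightarrow> (nat \<Rightarrow> 'l) \<Rightarrow> bool" where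
  "is_basis scale n e \<longleftrightarrow>
     inj_on e {..<n} \<and> \<not> module.dependent scale (e ` {..<n}) \<and> module.span scale (e ` {..<n}) = UNIV"

definition coord :: "('k::comm_ring_1 \<Rightarrow> 'l::ab_group_add \<Rightarrow> 'l) \<Rightarrow> nat \<Rightarrow> (nat \<Rightarrow> 'l) \<Rightarrow> nat \<Rightarrow> 'l \<Rightarrow> 'k" where
  "coord scale n e i v = module.representation scale (e ` {..<n}) v (e i)"

definition struct_const ::
  "('k::comm_ring_1 \<Rightarrow> 'l::ab_group_add \<Rightarrow> 'l) \<Rightarrow> ('l \<Rightarrow> 'l \<Rightarrow> 'l) \<Rightarrow> nat \<Rightarrow> (nat \<Rightarrow> 'l) \<Rightarrow>
   nat \<Rightarrow> nat \<Rightarrow> nat \<Rightarrow> 'k" where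
  "struct_const scale bracket n e i j k = coord scale n e k (bracket (e i) (e j))"


section \<open>The symmetric algebra of the dual\<close>

(* Formal polynomials in the coordinates y_0, ..., y_(n-1) of the chosen basis.  Polynomial functions
   would be wrong over a finite field, where distinct polynomials can have the same values. *)
type_synonym 'k mpoly = "(nat \<Rightarrow>\<^sub>0 nat) \<Rightarrow>\<^sub>0 'k"

definition pconst :: "'k::comm_ring_1 \<Rightarrow> 'k mpoly" where
  "pconst c = Poly_Mapping.single 0 c"

definition pvar :: "nat \<Rightarrow> 'k::comm_ring_1 mpoly" where
  "pvar i = Poly_Mapping.single (Poly_Mapping.single i 1) 1"

(* S^s; for s < 0 this is {0}. *)
definition sym_power :: "nat \<Rightarrow> int \<Rightarrow> 'k::comm_ring_1 mpoly set" where
  "sym_power n s =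
     {p. \<forall>m\<in>Poly_Mapping.keys p.
           Poly_Mapping.keys m \<subseteq> {..<n} \<and> int (\<Sum>i\<in>Poly_Mapping.keys m. Poly_Mapping.lookup m i) = s}"

(* The canonical map from the dual of the Lie algebra to S^1. *)
definition linear_poly :: "nat \<Rightarrow> (nat \<Rightarrow> 'l) \<Rightarrow> ('l \<Rightarrow> 'k::comm_ring_1) \<Rightarrow> 'k mpoly" where
  "linear_poly n e \<alpha> = (\<Sum>i<n. pconst (\<alpha> (e i)) * pvar i)"

definition partial_deriv :: "nat \<Rightarrow> 'k::comm_ring_1 mpoly \<Rightarrow> 'k mpoly" where
  "partial_deriv i p =
     (\<Sum>m\<in>Poly_Mapping.keys p.
        Poly_Mapping.single (m - Poly_Mapping.single i 1)
          (of_nat (Poly_Mapping.lookup m i) * Poly_Mapping.lookup p m))"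

definition dual_adjoint :: "('l \<Rightarrow> 'l \<Rightarrow> 'l) \<Rightarrow> 'l \<Rightarrow> ('l \<Rightarrow> 'k) \<Rightarrow> 'l \<Rightarrow> 'k" where
  "dual_adjoint bracket u \<alpha> = (\<lambda>v. \<alpha> (bracket v u))"

(* A derivation of a polynomial ring over its constants is determined by its values on the
   variables and is given by the chain rule. *)
definition sym_action ::
  "('k::comm_ring_1 \<Rightarrow> 'l::ab_group_add \<Rightarrow> 'l) \<Rightarrow> ('l \<Rightarrow> 'l \<Rightarrow> 'l) \<Rightarrow> nat \<Rightarrow> (nat \<Rightarrow> 'l) \<Rightarrow>
   'l \<Rightarrow> 'k mpoly \<Rightarrow> 'k mpoly" where
  "sym_action scale bracket n e u p =
     (\<Sum>i<n. partial_deriv i p * linear_poly n e (dual_adjoint bracket u (coord scale n e i)))"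


section \<open>Alternating forms with polynomial values\<close>

(* A t-form is a function on lists of vectors that vanishes on all lists whose length is not t.
   Thus the forms of all degrees lie in one abelian group, with pointwise addition.  The pointwise
   product supplied by Function_Algebras is not the product of forms. *)
type_synonym ('l, 'k) form = "'l list \<Rightarrow> 'k mpoly"

definition multilinear :: "('k::comm_ring_1 \<Rightarrow> 'l::ab_group_add \<Rightarrow> 'l) \<Rightarrow> ('l, 'k) form \<Rightarrow> bool" where
  "multilinear scale a \<longleftrightarrow>
     (\<forall>us vs u v. a (us @ (u + v) # vs) = a (us @ u # vs) + a (us @ v # vs)) \<and>
     (\<forall>us vs c u. a (us @ scale c u # vs) = pconst c * a (us @ u # vs))"

definition alternating :: "('l, 'k::comm_ring_1) form \<Rightarrow> bool" where
  "alternating a \<longleftrightarrow> (\<forall>us. \<not> distinct us \<longrightarrow> a us = 0)"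

definition alt_forms ::
  "('k::comm_ring_1 \<Rightarrow> 'l::ab_group_add \<Rightarrow> 'l) \<Rightarrow> nat \<Rightarrow> int \<Rightarrow> int \<Rightarrow> ('l, 'k) form set" where
  "alt_forms scale n s t =
     {a. multilinear scale a \<and> alternating a \<and>
         (\<forall>us. int (length us) \<noteq> t \<longrightarrow> a us = 0) \<and> (\<forall>us. a us \<in> sym_power n s)}"

definition form_scale :: "'k::comm_ring_1 \<Rightarrow> ('l, 'k) form \<Rightarrow> ('l, 'k) form" where
  "form_scale c a = (\<lambda>us. pconst c * a us)"

(* The shuffle product.  The set I holds the positions of the arguments given to a, and the
   exponent counts the inversions of the shuffle. *)
definition wedge :: "('l, 'k::comm_ring_1) form \<Rightarrow> ('l, 'k) form \<Rightarrow> ('l, 'k) form" where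
  "wedge a b = (\<lambda>us. \<Sum>I\<in>Pow {..<length us}.
     (-1) ^ card {(i, j). i \<in> I \<and> j \<in> {..<length us} - I \<and> j < i} *
     (a (nths us I) * b (nths us (- I))))"

definition poly_form :: "'k::comm_ring_1 mpoly \<Rightarrow> ('l, 'k) form" where
  "poly_form p = (\<lambda>us. if us = [] then p else 0)"

definition x_gen ::
  "('k::comm_ring_1 \<Rightarrow> 'l::ab_group_add \<Rightarrow> 'l) \<Rightarrow> nat \<Rightarrow> (nat \<Rightarrow> 'l) \<Rightarrow> nat \<Rightarrow> ('l, 'k) form" where
  "x_gen scale n e i = (\<lambda>us. if length us = 1 then pconst (coord scale n e i (hd us)) else 0)"

definition y_gen :: "nat \<Rightarrow> ('l, 'k::comm_ring_1) form" where
  "y_gen i = poly_form (pvar i)"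

definition x_monomial ::
  "('k::comm_ring_1 \<Rightarrow> 'l::ab_group_add \<Rightarrow> 'l) \<Rightarrow> nat \<Rightarrow> (nat \<Rightarrow> 'l) \<Rightarrow> nat set \<Rightarrow> ('l, 'k) form" where
  "x_monomial scale n e I = foldr wedge (map (x_gen scale n e) (sorted_list_of_set I)) (poly_form 1)"

definition CE_diff ::
  "('k::comm_ring_1 \<Rightarrow> 'l::ab_group_add \<Rightarrow> 'l) \<Rightarrow> ('l \<Rightarrow> 'l \<Rightarrow> 'l) \<Rightarrow> nat \<Rightarrow> (nat \<Rightarrow> 'l) \<Rightarrow>
   ('l, 'k) form \<Rightarrow> ('l, 'k) form" where
  "CE_diff scale bracket n e a = (\<lambda>us.
     (\<Sum>i<length us. (-1) ^ i * sym_action scale bracket n e (us ! i) (a (nths us (- {i})))) +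
     (\<Sum>(i, j)\<in>{(i, j). i < j \<and> j < length us}.
        (-1) ^ (i + j) * a (bracket (us ! i) (us ! j) # nths us (- {i, j}))))"


section \<open>Bigraded algebras and derivations\<close>

(* The total degree of bidegree (s, t) is 2 s + t. *)
definition tot :: "int \<Rightarrow> int \<Rightarrow> int" where
  "tot s t = 2 * s + t"

definition sgn_deg :: "int \<Rightarrow> 'x::ab_group_add \<Rightarrow> 'x" where
  "sgn_deg k x = (if even k then x else - x)"

locale bigraded_algebra = module scale
  for scale :: "'k::comm_ring_1 \<Rightarrow> 'x::ab_group_add \<Rightarrow> 'x" +
  fixes E :: "int \<Rightarrow> int \<Rightarrow> 'x set"
    and mult :: "'x \<Rightarrow> 'x \<Rightarrow> 'x"  (infixl \<open>\<star>\<close> 70)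
    and unit :: 'x
  assumes subspace_E: "subspace (E s t)"
    and unit_in: "unit \<in> E 0 0"
    and mult_in: "\<lbrakk>a \<in> E s t; b \<in> E s' t'\<rbrakk> \<Longrightarrow> a \<star> b \<in> E (s + s') (t + t')"
    and unit_left: "a \<in> E s t \<Longrightarrow> unit \<star> a = a"
    and unit_right: "a \<in> E s t \<Longrightarrow> a \<star> unit = a"
    and mult_assoc: "\<lbrakk>a \<in> E s t; b \<in> E s' t'; c \<in> E s'' t''\<rbrakk> \<Longrightarrow> (a \<star> b) \<star> c = a \<star> (b \<star> c)"
    and add_mult: "\<lbrakk>a \<in> E s t; b \<in> E s t; c \<in> E s' t'\<rbrakk> \<Longrightarrow> (a + b) \<star> c = a \<star> c + b \<star> c"
    and mult_add: "\<lbrakk>a \<in> E s t; b \<in> E s' t'; c \<in> E s' t'\<rbrakk> \<Longrightarrow> a \<star> (b + c) = a \<star> b + a \<star> c"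
    and scale_mult: "\<lbrakk>a \<in> E s t; b \<in> E s' t'\<rbrakk> \<Longrightarrow> scale r a \<star> b = scale r (a \<star> b)"
    and mult_scale: "\<lbrakk>a \<in> E s t; b \<in> E s' t'\<rbrakk> \<Longrightarrow> a \<star> scale r b = scale r (a \<star> b)"
    and graded_comm: "\<lbrakk>a \<in> E s t; b \<in> E s' t'\<rbrakk> \<Longrightarrow> a \<star> b = sgn_deg (tot s t * tot s' t') (b \<star> a)"

(* A derivation of odd total degree that shifts the bidegree by (p, q). *)
definition graded_derivation ::
  "('k::comm_ring_1 \<Rightarrow> 'x::ab_group_add \<Rightarrow> 'x) \<Rightarrow> (int \<Rightarrow> int \<Rightarrow> 'x set) \<Rightarrow> ('x \<Rightarrow> 'x \<Rightarrow> 'x) \<Rightarrow>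
   int \<Rightarrow> int \<Rightarrow> ('x \<Rightarrow> 'x) \<Rightarrow> bool" where
  "graded_derivation scale E mult p q \<delta> \<longleftrightarrow>
     (\<forall>s t. \<forall>a\<in>E s t. \<delta> a \<in> E (s + p) (t + q)) \<and>
     (\<forall>s t. \<forall>a\<in>E s t. \<forall>b\<in>E s t. \<delta> (a + b) = \<delta> a + \<delta> b) \<and>
     (\<forall>s t. \<forall>a\<in>E s t. \<forall>c. \<delta> (scale c a) = scale c (\<delta> a)) \<and>
     (\<forall>s t s' t'. \<forall>a\<in>E s t. \<forall>b\<in>E s' t'.
        \<delta> (mult a b) = mult (\<delta> a) b + sgn_deg (tot s t) (mult a (\<delta> b)))"

(* The derivation of this bidegree that is singled out by property P. *)
definition is_the_derivation ::
  "('k::comm_ring_1 \<Rightarrow> 'x::ab_group_add \<Rightarrow> 'x) \<Rightarrow> (int \<Rightarrow> int \<Rightarrow> 'x set) \<Rightarrow> ('x \<Rightarrow> 'x \<Rightarrow> 'x) \<Rightarrow>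
   int \<Rightarrow> int \<Rightarrow> (('x \<Rightarrow> 'x) \<Rightarrow> bool) \<Rightarrow> ('x \<Rightarrow> 'x) \<Rightarrow> bool" where
  "is_the_derivation scale E mult p q P \<delta> \<longleftrightarrow>
     graded_derivation scale E mult p q \<delta> \<and> P \<delta> \<and>
     (\<forall>\<delta>'. graded_derivation scale E mult p q \<delta>' \<and> P \<delta>' \<longrightarrow> (\<forall>s t. \<forall>a\<in>E s t. \<delta>' a = \<delta> a))"


section \<open>Spectral sequences\<close>

(* The quotient Z / B as a set of cosets; its zero is B, its addition is the sum of sets, and the
   other operations are induced as follows. *)
definition quot :: "'x::ab_group_add set \<Rightarrow> 'x set \<Rightarrow> 'x set set" where
  "quot Z B = (\<lambda>z. z +o B) ` Z"

definition quot_scale ::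
  "('k \<Rightarrow> 'x::ab_group_add \<Rightarrow> 'x) \<Rightarrow> 'x set \<Rightarrow> 'k \<Rightarrow> 'x set \<Rightarrow> 'x set" where
  "quot_scale scale B c X = (\<Union>x\<in>X. scale c x +o B)"

definition quot_mult ::
  "('x::ab_group_add \<Rightarrow> 'x \<Rightarrow> 'x) \<Rightarrow> 'x set \<Rightarrow> 'x set \<Rightarrow> 'x set \<Rightarrow> 'x set" where
  "quot_mult mult B X Y = (\<Union>x\<in>X. \<Union>y\<in>Y. mult x y +o B)"

(* A first quadrant spectral sequence whose pages are the subquotients E_r = Z_r / B_r of E_0.
   The assumptions kernel and image say that ker d_r = Z_(r+1) / B_r and im d_r = B_(r+1) / B_r,
   so that E_(r+1) is the homology of (E_r, d_r). *)
locale spectral_sequence = module scale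
  for scale :: "'k::comm_ring_1 \<Rightarrow> 'x::ab_group_add \<Rightarrow> 'x" +
  fixes Z B :: "nat \<Rightarrow> int \<Rightarrow> int \<Rightarrow> 'x set"
    and d :: "nat \<Rightarrow> int \<Rightarrow> int \<Rightarrow> 'x set \<Rightarrow> 'x set"
  assumes subspace_Z: "subspace (Z r s t)"
    and subspace_B: "subspace (B r s t)"
    and B_subset_Z: "B r s t \<subseteq> Z r s t"
    and first_quadrant: "s < 0 \<or> t < 0 \<Longrightarrow> quot (Z r s t) (B r s t) = {B r s t}"
    and diff_in: "X \<in> quot (Z r s t) (B r s t) \<Longrightarrow>
      d r s t X \<in> quot (Z r (s + int r) (t - (2 * int r - 1))) (B r (s + int r) (t - (2 * int r - 1)))"
    and diff_add: "\<lbrakk>X \<in> quot (Z r s t) (B r s t); Y \<in> quot (Z r s t) (B r s t)\<rbrakk> \<Longrightarrow>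
      d r s t (X + Y) = d r s t X + d r s t Y"
    and diff_scale: "X \<in> quot (Z r s t) (B r s t) \<Longrightarrow>
      d r s t (quot_scale scale (B r s t) c X) =
      quot_scale scale (B r (s + int r) (t - (2 * int r - 1))) c (d r s t X)"
    and diff_diff: "X \<in> quot (Z r s t) (B r s t) \<Longrightarrow>
      d r (s + int r) (t - (2 * int r - 1)) (d r s t X) =
      B r (s + 2 * int r) (t - 2 * (2 * int r - 1))"
    and kernel: "Z (Suc r) s t =
      {z \<in> Z r s t. d r s t (z +o B r s t) = B r (s + int r) (t - (2 * int r - 1))}"
    and image: "B (Suc r) (s + int r) (t - (2 * int r - 1)) =
      \<Union> (d r s t ` quot (Z r s t) (B r s t))"

(* The product of E_0 induces products on all pages, for which the d_r are derivations. *)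
locale multiplicative_spectral_sequence = spectral_sequence scale Z B d
  for scale :: "'k::comm_ring_1 \<Rightarrow> 'x::ab_group_add \<Rightarrow> 'x"
    and Z B :: "nat \<Rightarrow> int \<Rightarrow> int \<Rightarrow> 'x set"
    and d :: "nat \<Rightarrow> int \<Rightarrow> int \<Rightarrow> 'x set \<Rightarrow> 'x set" +
  fixes mult :: "'x \<Rightarrow> 'x \<Rightarrow> 'x"  (infixl \<open>\<star>\<close> 70)
  assumes mult_Z: "\<lbrakk>a \<in> Z r s t; b \<in> Z r s' t'\<rbrakk> \<Longrightarrow> a \<star> b \<in> Z r (s + s') (t + t')"
    and mult_B_left: "\<lbrakk>a \<in> B r s t; b \<in> Z r s' t'\<rbrakk> \<Longrightarrow> a \<star> b \<in> B r (s + s') (t + t')"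
    and mult_B_right: "\<lbrakk>a \<in> Z r s t; b \<in> B r s' t'\<rbrakk> \<Longrightarrow> a \<star> b \<in> B r (s + s') (t + t')"
    and diff_mult: "\<lbrakk>X \<in> quot (Z r s t) (B r s t); Y \<in> quot (Z r s' t') (B r s' t')\<rbrakk> \<Longrightarrow>
      d r (s + s') (t + t') (quot_mult (\<star>) (B r (s + s') (t + t')) X Y) =
      (let B' = B r (s + s' + int r) (t + t' - (2 * int r - 1)) in
        quot_mult (\<star>) B' (d r s t X) Y + sgn_deg (tot s t) ` quot_mult (\<star>) B' X (d r s' t' Y))"

definition Z_inf :: "(nat \<Rightarrow> int \<Rightarrow> int \<Rightarrow> 'x set) \<Rightarrow> int \<Rightarrow> int \<Rightarrow> 'x set" where
  "Z_inf Z s t = (\<Inter>r. Z r s t)"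

definition B_inf :: "(nat \<Rightarrow> int \<Rightarrow> int \<Rightarrow> 'x set) \<Rightarrow> int \<Rightarrow> int \<Rightarrow> 'x set" where
  "B_inf B s t = (\<Union>r. B r s t)"

(* A zig-zag z_0, ..., z_(r-1) of length r > 0 that starts in bidegree (s, t): all components of
   (d0 + d1) (z_0 + ... + z_(r-1)) vanish, except possibly d1 z_(r-1).  Then z_0 survives to E_r,
   and d_r maps its class to that of d1 z_(r-1). *)
definition zigzag ::
  "(int \<Rightarrow> int \<Rightarrow> 'x::ab_group_add set) \<Rightarrow> ('x \<Rightarrow> 'x) \<Rightarrow> ('x \<Rightarrow> 'x) \<Rightarrow> nat \<Rightarrow> int \<Rightarrow> int \<Rightarrow>
   (nat \<Rightarrow> 'x) \<Rightarrow> bool" where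
  "zigzag E d0 d1 r s t z \<longleftrightarrow>
     (\<forall>i<r. z i \<in> E (s + int i) (t - 2 * int i)) \<and>
     d0 (z 0) = 0 \<and> (\<forall>i. Suc i < r \<longrightarrow> d1 (z i) + d0 (z (Suc i)) = 0)"

end

theory Submission
  imports Defs "HOL-Library.Multiset"
begin

text \<open>The spectral sequence is that of the double complex \<open>\<Lambda>\<^sup>t(L, S\<^sup>s)\<close> whose differentials are the
  Chevalley-Eilenberg differential \<open>d\<^sub>0\<close> and the Koszul differential \<open>d\<^sub>1\<close>, the derivation that
  sends \<open>x\<^sub>i\<close> to \<open>y\<^sub>i\<close>. The rows of \<open>d\<^sub>1\<close> form the Koszul complex of the variables
  \<open>y\<^sub>0, \<dots>, y\<^sub>n\<^sub>-\<^sub>1\<close> of a polynomial ring, which resolves the ground ring. Hence the total complex has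
  the cohomology of a point, and so does the limit of the spectral sequence.

  Forms are handled through contractions \<open>\<iota>\<^sub>u\<close> with a vector, that is, by recursion on the number
  of arguments. Contraction is an antiderivation of the shuffle product (\<open>wedge_Cons\<close>), so that
  associativity, graded commutativity and the Leibniz rules become inductions of a few lines which
  never mention shuffles. Cartan's formula \<open>\<iota>\<^sub>u d\<^sub>0 + d\<^sub>0 \<iota>\<^sub>u = L\<^sub>u\<close> turns the double sum that defines
  \<open>d\<^sub>0\<close> into such a recursion (\<open>CE_diff_eq_ce_diff\<close>), and \<open>d\<^sub>1\<close> is \<open>\<Sum>\<^sub>i y\<^sub>i \<iota>\<^sub>e\<^sub>i\<close>. Identities such as
  \<open>d\<^sub>0 d\<^sub>0 = 0\<close> and \<open>d\<^sub>0 d\<^sub>1 + d\<^sub>1 d\<^sub>0 = 0\<close> are then checked on generators only (\<open>Forms_induct\<close>), because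
  both sides are derivations; the same principle gives the uniqueness of \<open>d\<^sub>0\<close> and \<open>d\<^sub>1\<close>.

  The exactness of the Koszul differential (\<open>koszul_exact\<close>) rests on the homotopy of
  \<open>homotopy_formula\<close>, which divides by one variable \<open>y\<^sub>j\<close> at a time and never by an integer. It removes
  one pair \<open>x\<^sub>j, y\<^sub>j\<close> after the other until only constants remain.

  For an abstract double complex, cochains of the total complex are sequences
  \<open>z\<^sub>0, z\<^sub>1, \<dots>\<close> with \<open>z\<^sub>i\<close> in bidegree \<open>(s + i, t - 2 i)\<close>, and \<open>D\<close> is the total differential. A class
  \<open>z\<^sub>0\<close> survives to page \<open>r\<close> if it extends to a sequence whose first \<open>r\<close> components of \<open>D z\<close> vanish;
  the differential of that page sends it to the component number \<open>r\<close> of \<open>D z\<close>. That this is well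
  defined (\<open>D_boundary\<close>) and has the right kernel (\<open>Zpage_Suc_iff\<close>) are instances of \<open>D D = 0\<close>.
  Products of pages come from the convolution of sequences, for which \<open>D\<close> is a derivation
  (\<open>D_conv\<close>). A cocycle of the total complex outside total degree \<open>0\<close> is a coboundary
  (\<open>total_exact\<close>), which makes the limit page trivial there.\<close>

section \<open>Polynomials\<close>

definition mon_degree :: "nat \<Rightarrow> (nat \<Rightarrow>\<^sub>0 nat) \<Rightarrow> nat" where
  "mon_degree n m = (\<Sum>i<n. Poly_Mapping.lookup m i)"

definition monomials :: "nat \<Rightarrow> int \<Rightarrow> (nat \<Rightarrow>\<^sub>0 nat) set" where
  "monomials n s = {m. Poly_Mapping.keys m \<subseteq> {..<n} \<and> int (mon_degree n m) = s}"

lemma mon_degree_add: "mon_degree n (m + m') = mon_degree n m + mon_degree n m'"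
  by (simp add: mon_degree_def lookup_add sum.distrib)

lemma mon_degree_eq_0: "mon_degree n m = 0 \<longleftrightarrow> (\<forall>i<n. Poly_Mapping.lookup m i = 0)"
  by (auto simp: mon_degree_def)

lemma mon_degree_keys:
  assumes "Poly_Mapping.keys m \<subseteq> {..<n}"
  shows "(\<Sum>i\<in>Poly_Mapping.keys m. Poly_Mapping.lookup m i) = mon_degree n m"
  unfolding mon_degree_def using assms by (intro sum.mono_neutral_left) (auto simp: in_keys_iff)

lemma sym_power_iff: "p \<in> sym_power n s \<longleftrightarrow> Poly_Mapping.keys p \<subseteq> monomials n s"
  unfolding sym_power_def monomials_def subset_iff mem_Collect_eq Ball_def
  by (metis mon_degree_keys subset_iff)

lemma monomials_add:
  "m \<in> monomials n s \<Longrightarrow> m' \<in> monomials n s' \<Longrightarrow> m + m' \<in> monomials n (s + s')"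
  using Poly_Mapping.keys_add[of m m'] by (auto simp: monomials_def mon_degree_add)

lemma keys_sum_subset:
  "Poly_Mapping.keys (sum f A) \<subseteq> (\<Union>i\<in>A. Poly_Mapping.keys (f i))"
  by (induction A rule: infinite_finite_induct) (use Poly_Mapping.keys_add in fastforce)+

lemma zero_in_sym_power [simp]: "0 \<in> sym_power n s"
  by (simp add: sym_power_iff)

lemma add_in_sym_power: "p \<in> sym_power n s \<Longrightarrow> q \<in> sym_power n s \<Longrightarrow> p + q \<in> sym_power n s"
  using Poly_Mapping.keys_add[of p q] by (auto simp: sym_power_iff)

lemma uminus_in_sym_power: "p \<in> sym_power n s \<Longrightarrow> - p \<in> sym_power n s"
  by (simp add: sym_power_iff)

lemma diff_in_sym_power: "p \<in> sym_power n s \<Longrightarrow> q \<in> sym_power n s \<Longrightarrow> p - q \<in> sym_power n s"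
  using add_in_sym_power[of p n s "- q"] uminus_in_sym_power[of q n s] by simp

lemma sum_in_sym_power: "(\<And>i. i \<in> A \<Longrightarrow> f i \<in> sym_power n s) \<Longrightarrow> sum f A \<in> sym_power n s"
  using keys_sum_subset[of f A] by (fastforce simp: sym_power_iff)

lemma mult_in_sym_power:
  "p \<in> sym_power n s \<Longrightarrow> q \<in> sym_power n s' \<Longrightarrow> p * q \<in> sym_power n (s + s')"
  using keys_mult[of p q] by (fastforce simp: sym_power_iff intro: monomials_add)

lemma single_in_sym_power: "m \<in> monomials n s \<Longrightarrow> Poly_Mapping.single m c \<in> sym_power n s"
  by (simp add: sym_power_iff)

lemma pconst_in_sym_power [simp]: "pconst c \<in> sym_power n 0"
  unfolding pconst_def by (rule single_in_sym_power) (simp add: monomials_def mon_degree_eq_0)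

lemma pvar_monomial:
  assumes "i < n"
  shows "Poly_Mapping.single i 1 \<in> monomials n 1"
proof -
  have "mon_degree n (Poly_Mapping.single i 1) = 1"
    unfolding mon_degree_def lookup_single when_def using assms by (subst sum.delta') auto
  with assms show ?thesis by (simp add: monomials_def)
qed

lemma monomials_0:
  assumes "m \<in> monomials n 0"
  shows "m = 0"
proof (rule poly_mapping_eqI)
  fix i
  from assms have *: "Poly_Mapping.keys m \<subseteq> {..<n}" "\<forall>i<n. Poly_Mapping.lookup m i = 0"
    by (simp_all add: monomials_def mon_degree_eq_0)
  then show "Poly_Mapping.lookup m i = Poly_Mapping.lookup 0 i"
    by (cases "i < n") (auto simp: in_keys_iff)
qed

lemma pvar_in_sym_power: "i < n \<Longrightarrow> pvar i \<in> sym_power n 1"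
  unfolding pvar_def by (intro single_in_sym_power pvar_monomial)

lemma sym_power_neg: "s < 0 \<Longrightarrow> sym_power n s = {0}"
proof -
  assume "s < 0"
  then have "monomials n s = {}" by (auto simp: monomials_def)
  then show ?thesis by (auto simp: sym_power_iff)
qed

lemma pconst_hom:
  "pconst (a + b) = pconst a + pconst b" "pconst (a * b) = pconst a * pconst b"
  "pconst 0 = 0" "pconst 1 = 1" "pconst (- a) = - pconst a"
  by (simp_all add: pconst_def single_add mult_single single_uminus)

lemma pconst_diff: "pconst (a - b) = pconst a - pconst b"
  by (simp add: pconst_def single_diff)

lemma pconst_sum: "pconst (sum f A) = (\<Sum>i\<in>A. pconst (f i))"
  by (induction A rule: infinite_finite_induct) (simp_all add: pconst_hom)

lemma pconst_inj: "pconst a = pconst b \<longleftrightarrow> a = b"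
  unfolding pconst_def by (metis lookup_single_eq)

lemma poly_sum_singles:
  fixes p :: "'a \<Rightarrow>\<^sub>0 'b::comm_monoid_add"
  shows "p = (\<Sum>m\<in>Poly_Mapping.keys p. Poly_Mapping.single m (Poly_Mapping.lookup p m))"
  by (rule poly_mapping_eqI)
    (simp add: lookup_sum lookup_single when_def sum.delta' in_keys_iff)

lemma poly_add_induct [case_names zero single add]:
  fixes p :: "'a \<Rightarrow>\<^sub>0 'b::comm_monoid_add"
  assumes "P 0" and "\<And>m c. P (Poly_Mapping.single m c)"
    and "\<And>p q. P p \<Longrightarrow> P q \<Longrightarrow> P (p + q)"
  shows "P p"
proof -
  have "P (\<Sum>m\<in>A. Poly_Mapping.single m (Poly_Mapping.lookup p m))" for A
    by (induction A rule: infinite_finite_induct) (use assms in auto)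
  then show ?thesis by (metis poly_sum_singles)
qed

lemma sym_power_0: "p \<in> sym_power n 0 \<Longrightarrow> \<exists>c. p = pconst c"
proof -
  assume "p \<in> sym_power n 0"
  then have "Poly_Mapping.keys p \<subseteq> {0}"
    by (auto simp: sym_power_iff dest: monomials_0)
  then have "p = pconst (Poly_Mapping.lookup p 0)"
    by (intro poly_mapping_eqI) (auto simp: pconst_def lookup_single when_def in_keys_iff)
  then show ?thesis ..
qed

lemma pvar_mult_single:
  "pvar i * Poly_Mapping.single m c = Poly_Mapping.single (m + Poly_Mapping.single i 1) c"
  by (simp add: pvar_def mult_single add.commute)

lemma single_split:
  assumes "Poly_Mapping.lookup m i \<noteq> (0::nat)"
  shows "m = (m - Poly_Mapping.single i 1) + Poly_Mapping.single i 1"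
  by (rule poly_mapping_eqI)
     (use assms in \<open>auto simp: lookup_add lookup_minus lookup_single when_def\<close>)

text \<open>The polynomials of degree \<open>s\<close> are reached from the constants by multiplication with variables, so
  that a derivation on them is known once it is known on the variables.\<close>
lemma sym_power_induct [consumes 1, case_names zero const var add]:
  assumes "p \<in> sym_power n s"
    and zero: "\<And>s. Q s 0"
    and const: "\<And>c. Q 0 (pconst c)"
    and var: "\<And>i s p. i < n \<Longrightarrow> p \<in> sym_power n s \<Longrightarrow> Q s p \<Longrightarrow> Q (s + 1) (pvar i * p)"
    and add: "\<And>s p q. p \<in> sym_power n s \<Longrightarrow> q \<in> sym_power n s \<Longrightarrow> Q s p \<Longrightarrow> Q s q \<Longrightarrow> Q s (p + q)"
  shows "Q s p"
proof -
  have mon: "Q s (Poly_Mapping.single m c)" if "m \<in> monomials n s" for m s c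
    using that
  proof (induction "nat s" arbitrary: m s)
    case 0
    then have "s = 0" by (auto simp: monomials_def)
    moreover from 0 this have "m = 0"
      by (auto dest: monomials_0)
    ultimately show ?case using const[of c] by (simp add: pconst_def)
  next
    case (Suc k)
    then have "mon_degree n m \<noteq> 0"
      by (auto simp: monomials_def)
    then obtain i where i: "i < n" "Poly_Mapping.lookup m i \<noteq> 0"
      by (auto simp: mon_degree_eq_0)
    define m' where "m' = m - Poly_Mapping.single i 1"
    have m: "m = m' + Poly_Mapping.single i 1"
      unfolding m'_def by (rule single_split[OF i(2)])
    have keys: "Poly_Mapping.keys m' \<subseteq> Poly_Mapping.keys m"
      unfolding m'_def by (auto simp: in_keys_iff lookup_minus)
    have "mon_degree n m = mon_degree n m' + 1"
      using pvar_monomial[OF i(1)] unfolding m by (simp add: mon_degree_add monomials_def)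
    then have m': "m' \<in> monomials n (s - 1)" using Suc.prems keys
      by (auto simp: monomials_def)
    have "Q (s - 1) (Poly_Mapping.single m' c)"
      using Suc.hyps(1)[OF _ m'] Suc.hyps(2) by simp
    from var[OF i(1) single_in_sym_power[OF m'] this]
    show ?case by (simp add: pvar_mult_single m)
  qed
  have "Q s (\<Sum>m\<in>A. Poly_Mapping.single m (Poly_Mapping.lookup p m))"
    if "A \<subseteq> Poly_Mapping.keys p" for A
    using finite_subset[OF that finite_keys] that
  proof (induction A rule: finite_induct)
    case empty
    show ?case by (simp add: zero)
  next
    case (insert m A)
    have sub: "\<And>m'. m' \<in> insert m A \<Longrightarrow> m' \<in> monomials n s"
      using insert.prems assms(1) by (auto simp: sym_power_iff)
    show ?case using insert sub
      by (simp, intro add mon single_in_sym_power sum_in_sym_power) auto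
  qed
  from this[OF subset_refl] show ?thesis using poly_sum_singles[of p] by simp
qed

subsection \<open>Partial derivatives\<close>

lemma sum_keys_extend:
  assumes "finite A" "Poly_Mapping.keys p \<subseteq> A" "\<And>m. f m 0 = 0"
  shows "(\<Sum>m\<in>Poly_Mapping.keys p. f m (Poly_Mapping.lookup p m)) = (\<Sum>m\<in>A. f m (Poly_Mapping.lookup p m))"
  using assms by (intro sum.mono_neutral_left) (auto simp: in_keys_iff)

text \<open>The sum over the keys of \<open>p + q\<close> can be extended to all keys of \<open>p\<close> and of \<open>q\<close>, where its terms
  are additive in the coefficient.\<close>
lemma partial_deriv_add: "partial_deriv i (p + q) = partial_deriv i p + partial_deriv i q"
proof -
  let ?A = "Poly_Mapping.keys p \<union> Poly_Mapping.keys q"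
  let ?f = "\<lambda>m c. Poly_Mapping.single (m - Poly_Mapping.single i 1) (of_nat (Poly_Mapping.lookup m i) * c)"
  have "partial_deriv i r = (\<Sum>m\<in>?A. ?f m (Poly_Mapping.lookup r m))" if "Poly_Mapping.keys r \<subseteq> ?A" for r
    unfolding partial_deriv_def by (rule sum_keys_extend) (use that in auto)
  from this[of p] this[of q] this[of "p + q"] show ?thesis
    using Poly_Mapping.keys_add[of p q]
    by (simp add: lookup_add distrib_left single_add sum.distrib del: One_nat_def)
qed

lemma partial_deriv_0 [simp]: "partial_deriv i 0 = 0"
  by (simp add: partial_deriv_def)

lemma partial_deriv_single:
  "partial_deriv i (Poly_Mapping.single m c) =
   Poly_Mapping.single (m - Poly_Mapping.single i 1) (of_nat (Poly_Mapping.lookup m i) * c)"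
  by (simp add: partial_deriv_def)

lemma partial_deriv_mult:
  "partial_deriv i (p * q) = partial_deriv i p * q + p * partial_deriv i q"
proof (induction p rule: poly_add_induct)
  case (add p p')
  then show ?case by (simp add: partial_deriv_add algebra_simps)
next
  case (single m c)
  show ?case
  proof (induction q rule: poly_add_induct)
    case (single m' c')
    have shift: "(m - Poly_Mapping.single i 1) + m' = m + m' - Poly_Mapping.single i 1"
      if "Poly_Mapping.lookup m i \<noteq> 0" for m m' :: "nat \<Rightarrow>\<^sub>0 nat"
      by (rule poly_mapping_eqI)
         (use that in \<open>auto simp: lookup_add lookup_minus lookup_single when_def\<close>)
    have "partial_deriv i (Poly_Mapping.single m c) * Poly_Mapping.single m' c' =
        Poly_Mapping.single (m + m' - Poly_Mapping.single i 1) (of_nat (Poly_Mapping.lookup m i) * c * c')"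
      by (cases "Poly_Mapping.lookup m i = 0") (simp_all add: partial_deriv_single mult_single shift del: One_nat_def)
    moreover have "Poly_Mapping.single m c * partial_deriv i (Poly_Mapping.single m' c') =
        Poly_Mapping.single (m + m' - Poly_Mapping.single i 1) (of_nat (Poly_Mapping.lookup m' i) * c * c')"
      using shift[of m' m]
      by (cases "Poly_Mapping.lookup m' i = 0")
         (simp_all add: partial_deriv_single mult_single ac_simps del: One_nat_def)
    ultimately show ?case
      by (simp add: mult_single partial_deriv_single lookup_add algebra_simps single_add)
  qed (simp_all add: partial_deriv_add algebra_simps)
qed simp

lemma partial_deriv_pconst [simp]: "partial_deriv i (pconst c) = 0"
  by (simp add: pconst_def partial_deriv_single)

lemma partial_deriv_pvar: "partial_deriv i (pvar j) = (if i = j then 1 else 0)"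
  by (auto simp: pvar_def partial_deriv_single lookup_single)

subsection \<open>Division by a variable\<close>

text \<open>On monomials that contain the variable \<open>y\<^sub>j\<close> this divides by \<open>y\<^sub>j\<close>; the other monomials are sent to
  \<open>0\<close>. Thus \<open>p - y\<^sub>j * var_quot j p\<close> is \<open>p\<close> evaluated at \<open>y\<^sub>j = 0\<close>.\<close>
definition var_quot :: "nat \<Rightarrow> 'k::comm_ring_1 mpoly \<Rightarrow> 'k mpoly" where
  "var_quot j p = Poly_Mapping.map_key (\<lambda>m. m + Poly_Mapping.single j 1) p"

lemma inj_shift: "inj (\<lambda>m :: nat \<Rightarrow>\<^sub>0 nat. m + Poly_Mapping.single j 1)"
  by (simp add: inj_on_def)

lemma lookup_var_quot:
  "Poly_Mapping.lookup (var_quot j p) m = Poly_Mapping.lookup p (m + Poly_Mapping.single j 1)"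
  by (simp add: var_quot_def map_key.rep_eq[OF inj_shift] del: One_nat_def)

lemma var_quot_add: "var_quot j (p + q) = var_quot j p + var_quot j q"
  by (rule poly_mapping_eqI) (simp add: lookup_var_quot lookup_add)

lemma var_quot_0 [simp]: "var_quot j 0 = 0"
  by (rule poly_mapping_eqI) (simp add: lookup_var_quot)

lemma var_quot_diff: "var_quot j (p - q) = var_quot j p - var_quot j q"
  by (rule poly_mapping_eqI) (simp add: lookup_var_quot lookup_minus)

lemma var_quot_sum: "var_quot j (sum f A) = (\<Sum>i\<in>A. var_quot j (f i))"
  by (induction A rule: infinite_finite_induct) (simp_all add: var_quot_add)

lemma var_quot_commute: "var_quot i (var_quot j p) = var_quot j (var_quot i p)"
  by (rule poly_mapping_eqI) (simp add: lookup_var_quot ac_simps)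

lemma var_quot_pvar_same [simp]: "var_quot j (pvar j * p) = p"
proof (induction p rule: poly_add_induct)
  case (single m c)
  show ?case unfolding pvar_mult_single var_quot_def by (rule map_key_single[OF inj_shift])
qed (simp_all add: distrib_left var_quot_add)

lemma var_quot_single:
  "var_quot j (Poly_Mapping.single m c) =
    (if Poly_Mapping.lookup m j = 0 then 0 else Poly_Mapping.single (m - Poly_Mapping.single j 1) c)"
proof (cases "Poly_Mapping.lookup m j = 0")
  case True
  then have "m \<noteq> m' + Poly_Mapping.single j 1" for m'
    by (auto simp: lookup_add)
  with True show ?thesis
    by (intro poly_mapping_eqI) (auto simp: lookup_var_quot lookup_single when_def)
next
  case False
  with single_split[OF False] map_key_single[OF inj_shift, of j "m - Poly_Mapping.single j 1" c]
  show ?thesis by (simp add: var_quot_def)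
qed

lemma var_quot_pconst [simp]: "var_quot j (pconst c * p) = pconst c * var_quot j p"
proof (induction p rule: poly_add_induct)
  case (single m a)
  show ?case by (simp add: pconst_def mult_single var_quot_single)
qed (simp_all add: distrib_left var_quot_add)

lemma var_quot_pvar:
  assumes "i \<noteq> j"
  shows "var_quot j (pvar i * p) = pvar i * var_quot j p"
proof (induction p rule: poly_add_induct)
  case (single m c)
  have "m - Poly_Mapping.single j 1 + Poly_Mapping.single i 1 =
      m + Poly_Mapping.single i 1 - Poly_Mapping.single j (1::nat)"
    by (rule poly_mapping_eqI)
       (use assms in \<open>auto simp: lookup_add lookup_minus lookup_single when_def\<close>)
  then show ?case unfolding pvar_mult_single
    using assms by (simp add: var_quot_single pvar_mult_single lookup_add lookup_single when_def)
qed (simp_all add: distrib_left var_quot_add)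

lemma var_quot_in_sym_power:
  assumes "p \<in> sym_power n s" "j < n"
  shows "var_quot j p \<in> sym_power n (s - 1)"
  unfolding sym_power_iff
proof
  fix m assume "m \<in> Poly_Mapping.keys (var_quot j p)"
  then have "m + Poly_Mapping.single j 1 \<in> monomials n s"
    using assms(1) by (auto simp: sym_power_iff in_keys_iff lookup_var_quot)
  moreover have "Poly_Mapping.keys m \<subseteq> Poly_Mapping.keys (m + Poly_Mapping.single j 1)"
    by (auto simp: in_keys_iff lookup_add)
  ultimately show "m \<in> monomials n (s - 1)"
    using pvar_monomial[OF assms(2)]
    by (auto simp: monomials_def mon_degree_add)
qed

lemma partial_deriv_in_sym_power:
  assumes "p \<in> sym_power n s" "i < n"
  shows "partial_deriv i p \<in> sym_power n (s - 1)"
  using assms(1)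
proof (induction rule: sym_power_induct)
  case (var j s p)
  have "pvar j * partial_deriv i p \<in> sym_power n (1 + (s - 1))"
    using var by (intro mult_in_sym_power pvar_in_sym_power)
  then show ?case using var
    by (auto simp: partial_deriv_mult partial_deriv_pvar intro: add_in_sym_power)
qed (auto simp: partial_deriv_add intro: add_in_sym_power)

text \<open>A quotient \<open>var_quot j p\<close> vanishes only if \<open>y\<^sub>j\<close> does not occur in \<open>p\<close>; without any variable, \<open>p\<close> is a
  constant, of degree \<open>0\<close>.\<close>
lemma sym_power_no_vars:
  assumes "p \<in> sym_power n s" "\<And>j. j < n \<Longrightarrow> var_quot j p = 0" "s \<noteq> 0"
  shows "p = 0"
proof (rule ccontr)
  assume "p \<noteq> 0"
  then obtain m where m: "m \<in> Poly_Mapping.keys p" by fastforce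
  then have "m \<in> monomials n s" using assms(1) by (auto simp: sym_power_iff)
  then have "mon_degree n m \<noteq> 0"
    using assms(3) by (auto simp: monomials_def)
  then obtain i where i: "i < n" "Poly_Mapping.lookup m i \<noteq> 0"
    by (auto simp: mon_degree_eq_0)
  then have "Poly_Mapping.lookup (var_quot i p) (m - Poly_Mapping.single i 1) = Poly_Mapping.lookup p m"
    using single_split[OF i(2)] by (simp add: lookup_var_quot)
  with m i assms(2)[of i] show False by (simp add: in_keys_iff)
qed

section \<open>Contraction and the product of forms\<close>

definition contract :: "'l \<Rightarrow> ('l, 'k::comm_ring_1) form \<Rightarrow> ('l, 'k) form" where
  "contract u a = (\<lambda>us. a (u # us))"

text \<open>A form with the sign that an odd operator picks up when it passes the form. The sign is read off from
  each list of arguments, so that the sign rules also make sense for inhomogeneous forms.\<close>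
definition bar :: "('l, 'k::comm_ring_1) form \<Rightarrow> ('l, 'k) form" where
  "bar a = (\<lambda>us. (-1) ^ length us * a us)"

lemma contract_simps [simp]:
  "contract u (a + b) = contract u a + contract u b"
  "contract u (a - b) = contract u a - contract u b"
  "contract u (- a) = - contract u a"
  "contract u 0 = 0"
  "contract u (form_scale c a) = form_scale c (contract u a)"
  by (auto simp: contract_def form_scale_def)

lemma bar_simps:
  "bar (a + b) = bar a + bar b"
  "bar (- a) = - bar a"
  "bar (bar a) = a"
  "contract u (bar a) = - bar (contract u a)"
  by (auto simp: bar_def contract_def algebra_simps simp flip: power_add power_mult_distrib)

lemma wedge_add:
  "wedge (a + b) c = wedge a c + wedge b c" "wedge c (a + b) = wedge c a + wedge c b"
  by (auto simp: wedge_def distrib_left distrib_right sum.distrib)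

lemma wedge_uminus: "wedge (- a) c = - wedge a c" "wedge c (- a) = - wedge c a"
  by (auto simp: wedge_def sum_negf)

lemma wedge_diff:
  "wedge (a - b) c = wedge a c - wedge b c" "wedge c (a - b) = wedge c a - wedge c b"
  by (simp_all only: diff_conv_add_uminus wedge_add wedge_uminus)

lemma wedge_0 [simp]: "wedge 0 c = 0" "wedge c 0 = 0"
  by (auto simp: wedge_def)

lemma wedge_sum:
  "wedge (sum f A) c = (\<Sum>i\<in>A. wedge (f i) c)" "wedge c (sum f A) = (\<Sum>i\<in>A. wedge c (f i))"
  by (induction A rule: infinite_finite_induct) (simp_all add: wedge_add)

lemma wedge_poly_mult:
  "wedge (\<lambda>us. p * a us) b = (\<lambda>us. p * wedge a b us)"
  "wedge a (\<lambda>us. p * b us) = (\<lambda>us. p * wedge a b us)"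
  by (auto simp: wedge_def sum_distrib_left ac_simps)

lemma wedge_form_scale:
  "wedge (form_scale c a) b = form_scale c (wedge a b)"
  "wedge a (form_scale c b) = form_scale c (wedge a b)"
  by (simp_all add: form_scale_def wedge_poly_mult)

lemma wedge_Nil: "wedge a b [] = a [] * b []"
proof -
  have "{(i, j). i \<in> {} \<and> j \<in> {..<0} - {} \<and> j < i} = ({} :: (nat \<times> nat) set)" by auto
  then show ?thesis by (simp add: wedge_def)
qed

text \<open>Contraction is an antiderivation: in a shuffle the first argument goes either to the first
  factor or to the second, and in the latter case it has to pass all the arguments of the first
  factor. Together with \<open>wedge_Nil\<close> this determines the product by recursion, and the sum over
  shuffles is not needed for further identities.\<close>
lemma wedge_Cons:
  "wedge a b (u # us) = wedge (contract u a) b us + wedge (bar a) (contract u b) us"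
proof -
  define m where "m = length us"
  define inv where "inv k I = {(i, j). i \<in> I \<and> j \<in> {..<k} - I \<and> j < i}" for k and I :: "nat set"
  define f where "f I = (-1) ^ card (inv (Suc m) I) *
    (a (nths (u # us) I) * b (nths (u # us) (- I)))" for I
  \<comment> \<open>The sets of positions are split according to whether they contain the position 0.\<close>
  have Pow_eq: "Pow {..<Suc m} = (\<lambda>J. insert 0 (Suc ` J)) ` Pow {..<m} \<union> (\<lambda>J. Suc ` J) ` Pow {..<m}"
  proof (intro equalityI subsetI)
    fix I assume "I \<in> Pow {..<Suc m}"
    then have I: "I \<subseteq> {..<Suc m}" by simp
    define J where "J = {j. Suc j \<in> I}"
    have "J \<in> Pow {..<m}" using I by (auto simp: J_def)
    moreover have "I = (if 0 \<in> I then insert 0 (Suc ` J) else Suc ` J)"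
      by (auto simp: J_def image_iff) (metis not0_implies_Suc)+
    ultimately show "I \<in> (\<lambda>J. insert 0 (Suc ` J)) ` Pow {..<m} \<union> (\<lambda>J. Suc ` J) ` Pow {..<m}"
      by (metis UnCI image_eqI)
  qed auto
  have inj1: "inj_on (\<lambda>J. insert 0 (Suc ` J)) (Pow {..<m})"
    by (rule inj_onI) (metis Diff_insert_absorb imageE inj_Suc inj_image_eq_iff nat.distinct(1))
  have inj2: "inj_on (\<lambda>J. Suc ` J) (Pow {..<m})"
    by (rule inj_onI) (metis inj_Suc inj_image_eq_iff)
  have split: "sum f (Pow {..<Suc m}) =
      (\<Sum>J\<in>Pow {..<m}. f (insert 0 (Suc ` J))) + (\<Sum>J\<in>Pow {..<m}. f (Suc ` J))"
    unfolding Pow_eq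
    by (subst sum.union_disjoint) (auto simp: sum.reindex[OF inj1] sum.reindex[OF inj2])
  have fin: "finite (inv k J)" if "J \<subseteq> {..<m}" for k J
    by (rule finite_subset[of _ "{..<m} \<times> {..<k}"]) (use that in \<open>auto simp: inv_def\<close>)
  have inj_SucSuc: "inj (map_prod Suc Suc)" by (simp add: prod.inj_map)
  have f1: "f (insert 0 (Suc ` J)) =
      (-1) ^ card (inv m J) * (contract u a (nths us J) * b (nths us (- J)))"
    if J: "J \<subseteq> {..<m}" for J
  proof -
    have "inv (Suc m) (insert 0 (Suc ` J)) = map_prod Suc Suc ` inv m J"
    proof (intro equalityI subsetI)
      fix p assume "p \<in> inv (Suc m) (insert 0 (Suc ` J))"
      then obtain i j where "p = (Suc i, j)" "i \<in> J" "j < Suc m" "j \<noteq> 0" "j \<notin> Suc ` J" "j < Suc i"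
        by (auto simp: inv_def)
      then have "p = map_prod Suc Suc (i, j - 1)" "(i, j - 1) \<in> inv m J"
        by (auto simp: inv_def image_iff)
      then show "p \<in> map_prod Suc Suc ` inv m J" by blast
    qed (auto simp: inv_def)
    then have "card (inv (Suc m) (insert 0 (Suc ` J))) = card (inv m J)"
      by (simp add: card_image[OF inj_on_subset[OF inj_SucSuc subset_UNIV]])
    moreover have "{j. Suc j \<in> insert 0 (Suc ` J)} = J" "{j. Suc j \<in> - insert 0 (Suc ` J)} = - J"
      by auto
    ultimately show ?thesis by (simp add: f_def nths_Cons contract_def)
  qed
  have f2: "f (Suc ` J) =
      (-1) ^ card (inv m J) * (bar a (nths us J) * contract u b (nths us (- J)))"
    if J: "J \<subseteq> {..<m}" for J
  proof -
    have "inv (Suc m) (Suc ` J) = map_prod Suc Suc ` inv m J \<union> (\<lambda>i. (Suc i, 0)) ` J"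
    proof (intro equalityI subsetI)
      fix p assume "p \<in> inv (Suc m) (Suc ` J)"
      then obtain i j where p: "p = (Suc i, j)" "i \<in> J" "j < Suc m" "j \<notin> Suc ` J" "j < Suc i"
        by (auto simp: inv_def)
      show "p \<in> map_prod Suc Suc ` inv m J \<union> (\<lambda>i. (Suc i, 0)) ` J"
      proof (cases j)
        case (Suc j')
        with p have "p = map_prod Suc Suc (i, j')" "(i, j') \<in> inv m J" by (auto simp: inv_def)
        then show ?thesis by blast
      qed (use p in auto)
    qed (use J in \<open>auto simp: inv_def\<close>)
    then have "card (inv (Suc m) (Suc ` J)) = card (inv m J) + card J"
      using fin[OF J] finite_subset[OF J]
      by (simp only:, subst card_Un_disjoint)
         (auto simp: card_image[OF inj_on_subset[OF inj_SucSuc subset_UNIV]] card_image inj_on_def)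
    moreover have "card J = length (nths us J)"
    proof -
      have "{i. i < length us \<and> i \<in> J} = J" using J by (auto simp: m_def)
      then show ?thesis by (simp add: length_nths)
    qed
    moreover have "{j. Suc j \<in> Suc ` J} = J" "{j. Suc j \<in> - Suc ` J} = - J"
      by auto
    ultimately show ?thesis
      by (simp add: f_def nths_Cons contract_def bar_def image_iff power_add mult.assoc)
  qed
  have "wedge a b (u # us) = sum f (Pow {..<Suc m})"
    by (simp add: wedge_def f_def inv_def m_def)
  also have "\<dots> = wedge (contract u a) b us + wedge (bar a) (contract u b) us"
    unfolding split by (simp add: f1 f2 wedge_def inv_def m_def)
  finally show ?thesis .
qed

lemma contract_wedge:
  "contract u (wedge a b) = wedge (contract u a) b + wedge (bar a) (contract u b)"
  by (rule ext) (simp add: contract_def[of u "wedge a b"] wedge_Cons)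

lemma bar_wedge: "bar (wedge a b) = wedge (bar a) (bar b)"
proof
  fix us
  show "bar (wedge a b) us = wedge (bar a) (bar b) us"
  proof (induction us arbitrary: a b)
    case Nil
    show ?case by (simp add: bar_def wedge_Nil)
  next
    case (Cons u us)
    have "bar (wedge a b) (u # us) = - bar (contract u (wedge a b)) us"
      by (simp add: bar_def contract_def)
    then show ?case
      by (simp add: contract_wedge bar_simps wedge_Cons wedge_uminus Cons)
  qed
qed

lemma wedge_assoc: "wedge (wedge a b) c = wedge a (wedge b c)"
proof
  fix us
  show "wedge (wedge a b) c us = wedge a (wedge b c) us"
    by (induction us arbitrary: a b c)
       (simp_all add: wedge_Nil wedge_Cons contract_wedge bar_wedge wedge_add mult.assoc add.assoc)
qed

lemma contract_poly_form [simp]: "contract u (poly_form p) = 0"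
  by (auto simp: contract_def poly_form_def)

lemma bar_poly_form [simp]: "bar (poly_form p) = poly_form p"
  by (auto simp: bar_def poly_form_def)

lemma wedge_poly_form: "wedge (poly_form p) a = (\<lambda>us. p * a us)"
proof
  fix us
  show "wedge (poly_form p) a us = p * a us"
    by (induction us arbitrary: a) (simp_all add: wedge_Nil wedge_Cons, simp_all add: poly_form_def contract_def)
qed

lemma wedge_poly_form_right: "wedge a (poly_form p) = (\<lambda>us. p * a us)"
proof
  fix us
  show "wedge a (poly_form p) us = p * a us"
    by (induction us arbitrary: a) (simp_all add: wedge_Nil wedge_Cons, simp_all add: poly_form_def contract_def)
qed

lemma poly_form_hom:
  "poly_form (p + q) = poly_form p + poly_form q" "poly_form 0 = 0"
  "wedge (poly_form p) (poly_form q) = poly_form (p * q)"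
  "form_scale c (poly_form p) = poly_form (pconst c * p)"
  by (auto simp: wedge_poly_form form_scale_def, auto simp: poly_form_def)

subsection \<open>Homogeneous forms\<close>

definition hom_form :: "int \<Rightarrow> ('l, 'k::comm_ring_1) form \<Rightarrow> bool" where
  "hom_form t a \<longleftrightarrow> (\<forall>us. int (length us) \<noteq> t \<longrightarrow> a us = 0)"

lemma hom_form_contract: "hom_form t a \<Longrightarrow> hom_form (t - 1) (contract u a)"
  by (auto simp: hom_form_def contract_def)

lemma bar_hom_form: "hom_form t a \<Longrightarrow> bar a = sgn_deg t a"
proof
  fix us assume "hom_form t a"
  then show "bar a us = sgn_deg t a us"
    by (cases "int (length us) = t") (auto simp: hom_form_def bar_def sgn_deg_def)
qed

lemma hom_form_wedge:
  assumes "hom_form t a" "hom_form t' b"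
  shows "hom_form (t + t') (wedge a b)"
proof -
  have "wedge a b us = 0" if "int (length us) \<noteq> t + t'" for us
    using assms that
  proof (induction us arbitrary: a b t t')
    case Nil
    then have "t \<noteq> 0 \<or> t' \<noteq> 0" by auto
    then have "a [] = 0 \<or> b [] = 0" using Nil(1,2)
      unfolding hom_form_def by (metis add_0_left list.size(3) of_nat_0)
    then show ?case by (auto simp: wedge_Nil)
  next
    case (Cons u us)
    have "hom_form t (bar a)" using Cons.prems(1) by (simp add: hom_form_def bar_def)
    with Cons.IH[of "t - 1" "contract u a" t' b] Cons.IH[of t "bar a" "t' - 1" "contract u b"]
      Cons.prems show ?case by (simp add: wedge_Cons hom_form_contract)
  qed
  then show ?thesis by (simp add: hom_form_def)
qed

lemma sgn_deg_simps:
  "sgn_deg k x us = sgn_deg k (x us)"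
  "wedge (sgn_deg k a) b = sgn_deg k (wedge a b)"
  "wedge a (sgn_deg k b) = sgn_deg k (wedge a b)"
  by (simp_all add: sgn_deg_def wedge_uminus)

text \<open>Contracting both sides reduces the degree of one factor by one; the exponents
  \<open>(t - 1) t'\<close> and \<open>t + t (t' - 1)\<close> have the parities needed to reassemble the contraction of the other
  product.\<close>
lemma wedge_comm:
  assumes "hom_form t a" "hom_form t' b"
  shows "wedge a b = sgn_deg (t * t') (wedge b a)"
proof
  fix us
  show "wedge a b us = sgn_deg (t * t') (wedge b a) us"
    using assms
  proof (induction us arbitrary: a b t t')
    case Nil
    show ?case
    proof (cases "t = 0")
      case True
      then show ?thesis by (simp add: wedge_Nil sgn_deg_simps sgn_deg_def mult.commute)
    next
      case False
      with Nil have "a [] = 0" by (simp add: hom_form_def)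
      then show ?thesis by (simp add: wedge_Nil sgn_deg_simps sgn_deg_def)
    qed
  next
    case (Cons u us)
    have "wedge a b (u # us) = wedge (contract u a) b us + sgn_deg t (wedge a (contract u b) us)"
      by (simp add: wedge_Cons bar_hom_form[OF Cons.prems(1)] sgn_deg_simps)
    also have "\<dots> = sgn_deg ((t - 1) * t') (wedge b (contract u a) us) +
        sgn_deg t (sgn_deg (t * (t' - 1)) (wedge (contract u b) a us))"
      using Cons.IH[OF hom_form_contract[OF Cons.prems(1)] Cons.prems(2), of u]
        Cons.IH[OF Cons.prems(1) hom_form_contract[OF Cons.prems(2)], of u]
      by (simp add: sgn_deg_simps)
    also have "\<dots> = sgn_deg (t * t') (wedge (contract u b) a us + sgn_deg t' (wedge b (contract u a) us))"
      by (simp add: sgn_deg_def)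
    also have "\<dots> = sgn_deg (t * t') (wedge b a) (u # us)"
      by (simp add: wedge_Cons bar_hom_form[OF Cons.prems(2)] sgn_deg_simps)
    finally show ?case .
  qed
qed

section \<open>Multilinear and alternating forms\<close>

lemma multilinear_contract:
  assumes "multilinear scale a"
  shows "multilinear scale (contract w a)"
  unfolding multilinear_def contract_def
proof (intro conjI allI)
  fix us vs u v c
  show "a (w # us @ (u + v) # vs) = a (w # us @ u # vs) + a (w # us @ v # vs)"
    using assms[unfolded multilinear_def, THEN conjunct1, rule_format, of "w # us"] by simp
  show "a (w # us @ scale c u # vs) = pconst c * a (w # us @ u # vs)"
    using assms[unfolded multilinear_def, THEN conjunct2, rule_format, of "w # us"] by simp
qed

lemma multilinear_contract_linear:
  assumes "multilinear scale a"
  shows "contract (u + v) a = contract u a + contract v a"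
    and "contract (scale c u) a = form_scale c (contract u a)"
  using assms[unfolded multilinear_def, THEN conjunct1, rule_format, of "[]"]
    assms[unfolded multilinear_def, THEN conjunct2, rule_format, of "[]"]
  by (auto simp: contract_def form_scale_def)

lemma multilinear_bar: "multilinear scale a \<Longrightarrow> multilinear scale (bar a)"
  unfolding multilinear_def bar_def by (simp add: distrib_left ac_simps)

lemma multilinear_wedge:
  assumes "multilinear scale a" "multilinear scale b"
  shows "multilinear scale (wedge a b)"
  unfolding multilinear_def
proof (intro conjI allI)
  show "wedge a b (us @ (u + v) # vs) = wedge a b (us @ u # vs) + wedge a b (us @ v # vs)" for us u v vs
    using assms
    by (induction us arbitrary: a b)
       (simp_all add: wedge_Cons wedge_add multilinear_contract_linear multilinear_contract multilinear_bar)
  show "wedge a b (us @ scale c u # vs) = pconst c * wedge a b (us @ u # vs)" for us c u vs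
    using assms
    by (induction us arbitrary: a b)
       (simp_all add: wedge_Cons wedge_form_scale multilinear_contract_linear multilinear_contract
          multilinear_bar distrib_left, simp add: form_scale_def)
qed

lemma alternating_contract: "alternating a \<Longrightarrow> alternating (contract u a)"
  by (simp add: alternating_def contract_def)

lemma alternating_bar: "alternating a \<Longrightarrow> alternating (bar a)"
  by (simp add: alternating_def bar_def)

lemma alternating_contract_contract: "alternating a \<Longrightarrow> contract u (contract u a) = 0"
  by (auto simp: alternating_def contract_def)

lemma swap_adjacent:
  assumes ml: "multilinear scale a" and adj: "\<And>ps u qs. a (ps @ u # u # qs) = 0"
  shows "a (ps @ u # v # qs) = - a (ps @ v # u # qs)"
proof -
  have add: "a (ps @ (u + v) # qs) = a (ps @ u # qs) + a (ps @ v # qs)" for ps u v qs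
    using ml by (simp add: multilinear_def)
  have "0 = a (ps @ (u + v) # (u + v) # qs)" by (simp add: adj)
  also have "\<dots> = a (ps @ u # (u + v) # qs) + a (ps @ v # (u + v) # qs)" by (rule add)
  also have "\<dots> = a (ps @ u # v # qs) + a (ps @ v # u # qs)"
    using add[of "ps @ [u]" u v qs] add[of "ps @ [v]" u v qs] by (simp add: adj)
  finally show ?thesis by (simp add: eq_neg_iff_add_eq_0)
qed

text \<open>Only adjacent repetitions need to be tested, as equal arguments can be brought next to each
  other by adjacent swaps. This form of the condition is accessible to induction on the argument list.\<close>
lemma alternating_iff_adjacent:
  assumes "multilinear scale a"
  shows "alternating a \<longleftrightarrow> (\<forall>ps u qs. a (ps @ u # u # qs) = 0)"
proof
  assume adj: "\<forall>ps u qs. a (ps @ u # u # qs) = 0"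
  have *: "a (xs @ y # ys @ y # zs) = 0" for xs y ys zs
  proof (induction ys arbitrary: xs)
    case (Cons w ys)
    then show ?case
      using swap_adjacent[OF assms, of xs y w "ys @ y # zs"] adj Cons[of "xs @ [w]"] by simp
  qed (simp add: adj)
  show "alternating a"
    unfolding alternating_def
  proof (intro allI impI)
    fix us :: "'b list" assume "\<not> distinct us"
    then obtain xs y ys zs where "us = xs @ [y] @ ys @ [y] @ zs"
      using not_distinct_decomp by blast
    then show "a us = 0" using * by simp
  qed
qed (auto simp: alternating_def)

lemma alternating_swap:
  assumes "multilinear scale a" "alternating a"
  shows "a (ps @ u # v # qs) = - a (ps @ v # u # qs)"
  by (rule swap_adjacent[OF assms(1)]) (use assms(2) in \<open>simp add: alternating_def\<close>)

lemma contract_swap: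
  assumes "multilinear scale a" "alternating a"
  shows "contract u (contract v a) = - contract v (contract u a)"
  using alternating_swap[OF assms, of "[]" v u] by (auto simp: contract_def)

lemma alternating_move:
  assumes "multilinear scale a" "alternating a"
  shows "a (ps @ u # qs) = (-1) ^ length ps * a (u # ps @ qs)"
proof (induction ps arbitrary: qs rule: rev_induct)
  case (snoc w ps)
  have "a ((ps @ [w]) @ u # qs) = - a (ps @ u # w # qs)"
    unfolding append_assoc append.simps by (rule alternating_swap[OF assms])
  also have "\<dots> = (-1) ^ length (ps @ [w]) * a (u # (ps @ [w]) @ qs)"
    unfolding snoc[of "w # qs"] by simp
  finally show ?case .
qed simp

lemma alternating_wedge:
  assumes "multilinear scale a" "multilinear scale b" "alternating a" "alternating b"
  shows "alternating (wedge a b)"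
  unfolding alternating_iff_adjacent[OF multilinear_wedge[OF assms(1,2)]]
proof (intro allI)
  fix ps u qs
  show "wedge a b (ps @ u # u # qs) = 0"
    using assms(3,4)
  proof (induction ps arbitrary: a b)
    case Nil
    then show ?case
      by (simp add: wedge_Cons bar_simps wedge_uminus alternating_contract_contract)
  next
    case (Cons w ps)
    then show ?case
      by (simp add: wedge_Cons alternating_contract alternating_bar)
  qed
qed

lemma alt_forms_iff:
  "a \<in> alt_forms scale n s t \<longleftrightarrow>
    multilinear scale a \<and> alternating a \<and> hom_form t a \<and> (\<forall>us. a us \<in> sym_power n s)"
  by (simp add: alt_forms_def hom_form_def)

lemma neg_one_power_in_sym_power: "p \<in> sym_power n s \<Longrightarrow> (- 1) ^ k * p \<in> sym_power n s"
  by (cases "even k") (auto simp: uminus_in_sym_power)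

lemma wedge_in_alt_forms:
  assumes "a \<in> alt_forms scale n s t" "b \<in> alt_forms scale n s' t'"
  shows "wedge a b \<in> alt_forms scale n (s + s') (t + t')"
  using assms
  by (auto simp: alt_forms_iff intro: multilinear_wedge alternating_wedge hom_form_wedge)
     (auto simp: wedge_def intro!: sum_in_sym_power neg_one_power_in_sym_power mult_in_sym_power)

lemma poly_form_in_alt_forms: "p \<in> sym_power n s \<Longrightarrow> poly_form p \<in> alt_forms scale n s 0"
  by (auto simp: alt_forms_iff poly_form_def multilinear_def alternating_def hom_form_def)

lemma module_form_scale: "module (form_scale :: 'k::comm_ring_1 \<Rightarrow> ('l, 'k) form \<Rightarrow> ('l, 'k) form)"
  by unfold_locales (auto simp: form_scale_def pconst_hom algebra_simps)

interpretation forms: module "form_scale :: 'k::comm_ring_1 \<Rightarrow> ('l, 'k) form \<Rightarrow> ('l, 'k) form"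
  by (rule module_form_scale)

lemma form_scale_in_alt_forms:
  assumes "a \<in> alt_forms scale n s t"
  shows "form_scale c a \<in> alt_forms scale n s t"
  using assms mult_in_sym_power[OF pconst_in_sym_power[of c n], of _ s]
  by (auto simp: alt_forms_iff form_scale_def multilinear_def alternating_def hom_form_def
      mult.left_commute distrib_left)

lemma subspace_alt_forms: "module.subspace form_scale (alt_forms scale n s t)"
  by (rule forms.subspaceI)
     (auto simp: form_scale_in_alt_forms,
      auto simp: alt_forms_iff multilinear_def alternating_def hom_form_def add_in_sym_power algebra_simps)

lemma alt_forms_neg:
  fixes scale :: "'k::comm_ring_1 \<Rightarrow> 'l::ab_group_add \<Rightarrow> 'l"
  assumes "s < 0 \<or> t < 0"
  shows "alt_forms scale n s t = {0}"
proof -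
  have "a = 0" if "a \<in> alt_forms scale n s t" for a :: "('l, 'k) form"
    using that assms by (auto simp: alt_forms_iff hom_form_def sym_power_neg)
  moreover have "0 \<in> alt_forms scale n s t" by (rule forms.subspace_0[OF subspace_alt_forms])
  ultimately show ?thesis by auto
qed

lemma sgn_deg_even_cong: "even (k - l) \<Longrightarrow> sgn_deg k x = sgn_deg l x"
  by (auto simp: sgn_deg_def)

lemma bigraded_algebra_forms:
  fixes scale :: "'k::comm_ring_1 \<Rightarrow> 'l::ab_group_add \<Rightarrow> 'l"
  shows "bigraded_algebra form_scale (alt_forms scale n) wedge (poly_form 1)"
proof (unfold_locales)
  show "poly_form 1 \<in> alt_forms scale n 0 0"
    using poly_form_in_alt_forms[OF pconst_in_sym_power[of 1 n]] by (simp add: pconst_hom)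
  show "wedge a b = sgn_deg (tot s t * tot s' t') (wedge b a)"
    if "a \<in> alt_forms scale n s t" "b \<in> alt_forms scale n s' t'" for a b :: "('l, 'k) form" and s t s' t'
  proof -
    have "wedge a b = sgn_deg (t * t') (wedge b a)"
      using that by (intro wedge_comm) (auto simp: alt_forms_iff)
    also have "\<dots> = sgn_deg (tot s t * tot s' t') (wedge b a)"
      by (rule sgn_deg_even_cong) (simp add: tot_def)
    finally show ?thesis .
  qed
qed (simp_all add: subspace_alt_forms wedge_in_alt_forms wedge_assoc wedge_add wedge_form_scale
      wedge_poly_form wedge_poly_form_right)

lemma sum_fun_apply: "sum f A x = (\<Sum>i\<in>A. f i x)"
  by (induction A rule: infinite_finite_induct) simp_all

text \<open>Vanishing is invariant under permutations of the arguments, so that a form needs to be tested on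
  one ordering of each set of basis vectors only.\<close>
lemma alternating_perm_zero:
  assumes "multilinear scale a" "alternating a" "mset us = mset vs" "a vs = 0"
  shows "a us = 0"
  using assms
proof (induction us arbitrary: a vs)
  case (Cons u us)
  then have "u \<in> set vs" by (metis list.set_intros(1) mset_eq_setD)
  then obtain ps qs where vs: "vs = ps @ u # qs" by (meson split_list)
  have "a (ps @ u # qs) = (-1) ^ length ps * a (u # ps @ qs)"
    by (rule alternating_move[OF Cons.prems(1,2)])
  with Cons.prems(4) have "contract u a (ps @ qs) = 0"
    unfolding vs contract_def by (cases "even (length ps)") auto
  moreover have "mset us = mset (ps @ qs)" using Cons.prems(3) vs by simp
  ultimately have "contract u a us = 0"
    using Cons.IH multilinear_contract[OF Cons.prems(1)] alternating_contract[OF Cons.prems(2)] by blast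
  then show ?case by (simp add: contract_def)
qed simp

section \<open>Forms in coordinates\<close>

locale based_module = module scale
  for scale :: "'k::comm_ring_1 \<Rightarrow> 'l::ab_group_add \<Rightarrow> 'l" +
  fixes n :: nat and e :: "nat \<Rightarrow> 'l"
  assumes basis: "is_basis scale n e"
begin

abbreviation "crd \<equiv> coord scale n e"
abbreviation "X \<equiv> x_gen scale n e"
abbreviation "Forms \<equiv> alt_forms scale n"

lemma basis_facts: "inj_on e {..<n}" "independent (e ` {..<n})" "span (e ` {..<n}) = UNIV"
  using basis by (auto simp: is_basis_def)

lemma coord_e: "i < n \<Longrightarrow> j < n \<Longrightarrow> crd i (e j) = (if i = j then 1 else 0)"
  using basis_facts
  by (auto simp: coord_def representation_basis inj_on_eq_iff)

lemma coord_add: "crd i (u + v) = crd i u + crd i v"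
  using basis_facts by (simp add: coord_def representation_add)

lemma coord_scale: "crd i (scale c u) = c * crd i u"
  using basis_facts by (simp add: coord_def representation_scale)

lemma coord_expand: "v = (\<Sum>i<n. scale (crd i v) (e i))"
proof -
  have "v = (\<Sum>b\<in>e ` {..<n}. scale (representation (e ` {..<n}) v b) b)"
    by (rule sum_representation_eq[symmetric]) (use basis_facts in auto)
  also have "\<dots> = (\<Sum>i<n. scale (crd i v) (e i))"
    using basis_facts(1) by (simp add: sum.reindex coord_def)
  finally show ?thesis .
qed

lemma linear_expand:
  assumes "\<And>u v. \<alpha> (u + v) = \<alpha> u + \<alpha> v" "\<And>c u. \<alpha> (scale c u) = c * (\<alpha> u :: 'k)"
  shows "\<alpha> v = (\<Sum>i<n. crd i v * \<alpha> (e i))"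
proof -
  have [simp]: "\<alpha> 0 = 0" using assms(2)[of 0 0] by simp
  have "\<alpha> (\<Sum>i\<in>A. f i) = (\<Sum>i\<in>A. \<alpha> (f i))" for f and A :: "nat set"
    by (induction A rule: infinite_finite_induct) (simp_all add: assms)
  from this[of "\<lambda>i. scale (crd i v) (e i)" "{..<n}"] show ?thesis
    unfolding coord_expand[symmetric] assms(2) .
qed

lemma contract_expand:
  assumes "multilinear scale a"
  shows "contract v a = (\<Sum>i<n. form_scale (crd i v) (contract (e i) a))"
proof -
  note lin = multilinear_contract_linear[OF assms]
  have [simp]: "contract 0 a = 0" using lin(2)[of 0 0] by simp
  have "contract (\<Sum>i\<in>A. f i) a = (\<Sum>i\<in>A. contract (f i) a)" for f and A :: "nat set"
    by (induction A rule: infinite_finite_induct) (simp_all add: lin del: plus_fun_apply)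
  from this[of "\<lambda>i. scale (crd i v) (e i)" "{..<n}"] show ?thesis
    unfolding coord_expand[symmetric] lin(2) .
qed

lemma multilinear_zeroI:
  assumes "multilinear scale a" "\<And>js. set js \<subseteq> {..<n} \<Longrightarrow> a (map e js) = 0"
  shows "a us = 0"
  using assms
proof (induction us arbitrary: a)
  case Nil
  from Nil(2)[of "[]"] show ?case by simp
next
  case (Cons u us)
  have "contract (e i) a us = 0" if "i < n" for i
  proof (rule Cons.IH[OF multilinear_contract[OF Cons.prems(1)]])
    fix js assume "set js \<subseteq> {..<n}"
    with that Cons.prems(2)[of "i # js"] show "contract (e i) a (map e js) = 0"
      by (simp add: contract_def)
  qed
  then have "contract u a us = 0"
    unfolding contract_expand[OF Cons.prems(1), of u] by (simp add: sum_fun_apply form_scale_def)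
  then show ?case by (simp add: contract_def)
qed

text \<open>By linearity, the difference vanishes once it vanishes on sequences of basis vectors. Those
  with repetitions contribute nothing, and the others can be sorted.\<close>
lemma alt_forms_eqI:
  assumes a: "a \<in> Forms s t" and b: "b \<in> Forms s t"
    and eq: "\<And>js. sorted_wrt (<) js \<Longrightarrow> set js \<subseteq> {..<n} \<Longrightarrow> a (map e js) = b (map e js)"
  shows "a = b"
proof -
  define c where "c = a - b"
  have "c \<in> Forms s t"
    unfolding c_def by (rule forms.subspace_diff[OF subspace_alt_forms a b])
  then have c: "multilinear scale c" "alternating c" by (simp_all add: alt_forms_iff)
  have "c us = 0" for us
  proof (rule multilinear_zeroI[OF c(1)])
    fix js assume js: "set js \<subseteq> {..<n}"
    show "c (map e js) = 0"
    proof (cases "distinct js")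
      case True
      then have "sorted_wrt (<) (sort js)" by (simp add: strict_sorted_iff)
      then have "c (map e (sort js)) = 0" using eq[of "sort js"] js by (simp add: c_def)
      moreover have "mset (map e js) = mset (map e (sort js))" by simp
      ultimately show ?thesis using alternating_perm_zero[OF c] by metis
    next
      case False
      then have "\<not> distinct (map e js)" by (simp add: distinct_map)
      then show ?thesis using c(2) by (simp add: alternating_def)
    qed
  qed
  then show ?thesis by (auto simp: c_def)
qed

subsection \<open>Monomials in the generators\<close>

lemma x_gen_Nil [simp]: "X i [] = 0"
  by (simp add: x_gen_def)

lemma contract_x_gen: "contract u (X i) = poly_form (pconst (crd i u))"
  by (auto simp: contract_def x_gen_def poly_form_def)

lemma bar_x_gen: "bar (X i) = - X i"
  by (auto simp: bar_def x_gen_def)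

lemma x_gen_in_Forms: "X i \<in> Forms 0 1"
proof -
  have "multilinear scale (X i)"
    unfolding multilinear_def
    by (auto simp: x_gen_def coord_add coord_scale pconst_hom hd_append)
  moreover have "alternating (X i)"
    by (auto simp: alternating_def x_gen_def length_Suc_conv)
  ultimately show ?thesis
    by (simp add: alt_forms_iff hom_form_def) (simp add: x_gen_def)
qed

lemma y_gen_in_Forms: "i < n \<Longrightarrow> y_gen i \<in> Forms 1 0"
  unfolding y_gen_def by (intro poly_form_in_alt_forms pvar_in_sym_power)

lemma one_in_Forms: "poly_form 1 \<in> Forms 0 0"
  using poly_form_in_alt_forms[OF pconst_in_sym_power[of 1 n]] by (simp add: pconst_hom)

definition x_prod :: "nat list \<Rightarrow> ('l, 'k) form" where
  "x_prod is = foldr wedge (map X is) (poly_form 1)"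

lemma x_prod_simps: "x_prod [] = poly_form 1" "x_prod (i # is) = wedge (X i) (x_prod is)"
  by (simp_all add: x_prod_def)

lemma x_monomial_eq: "x_monomial scale n e I = x_prod (sorted_list_of_set I)"
  by (simp add: x_monomial_def x_prod_def)

lemma x_prod_in_Forms: "x_prod is \<in> Forms 0 (int (length is))"
proof (induction "is")
  case (Cons i "is")
  then show ?case
    using wedge_in_alt_forms[OF x_gen_in_Forms Cons, of i] by (simp add: x_prod_simps)
qed (simp add: x_prod_simps one_in_Forms)

lemma contract_x_wedge:
  "contract u (wedge (X i) b) = form_scale (crd i u) b - wedge (X i) (contract u b)"
  by (simp add: contract_wedge contract_x_gen wedge_poly_form bar_x_gen wedge_uminus form_scale_def
      fun_eq_iff)

lemma contract_x_prod:
  assumes "j < n" "set is \<subseteq> {..<n}" "j \<notin> set is"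
  shows "contract (e j) (x_prod is) = 0"
  using assms(2,3)
  by (induction "is") (auto simp: x_prod_simps contract_x_wedge coord_e assms(1))

lemma x_wedge_eval_zero:
  assumes "i < n" "set js \<subseteq> {..<n}" "i \<notin> set js"
  shows "wedge (X i) b (map e js) = 0"
  using assms(2,3)
proof (induction js arbitrary: b)
  case (Cons j js)
  have "wedge (X i) b (map e (j # js)) = contract (e j) (wedge (X i) b) (map e js)"
    by (simp add: contract_def)
  also have "\<dots> = 0"
    using Cons assms(1) by (simp add: contract_x_wedge coord_e)
  finally show ?case .
qed (simp add: wedge_Nil)

text \<open>The monomials are dual to the increasing sequences of basis vectors. Contraction with \<open>e j\<close> removes
  the leading factor \<open>X i\<close> if \<open>i = j\<close>. Otherwise one of the two lists starts with an index smaller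
  than all those of the other list, and the missing index makes the product vanish.\<close>
lemma x_prod_eval:
  assumes "sorted_wrt (<) is" "sorted_wrt (<) js" "set is \<subseteq> {..<n}" "set js \<subseteq> {..<n}"
  shows "x_prod is (map e js) = (if is = js then 1 else 0)"
  using assms
proof (induction "is" arbitrary: js)
  case Nil
  show ?case by (cases js) (simp_all add: x_prod_simps poly_form_def)
next
  case (Cons i is' js)
  show ?case
  proof (cases js)
    case (Cons j js')
    have *: "x_prod (i # is') (map e js) =
        (if i = j then x_prod is' (map e js') else 0) - wedge (X i) (contract (e j) (x_prod is')) (map e js')"
      using contract_x_wedge[of "e j" i "x_prod is'", THEN fun_cong, of "map e js'"] Cons.prems Cons
      by (auto simp: x_prod_simps contract_def[of _ "wedge _ _"] coord_e)
    have "wedge (X i) (contract (e j) (x_prod is')) (map e js') = 0"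
    proof (cases "i < j")
      case True
      then have "i \<notin> set js'" using Cons.prems(2) Cons by auto
      then show ?thesis using Cons.prems Cons by (intro x_wedge_eval_zero) auto
    next
      case False
      then have "j \<notin> set is'" using Cons.prems(1) by auto
      then have "contract (e j) (x_prod is') = 0" using Cons.prems Cons by (intro contract_x_prod) auto
      then show ?thesis by simp
    qed
    then show ?thesis unfolding * using Cons.IH[of js'] Cons.prems Cons by auto
  qed (simp add: x_prod_simps wedge_Nil)
qed

lemma expansion_eval:
  assumes "sorted_wrt (<) js" "set js \<subseteq> {..<n}"
  shows "(\<Sum>I\<in>Pow {..<n}. wedge (poly_form (p I)) (x_monomial scale n e I)) (map e js) = p (set js)"
proof -
  have "x_monomial scale n e I (map e js) = (if I = set js then 1 else 0)" if "I \<in> Pow {..<n}" for I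
  proof -
    have fin: "finite I" using that finite_subset by auto
    have "sorted_list_of_set I = js \<longleftrightarrow> I = set js"
      using fin assms(1) by (metis set_sorted_list_of_set sorted_list_of_set.idem_if_sorted_distinct strict_sorted_iff)
    then show ?thesis
      using x_prod_eval[of "sorted_list_of_set I" js] assms that fin by (simp add: x_monomial_eq)
  qed
  then have "(\<Sum>I\<in>Pow {..<n}. wedge (poly_form (p I)) (x_monomial scale n e I)) (map e js) =
      (\<Sum>I\<in>Pow {..<n}. if I = set js then p I else 0)"
    unfolding sum_fun_apply wedge_poly_form by (intro sum.cong) auto
  also have "\<dots> = p (set js)" using assms(2) by simp
  finally show ?thesis .
qed

lemma expansion_in_Forms:
  assumes "\<And>I. p I \<in> sym_power n s" "\<And>I. I \<subseteq> {..<n} \<Longrightarrow> int (card I) \<noteq> t \<Longrightarrow> p I = 0"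
    "I \<subseteq> {..<n}"
  shows "wedge (poly_form (p I)) (x_monomial scale n e I) \<in> Forms s t"
proof (cases "int (card I) = t")
  case True
  then show ?thesis
    using wedge_in_alt_forms[OF poly_form_in_alt_forms[OF assms(1)] x_prod_in_Forms, of I "sorted_list_of_set I"]
    by (simp add: x_monomial_eq)
next
  case False
  then show ?thesis using assms(2,3)
    by (simp add: poly_form_hom forms.subspace_0[OF subspace_alt_forms])
qed

text \<open>By duality with the monomials, the coefficients of the expansion of a form are its values.\<close>
definition coeff :: "('l, 'k) form \<Rightarrow> nat set \<Rightarrow> 'k mpoly" where
  "coeff a I = (if I \<subseteq> {..<n} then a (map e (sorted_list_of_set I)) else 0)"

lemma coeff_props:
  assumes "a \<in> Forms s t"
  shows "coeff a I \<in> sym_power n s" "\<not> (I \<subseteq> {..<n} \<and> int (card I) = t) \<Longrightarrow> coeff a I = 0"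
  using assms by (auto simp: coeff_def alt_forms_iff hom_form_def)

lemma expansion:
  assumes a: "a \<in> Forms s t"
  shows "a = (\<Sum>I\<in>Pow {..<n}. wedge (poly_form (coeff a I)) (x_monomial scale n e I))"
proof (rule alt_forms_eqI[OF a])
  show "(\<Sum>I\<in>Pow {..<n}. wedge (poly_form (coeff a I)) (x_monomial scale n e I)) \<in> Forms s t"
    using coeff_props[OF a]
    by (intro forms.subspace_sum[OF subspace_alt_forms] expansion_in_Forms) auto
  fix js assume js: "sorted_wrt (<) js" "set js \<subseteq> {..<n}"
  then have "sorted_list_of_set (set js) = js"
    by (metis sorted_list_of_set.idem_if_sorted_distinct strict_sorted_iff)
  then show "a (map e js) =
      (\<Sum>I\<in>Pow {..<n}. wedge (poly_form (coeff a I)) (x_monomial scale n e I)) (map e js)"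
    using js by (simp add: expansion_eval coeff_def)
qed

lemma expansion_unique:
  assumes a: "a \<in> Forms s t"
  shows "\<exists>!p. (\<forall>I. p I \<in> sym_power n s \<and> (\<not> (I \<subseteq> {..<n} \<and> int (card I) = t) \<longrightarrow> p I = 0)) \<and>
    a = (\<Sum>I\<in>Pow {..<n}. wedge (poly_form (p I)) (x_monomial scale n e I))"
proof (rule ex1I[of _ "coeff a"])
  fix p assume p: "(\<forall>I. p I \<in> sym_power n s \<and> (\<not> (I \<subseteq> {..<n} \<and> int (card I) = t) \<longrightarrow> p I = 0)) \<and>
    a = (\<Sum>I\<in>Pow {..<n}. wedge (poly_form (p I)) (x_monomial scale n e I))"
  show "p = coeff a"
  proof
    fix I
    show "p I = coeff a I"
    proof (cases "I \<subseteq> {..<n}")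
      case True
      then have "finite I" using finite_subset by auto
      then show ?thesis
        using expansion_eval[of "sorted_list_of_set I" p] True p
        by (simp add: coeff_def)
    qed (use p in \<open>auto simp: coeff_def\<close>)
  qed
qed (use coeff_props[OF a] expansion[OF a] in auto)

text \<open>This rule expresses that the algebra is generated by the \<open>x\<^sub>i\<close> and \<open>y\<^sub>i\<close>. It is used for
  properties that are stable under products, such as the equality of two derivations or the vanishing of
  the square of an odd derivation.\<close>
lemma Forms_induct [consumes 1, case_names one x y add scale wedge]:
  assumes a: "a \<in> Forms s t"
    and one: "Q (poly_form 1)"
    and x: "\<And>i. i < n \<Longrightarrow> Q (X i)"
    and y: "\<And>i. i < n \<Longrightarrow> Q (y_gen i)"
    and add: "\<And>s t a b. a \<in> Forms s t \<Longrightarrow> b \<in> Forms s t \<Longrightarrow> Q a \<Longrightarrow> Q b \<Longrightarrow> Q (a + b)"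
    and scale: "\<And>s t c a. a \<in> Forms s t \<Longrightarrow> Q a \<Longrightarrow> Q (form_scale c a)"
    and wedge: "\<And>s t s' t' a b. a \<in> Forms s t \<Longrightarrow> b \<in> Forms s' t' \<Longrightarrow> Q a \<Longrightarrow> Q b \<Longrightarrow> Q (wedge a b)"
  shows "Q a"
proof -
  have zero: "Q 0" using scale[OF one_in_Forms one, of 0] by simp
  have poly: "Q (poly_form p)" if "p \<in> sym_power n s" for p s
    using that
  proof (induction rule: sym_power_induct)
    case (const c)
    show ?case using scale[OF one_in_Forms one, of c] by (simp add: poly_form_hom)
  next
    case (var i s p)
    show ?case
      using wedge[OF y_gen_in_Forms poly_form_in_alt_forms y] var
      by (simp add: y_gen_def poly_form_hom)
  next
    case (add s p q)
    then show ?case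
      unfolding poly_form_hom using assms(5) poly_form_in_alt_forms by blast
  qed (simp only: poly_form_hom zero)
  have prod: "Q (x_prod is)" if "set is \<subseteq> {..<n}" for "is"
    using that
    by (induction "is") (auto simp: x_prod_simps one intro: wedge[OF x_gen_in_Forms x_prod_in_Forms x])
  have mon: "Q (wedge (poly_form (coeff a I)) (x_monomial scale n e I))" if "I \<subseteq> {..<n}" for I
    using that finite_subset[OF that] coeff_props(1)[OF a]
    by (auto simp: x_monomial_eq intro!: wedge[OF poly_form_in_alt_forms x_prod_in_Forms] poly prod)
  have "Q (\<Sum>I\<in>\<A>. wedge (poly_form (coeff a I)) (x_monomial scale n e I))"
    if "finite \<A>" "\<A> \<subseteq> Pow {..<n}" for \<A>
    using that
  proof (induction \<A> rule: finite_induct)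
    case (insert I \<A>)
    have mem: "wedge (poly_form (coeff a I)) (x_monomial scale n e I) \<in> Forms s t"
      if "I \<in> Pow {..<n}" for I
      using that coeff_props[OF a] by (intro expansion_in_Forms) auto
    show ?case using insert
      by (simp del: plus_fun_apply, intro add[of _ s t] mon forms.subspace_sum[OF subspace_alt_forms] mem) auto
  qed (simp add: zero)
  from this[of "Pow {..<n}"] show ?thesis using expansion[OF a] by simp
qed

end

section \<open>The Chevalley-Eilenberg differential\<close>

locale based_lie_algebra = lie_algebra scale bracket + based_module scale n e
  for scale :: "'k::comm_ring_1 \<Rightarrow> 'l::ab_group_add \<Rightarrow> 'l" and bracket n e
begin

abbreviation "act \<equiv> sym_action scale bracket n e"

lemma bracket_linear:
  "bracket (u + v) w = bracket u w + bracket v w" "bracket w (u + v) = bracket w u + bracket w v"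
  "bracket (scale c u) w = scale c (bracket u w)" "bracket w (scale c u) = scale c (bracket w u)"
  by (rule module_hom.add[OF bracket_hom_left] module_hom.add[OF bracket_hom_right]
      module_hom.scale[OF bracket_hom_left] module_hom.scale[OF bracket_hom_right])+

lemma bracket_skew: "bracket u v = - bracket v u"
proof -
  have "0 = bracket (u + v) (u + v)" by (simp only: bracket_self)
  also have "\<dots> = bracket u v + bracket v u" unfolding bracket_linear by (simp add: bracket_self)
  finally show ?thesis by (simp add: eq_neg_iff_add_eq_0)
qed

lemma coord_uminus: "crd i (- v) = - crd i v"
  using coord_scale[of i "-1" v] by simp

subsection \<open>The action on polynomials\<close>

lemma act_add: "act u (p + q) = act u p + act u q"
  by (simp add: sym_action_def partial_deriv_add distrib_right sum.distrib)

lemma act_pconst [simp]: "act u (pconst c) = 0" "act u 0 = 0"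
  by (simp_all add: sym_action_def)

lemma act_mult: "act u (p * q) = act u p * q + p * act u q"
  by (simp add: sym_action_def partial_deriv_mult sum_distrib_left sum_distrib_right sum.distrib
      algebra_simps)

lemma act_pconst_mult: "act u (pconst c * p) = pconst c * act u p"
  by (simp add: act_mult)

lemma act_uminus: "act u (- p) = - act u p"
  using act_pconst_mult[of u "-1" p] by (simp add: pconst_hom)

lemma act_sum: "act u (sum f A) = (\<Sum>i\<in>A. act u (f i))"
  by (induction A rule: infinite_finite_induct) (simp_all add: act_add)

lemma act_linear:
  "act (u + v) p = act u p + act v p" "act (scale c u) p = pconst c * act u p"
  by (simp_all add: sym_action_def linear_poly_def dual_adjoint_def bracket_linear coord_add coord_scale
      pconst_hom sum.distrib sum_distrib_left algebra_simps)

lemma act_pvar: "i < n \<Longrightarrow> act u (pvar i) = linear_poly n e (\<lambda>v. crd i (bracket v u))"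
  by (simp add: sym_action_def partial_deriv_pvar dual_adjoint_def if_distrib[of "\<lambda>x. x * _"] cong: if_cong)

lemma linear_poly_in_sym_power: "linear_poly n e \<alpha> \<in> sym_power n 1"
  unfolding linear_poly_def
  using mult_in_sym_power[OF pconst_in_sym_power pvar_in_sym_power]
  by (intro sum_in_sym_power) auto

lemma act_in_sym_power: "p \<in> sym_power n s \<Longrightarrow> act u p \<in> sym_power n s"
  unfolding sym_action_def
  using mult_in_sym_power[OF partial_deriv_in_sym_power linear_poly_in_sym_power]
  by (intro sum_in_sym_power) auto

lemma act_linear_poly:
  assumes "\<And>u v. \<alpha> (u + v) = \<alpha> u + \<alpha> v" "\<And>c u. \<alpha> (scale c u) = c * \<alpha> u"
  shows "act u (linear_poly n e \<alpha>) = linear_poly n e (\<lambda>v. \<alpha> (bracket v u))"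
proof -
  have "act u (linear_poly n e \<alpha>) =
      (\<Sum>j<n. pconst (\<alpha> (e j)) * (\<Sum>i<n. pconst (crd j (bracket (e i) u)) * pvar i))"
    by (simp add: linear_poly_def act_sum act_pconst_mult act_pvar)
  also have "\<dots> = (\<Sum>j<n. \<Sum>i<n. pconst (crd j (bracket (e i) u) * \<alpha> (e j)) * pvar i)"
    by (simp add: sum_distrib_left pconst_hom ac_simps)
  also have "\<dots> = (\<Sum>i<n. \<Sum>j<n. pconst (crd j (bracket (e i) u) * \<alpha> (e j)) * pvar i)"
    by (rule sum.swap)
  also have "\<dots> = (\<Sum>i<n. pconst (\<alpha> (bracket (e i) u)) * pvar i)"
    unfolding linear_expand[of \<alpha>, OF assms, of "bracket (e _) u"]
    by (simp add: pconst_sum sum_distrib_right)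
  finally show ?thesis by (simp add: linear_poly_def)
qed

lemma linear_poly_diff: "linear_poly n e (\<lambda>v. \<alpha> v - \<beta> v) = linear_poly n e \<alpha> - linear_poly n e \<beta>"
  by (simp add: linear_poly_def pconst_diff left_diff_distrib sum_subtractf)

text \<open>On linear polynomials the action is dual to the adjoint action, and the identity is the Jacobi
  identity.\<close>
lemma act_bracket_pvar:
  assumes "i < n"
  shows "act (bracket u v) (pvar i) = act u (act v (pvar i)) - act v (act u (pvar i))"
proof -
  have *: "act u (act v (pvar i)) = linear_poly n e (\<lambda>w. crd i (bracket (bracket w u) v))" for u v
    using act_linear_poly[of "\<lambda>w. crd i (bracket w v)" u] assms
    by (simp add: act_pvar bracket_linear coord_add coord_scale)
  have "crd i (bracket w (bracket u v)) =
      crd i (bracket (bracket w u) v) - crd i (bracket (bracket w v) u)" for w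
  proof -
    have "bracket w (bracket u v) = - bracket u (bracket v w) - bracket v (bracket w u)"
      using jacobi[of w u v] by (simp add: algebra_simps add_eq_0_iff)
    also have "bracket u (bracket v w) = bracket (bracket w v) u"
      using bracket_linear(4)[of u "-1" "bracket w v"] bracket_skew[of v w] bracket_skew[of u "bracket w v"]
      by simp
    also have "bracket v (bracket w u) = - bracket (bracket w u) v"
      by (rule bracket_skew)
    finally show ?thesis
      using coord_add[of i "- bracket (bracket w v) u" "bracket (bracket w u) v"] by (simp add: coord_uminus)
  qed
  then have "linear_poly n e (\<lambda>w. crd i (bracket w (bracket u v))) =
      linear_poly n e (\<lambda>w. crd i (bracket (bracket w u) v)) -
      linear_poly n e (\<lambda>w. crd i (bracket (bracket w v) u))"
    by (simp add: linear_poly_diff)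
  then show ?thesis unfolding * by (simp only: act_pvar[OF assms])
qed

subsection \<open>Lie derivative and Cartan formula\<close>

text \<open>Both operators are defined by their commutation rules with contractions,
  \<open>\<iota>\<^sub>v L\<^sub>u = L\<^sub>u \<iota>\<^sub>v - \<iota>\<^bsub>[u, v]\<^esub>\<close> and \<open>\<iota>\<^sub>u d = L\<^sub>u - d \<iota>\<^sub>u\<close>. In this form they make sense for arbitrary functions on
  lists, and linearity and the Leibniz rules hold without any assumption on the forms.\<close>

fun lie_deriv :: "'l \<Rightarrow> ('l, 'k) form \<Rightarrow> ('l, 'k) form" where
  "lie_deriv u a [] = act u (a [])"
| "lie_deriv u a (v # us) = lie_deriv u (contract v a) us - a (bracket u v # us)"

fun ce_diff :: "('l, 'k) form \<Rightarrow> ('l, 'k) form" where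
  "ce_diff a [] = 0"
| "ce_diff a (u # us) = lie_deriv u a us - ce_diff (contract u a) us"

lemma contract_lie: "contract v (lie_deriv u a) = lie_deriv u (contract v a) - contract (bracket u v) a"
  by (auto simp: contract_def[of _ "lie_deriv u a"] contract_def[of "bracket u v" a])

lemma contract_ce_diff: "contract u (ce_diff a) = lie_deriv u a - ce_diff (contract u a)"
  by (auto simp: contract_def[of _ "ce_diff a"])

text \<open>The bracket \<open>[u, v]\<close> replaces the argument \<open>v\<close> in the usual formula. Here it is moved to the front,
  which costs the sign \<open>(-1)\<^sup>j\<close>; in this shape the sum is part of the Chevalley-Eilenberg differential.\<close>
lemma lie_explicit:
  assumes "multilinear scale a" "alternating a"
  shows "lie_deriv u a us = act u (a us) - (\<Sum>j<length us. (-1) ^ j * a (bracket u (us ! j) # nths us (- {j})))"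
  using assms
proof (induction us arbitrary: a)
  case (Cons v us)
  have n0: "nths (v # us) (- {0}) = us"
    by (simp add: nths_Cons nths_all)
  have nS: "nths (v # us) (- {Suc j}) = v # nths us (- {j})" for j
    by (simp add: nths_Cons Compl_eq)
  have swap: "a (x # v # ws) = - contract v a (x # ws)" for x ws
    using alternating_swap[OF Cons.prems, of "[]" x v ws] by (simp add: contract_def)
  have "lie_deriv u (contract v a) us =
      act u (contract v a us) - (\<Sum>j<length us. (-1) ^ j * contract v a (bracket u (us ! j) # nths us (- {j})))"
    using Cons.prems by (intro Cons.IH multilinear_contract alternating_contract)
  then show ?case
    by (simp add: sum.lessThan_Suc_shift n0 nS swap sum_negf contract_def[of v a] del: sum.lessThan_Suc)
qed simp

text \<open>This is Cartan's formula. The terms of the differential in which the first argument \<open>u\<close> acts or is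
  bracketed make up \<open>L\<^sub>u\<close>, by \<open>lie_explicit\<close>. In all other terms \<open>u\<close> is a plain argument, and moving it to the
  front gives the differential of \<open>\<iota>\<^sub>u a\<close>, with the opposite sign.\<close>
lemma CE_diff_eq_ce_diff:
  assumes "multilinear scale a" "alternating a"
  shows "CE_diff scale bracket n e a = ce_diff a"
proof
  fix us
  show "CE_diff scale bracket n e a us = ce_diff a us"
    using assms
  proof (induction us arbitrary: a)
    case (Cons u us)
    define m where "m = length us"
    define P where "P k = {(i, j). i < j \<and> j < k}" for k :: nat
    have n0: "nths (u # us) (- {0}) = us"
      by (simp add: nths_Cons nths_all)
    have nS: "nths (u # us) (- {Suc i}) = u # nths us (- {i})" for i
      by (simp add: nths_Cons Compl_eq)
    have n0S: "nths (u # us) (- {0, Suc j}) = nths us (- {j})" for j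
      by (simp add: nths_Cons Compl_eq)
    have nSS: "nths (u # us) (- {Suc i, Suc j}) = u # nths us (- {i, j})" for i j
      by (simp add: nths_Cons Compl_eq)
    have swap: "a (x # u # ws) = - contract u a (x # ws)" for x ws
      using alternating_swap[OF Cons.prems, of "[]" x u ws] by (simp add: contract_def)
    have PSuc: "P (Suc k) = (\<lambda>j. (0, Suc j)) ` {..<k} \<union> map_prod Suc Suc ` P k" for k
    proof (intro equalityI subsetI)
      fix p assume "p \<in> P (Suc k)"
      then obtain i j where p: "p = (i, Suc j)" "i < Suc j" "j < k"
        by (cases p; cases "snd p") (auto simp: P_def)
      show "p \<in> (\<lambda>j. (0, Suc j)) ` {..<k} \<union> map_prod Suc Suc ` P k"
      proof (cases i)
        case (Suc i')
        then have "p = map_prod Suc Suc (i', j)" "(i', j) \<in> P k" using p by (auto simp: P_def)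
        then show ?thesis by blast
      qed (use p in auto)
    qed (auto simp: P_def)
    have finP: "finite (P k)" for k
      by (rule finite_subset[of _ "{..<k} \<times> {..<k}"]) (auto simp: P_def)
    have inj: "inj_on (map_prod Suc Suc) (P k)" for k
      by (rule inj_on_subset[OF _ subset_UNIV]) (simp add: prod.inj_map)
    have inj0: "inj_on (\<lambda>j. (0 :: nat, Suc j)) A" for A by (simp add: inj_on_def)
    have reindex: "sum f (map_prod Suc Suc ` P k) = (\<Sum>(i, j)\<in>P k. f (Suc i, Suc j))"
      for f :: "nat \<times> nat \<Rightarrow> 'k mpoly" and k
      by (subst sum.reindex[OF inj]) (simp add: map_prod_def case_prod_unfold)
    have sumP: "sum f (P (Suc k)) = (\<Sum>j<k. f (0, Suc j)) + (\<Sum>(i, j)\<in>P k. f (Suc i, Suc j))"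
      for f :: "nat \<times> nat \<Rightarrow> 'k mpoly" and k
      unfolding PSuc
      by (subst sum.union_disjoint)
         (auto simp: finP reindex sum.reindex[OF inj0])
    have IH: "CE_diff scale bracket n e (contract u a) us = ce_diff (contract u a) us"
      using Cons.prems by (intro Cons.IH multilinear_contract alternating_contract)
    have "CE_diff scale bracket n e a (u # us) =
        (act u (a us) - (\<Sum>i<m. (-1) ^ i * act (us ! i) (contract u a (nths us (- {i}))))) +
        ((\<Sum>j<m. - ((-1) ^ j * a (bracket u (us ! j) # nths us (- {j})))) -
         (\<Sum>(i, j)\<in>P m. (-1) ^ (i + j) * contract u a (bracket (us ! i) (us ! j) # nths us (- {i, j}))))"
      unfolding CE_diff_def P_def[symmetric] length_Cons m_def[symmetric] sumP
      by (simp add: sum.lessThan_Suc_shift n0 nS n0S nSS swap sum_negf case_prod_unfold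
          contract_def[of u a, symmetric] del: sum.lessThan_Suc)
         (simp add: contract_def)
    also have "\<dots> = lie_deriv u a us - CE_diff scale bracket n e (contract u a) us"
      unfolding lie_explicit[OF Cons.prems] CE_diff_def P_def[symmetric] m_def[symmetric]
      by (simp add: sum_negf)
    finally show ?case unfolding IH by simp
  qed (simp add: CE_diff_def)
qed

lemma lie_linear_form:
  "lie_deriv u (a + b) = lie_deriv u a + lie_deriv u b" "lie_deriv u (- a) = - lie_deriv u a" "lie_deriv u 0 = 0"
  "lie_deriv u (form_scale c a) = form_scale c (lie_deriv u a)" "lie_deriv u (bar a) = bar (lie_deriv u a)"
proof -
  have "lie_deriv u (a + b) us = (lie_deriv u a + lie_deriv u b) us" for us
    by (induction us arbitrary: a b) (simp_all add: act_add)
  then show "lie_deriv u (a + b) = lie_deriv u a + lie_deriv u b" by blast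
  have m: "lie_deriv u (- a) us = (- lie_deriv u a) us" for us and a :: "('l, 'k) form"
    by (induction us arbitrary: a) (simp_all add: act_uminus)
  then show "lie_deriv u (- a) = - lie_deriv u a" by blast
  have "lie_deriv u (\<lambda>_. 0) us = 0" for us
    by (induction us) (simp_all add: contract_def)
  then show "lie_deriv u 0 = 0" unfolding zero_fun_def by blast
  have "lie_deriv u (form_scale c a) us = form_scale c (lie_deriv u a) us" for us
  proof (induction us arbitrary: a)
    case (Cons v us)
    then show ?case by simp (simp add: form_scale_def right_diff_distrib)
  qed (simp add: form_scale_def act_pconst_mult)
  then show "lie_deriv u (form_scale c a) = form_scale c (lie_deriv u a)" by blast
  have "lie_deriv u (bar a) us = bar (lie_deriv u a) us" for us
  proof (induction us arbitrary: a)
    case (Cons v us)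
    have "lie_deriv u (bar a) (v # us) = - bar (lie_deriv u (contract v a)) us - bar a (bracket u v # us)"
      using m[of "bar (contract v a)" us] by (simp add: bar_simps Cons)
    also have "\<dots> = bar (lie_deriv u a) (v # us)" by (simp add: bar_def algebra_simps)
    finally show ?case .
  qed (simp add: bar_def)
  then show "lie_deriv u (bar a) = bar (lie_deriv u a)" by blast
qed

lemma lie_linear_vector:
  assumes "multilinear scale a"
  shows "lie_deriv (u + v) a = lie_deriv u a + lie_deriv v a" "lie_deriv (scale c u) a = form_scale c (lie_deriv u a)"
proof -
  have "lie_deriv (u + v) a us = (lie_deriv u a + lie_deriv v a) us" for us
    using assms
  proof (induction us arbitrary: a)
    case (Cons w us)
    have "a ((bracket u w + bracket v w) # us) = a (bracket u w # us) + a (bracket v w # us)"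
      using multilinear_contract_linear(1)[OF Cons.prems, THEN fun_cong] by (simp add: contract_def)
    then show ?case using Cons.IH[OF multilinear_contract[OF Cons.prems]]
      by (simp add: bracket_linear)
  qed (simp add: act_linear)
  then show "lie_deriv (u + v) a = lie_deriv u a + lie_deriv v a" by blast
  have "lie_deriv (scale c u) a us = form_scale c (lie_deriv u a) us" for us
    using assms
  proof (induction us arbitrary: a)
    case (Cons w us)
    have "a (scale c (bracket u w) # us) = pconst c * a (bracket u w # us)"
      using multilinear_contract_linear(2)[OF Cons.prems, THEN fun_cong] by (simp add: contract_def form_scale_def)
    then show ?case using Cons.IH[OF multilinear_contract[OF Cons.prems]]
      by (simp add: bracket_linear form_scale_def right_diff_distrib)
  qed (simp add: act_linear form_scale_def)
  then show "lie_deriv (scale c u) a = form_scale c (lie_deriv u a)" by blast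
qed

lemma ce_linear:
  "ce_diff (a + b) = ce_diff a + ce_diff b" "ce_diff (- a) = - ce_diff a" "ce_diff 0 = 0"
  "ce_diff (form_scale c a) = form_scale c (ce_diff a)" "ce_diff (bar a) = - bar (ce_diff a)"
proof -
  have "ce_diff (a + b) us = (ce_diff a + ce_diff b) us" for us
    by (induction us arbitrary: a b) (simp_all add: lie_linear_form)
  then show "ce_diff (a + b) = ce_diff a + ce_diff b" by blast
  have m: "ce_diff (- a) us = (- ce_diff a) us" for us and a :: "('l, 'k) form"
    by (induction us arbitrary: a) (simp_all add: lie_linear_form)
  then show "ce_diff (- a) = - ce_diff a" by blast
  have "ce_diff (\<lambda>_. 0) us = 0" for us
    using lie_linear_form(3) by (induction us) (simp_all add: contract_def zero_fun_def)
  then show "ce_diff 0 = 0" unfolding zero_fun_def by blast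
  have "ce_diff (form_scale c a) us = form_scale c (ce_diff a) us" for us
  proof (induction us arbitrary: a)
    case (Cons v us)
    then show ?case by (simp add: lie_linear_form) (simp add: form_scale_def right_diff_distrib)
  qed (simp add: form_scale_def)
  then show "ce_diff (form_scale c a) = form_scale c (ce_diff a)" by blast
  have "ce_diff (bar a) us = (- bar (ce_diff a)) us" for us
  proof (induction us arbitrary: a)
    case (Cons v us)
    have "ce_diff (bar a) (v # us) = bar (lie_deriv v a) us - bar (ce_diff (contract v a)) us"
      using m[of "bar (contract v a)" us] by (simp add: bar_simps lie_linear_form Cons)
    also have "\<dots> = (- bar (ce_diff a)) (v # us)" by (simp add: bar_def algebra_simps)
    finally show ?case .
  qed (simp add: bar_def)
  then show "ce_diff (bar a) = - bar (ce_diff a)" by blast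
qed

lemma lie_wedge: "lie_deriv u (wedge a b) = wedge (lie_deriv u a) b + wedge a (lie_deriv u b)"
proof
  fix us
  show "lie_deriv u (wedge a b) us = (wedge (lie_deriv u a) b + wedge a (lie_deriv u b)) us"
  proof (induction us arbitrary: a b)
    case Nil
    show ?case by (simp add: wedge_Nil act_mult)
  next
    case (Cons v us)
    have "lie_deriv u (wedge a b) (v # us) =
        lie_deriv u (wedge (contract v a) b) us + lie_deriv u (wedge (bar a) (contract v b)) us -
        contract (bracket u v) (wedge a b) us"
      by (simp add: contract_wedge[of v] lie_linear_form)
         (simp add: contract_def)
    also have "\<dots> = (wedge (lie_deriv u a) b + wedge a (lie_deriv u b)) (v # us)"
      unfolding Cons by (simp add: wedge_Cons contract_wedge contract_lie wedge_diff lie_linear_form algebra_simps)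
    finally show ?case .
  qed
qed

text \<open>Both \<open>\<iota>\<^sub>u\<close> and \<open>d\<close> are antiderivations and \<open>L\<^sub>u\<close> is a derivation. By Cartan's formula, the failure of
  the Leibniz rule for a product is minus its failure for the products of the contractions, which have
  fewer arguments.\<close>
lemma ce_wedge: "ce_diff (wedge a b) = wedge (ce_diff a) b + wedge (bar a) (ce_diff b)"
proof
  fix us
  show "ce_diff (wedge a b) us = (wedge (ce_diff a) b + wedge (bar a) (ce_diff b)) us"
  proof (induction us arbitrary: a b)
    case Nil
    show ?case by (simp add: wedge_Nil)
  next
    case (Cons v us)
    have "ce_diff (wedge a b) (v # us) = lie_deriv v (wedge a b) us -
        (ce_diff (wedge (contract v a) b) us + ce_diff (wedge (bar a) (contract v b)) us)"
      by (simp add: contract_wedge ce_linear)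
    also have "\<dots> = (wedge (ce_diff a) b + wedge (bar a) (ce_diff b)) (v # us)"
      unfolding Cons lie_wedge
      by (simp add: wedge_Cons contract_ce_diff wedge_diff ce_linear bar_simps wedge_uminus algebra_simps)
    finally show ?case .
  qed
qed

end

context based_lie_algebra begin

lemma multilinear_lie:
  assumes "multilinear scale a"
  shows "multilinear scale (lie_deriv u a)"
  unfolding multilinear_def
proof (intro conjI allI)
  show "lie_deriv u a (ps @ (x + y) # qs) = lie_deriv u a (ps @ x # qs) + lie_deriv u a (ps @ y # qs)" for ps x y qs
    using assms
  proof (induction ps arbitrary: a)
    case Nil
    have "a ((bracket u x + bracket u y) # qs) = a (bracket u x # qs) + a (bracket u y # qs)"
      using multilinear_contract_linear(1)[OF Nil, THEN fun_cong] by (simp add: contract_def)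
    with Nil show ?case
      by (simp add: multilinear_contract_linear lie_linear_form bracket_linear)
  next
    case (Cons w ps)
    have "a (bracket u w # ps @ (x + y) # qs) = a (bracket u w # ps @ x # qs) + a (bracket u w # ps @ y # qs)"
      using Cons.prems unfolding multilinear_def by (metis append_Cons)
    then show ?case using Cons.IH[OF multilinear_contract[OF Cons.prems]] by simp
  qed
  show "lie_deriv u a (ps @ scale c x # qs) = pconst c * lie_deriv u a (ps @ x # qs)" for ps c x qs
    using assms
  proof (induction ps arbitrary: a)
    case Nil
    have "a (scale c (bracket u x) # qs) = pconst c * a (bracket u x # qs)"
      using multilinear_contract_linear(2)[OF Nil, THEN fun_cong] by (simp add: contract_def form_scale_def)
    with Nil show ?case
      by (simp add: multilinear_contract_linear lie_linear_form bracket_linear)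
         (simp add: form_scale_def right_diff_distrib)
  next
    case (Cons w ps)
    have "a (bracket u w # ps @ scale c x # qs) = pconst c * a (bracket u w # ps @ x # qs)"
      using Cons.prems unfolding multilinear_def by (metis append_Cons)
    then show ?case using Cons.IH[OF multilinear_contract[OF Cons.prems]]
      by (simp add: right_diff_distrib)
  qed
qed

lemma multilinear_ce:
  assumes "multilinear scale a"
  shows "multilinear scale (ce_diff a)"
  unfolding multilinear_def
proof (intro conjI allI)
  show "ce_diff a (ps @ (x + y) # qs) = ce_diff a (ps @ x # qs) + ce_diff a (ps @ y # qs)" for ps x y qs
    using assms
  proof (induction ps arbitrary: a)
    case Nil
    then show ?case
      by (simp add: multilinear_contract_linear ce_linear lie_linear_vector)
  next
    case (Cons w ps)
    have "lie_deriv w a (ps @ (x + y) # qs) = lie_deriv w a (ps @ x # qs) + lie_deriv w a (ps @ y # qs)"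
      using multilinear_lie[OF Cons.prems] unfolding multilinear_def by blast
    then show ?case using Cons.IH[OF multilinear_contract[OF Cons.prems]] by simp
  qed
  show "ce_diff a (ps @ scale c x # qs) = pconst c * ce_diff a (ps @ x # qs)" for ps c x qs
    using assms
  proof (induction ps arbitrary: a)
    case Nil
    then show ?case
      by (simp add: multilinear_contract_linear ce_linear lie_linear_vector)
         (simp add: form_scale_def right_diff_distrib)
  next
    case (Cons w ps)
    have "lie_deriv w a (ps @ scale c x # qs) = pconst c * lie_deriv w a (ps @ x # qs)"
      using multilinear_lie[OF Cons.prems] unfolding multilinear_def by blast
    then show ?case using Cons.IH[OF multilinear_contract[OF Cons.prems]]
      by (simp add: right_diff_distrib)
  qed
qed

lemma alternating_lie:
  assumes "multilinear scale a" "alternating a"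
  shows "alternating (lie_deriv u a)"
  unfolding alternating_iff_adjacent[OF multilinear_lie[OF assms(1)]]
proof (intro allI)
  show "lie_deriv u a (ps @ x # x # qs) = 0" for ps x qs
    using assms
  proof (induction ps arbitrary: a)
    case Nil
    have "contract x (contract (bracket u x) a) qs = - contract (bracket u x) (contract x a) qs"
      using contract_swap[OF Nil, of x "bracket u x"] by simp
    then show ?case
      by (simp add: alternating_contract_contract[OF Nil(2)] lie_linear_form) (simp add: contract_def)
  next
    case (Cons w ps)
    have "a (bracket u w # ps @ x # x # qs) = 0"
      using Cons.prems(2) unfolding alternating_def by simp
    with Cons show ?case by (simp add: multilinear_contract alternating_contract)
  qed
qed

text \<open>For a repeated argument, \<open>\<iota>\<^sub>u \<iota>\<^sub>u d = \<iota>\<^sub>u L\<^sub>u - \<iota>\<^sub>u d \<iota>\<^sub>u = - \<iota>\<^bsub>[u, u]\<^esub> + d \<iota>\<^sub>u \<iota>\<^sub>u\<close>, and both terms vanish.\<close>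
lemma alternating_ce:
  assumes "multilinear scale a" "alternating a"
  shows "alternating (ce_diff a)"
  unfolding alternating_iff_adjacent[OF multilinear_ce[OF assms(1)]]
proof (intro allI)
  show "ce_diff a (ps @ x # x # qs) = 0" for ps x qs
    using assms
  proof (induction ps arbitrary: a)
    case Nil
    have "a (0 # qs) = 0"
      using multilinear_contract_linear(2)[OF Nil(1), of 0 0, THEN fun_cong, of qs]
      by (simp add: contract_def form_scale_def pconst_hom)
    then show ?case
      by (simp add: alternating_contract_contract[OF Nil(2)] ce_linear bracket_self)
  next
    case (Cons w ps)
    have "lie_deriv w a (ps @ x # x # qs) = 0"
      using alternating_lie[OF Cons.prems] unfolding alternating_def by simp
    with Cons show ?case by (simp add: multilinear_contract alternating_contract)
  qed
qed

lemma hom_form_lie: "hom_form t a \<Longrightarrow> hom_form t (lie_deriv u a)"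
proof -
  have "lie_deriv u a us = 0" if "hom_form t a" "int (length us) \<noteq> t" for us
    using that
  proof (induction us arbitrary: a t)
    case (Cons v us)
    have "lie_deriv u (contract v a) us = 0"
      using Cons.prems by (intro Cons.IH[OF hom_form_contract]) auto
    then show ?case using Cons.prems by (simp add: hom_form_def)
  qed (simp add: hom_form_def)
  then show "hom_form t a \<Longrightarrow> hom_form t (lie_deriv u a)" by (simp add: hom_form_def)
qed

lemma hom_form_ce: "hom_form t a \<Longrightarrow> hom_form (t + 1) (ce_diff a)"
proof -
  have "ce_diff a us = 0" if "hom_form t a" "int (length us) \<noteq> t + 1" for us
    using that
  proof (induction us arbitrary: a t)
    case (Cons v us)
    have "ce_diff (contract v a) us = 0"
      using Cons.prems by (intro Cons.IH[OF hom_form_contract]) auto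
    moreover have "lie_deriv v a us = 0"
      using hom_form_lie[OF Cons.prems(1)] Cons.prems(2) by (simp add: hom_form_def)
    ultimately show ?case by simp
  qed simp
  then show "hom_form t a \<Longrightarrow> hom_form (t + 1) (ce_diff a)" by (simp add: hom_form_def)
qed

lemma lie_in_sym_power: "(\<And>us. a us \<in> sym_power n s) \<Longrightarrow> lie_deriv u a us \<in> sym_power n s"
  by (induction us arbitrary: a) (auto intro!: act_in_sym_power diff_in_sym_power simp: contract_def)

lemma ce_in_sym_power: "(\<And>us. a us \<in> sym_power n s) \<Longrightarrow> ce_diff a us \<in> sym_power n s"
  by (induction us arbitrary: a) (auto intro!: lie_in_sym_power diff_in_sym_power simp: contract_def)

lemma ce_in_Forms: "a \<in> Forms s t \<Longrightarrow> ce_diff a \<in> Forms s (t + 1)"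
  by (simp add: alt_forms_iff multilinear_ce alternating_ce hom_form_ce ce_in_sym_power)

lemma CE_diff_Forms: "a \<in> Forms s t \<Longrightarrow> CE_diff scale bracket n e a = ce_diff a"
  by (simp add: alt_forms_iff CE_diff_eq_ce_diff)

subsection \<open>The square of the differential\<close>

lemma ce_pconst: "ce_diff (poly_form (pconst c)) = 0"
proof
  fix us
  have "lie_deriv u (poly_form (pconst c)) us = 0" for u us
    by (induction us) (simp_all add: poly_form_def, simp add: lie_linear_form flip: poly_form_def)
  then show "ce_diff (poly_form (pconst c)) us = 0 us"
    by (cases us) (simp_all add: ce_linear)
qed

lemma ce_one: "ce_diff (poly_form 1) = 0"
  using ce_pconst[of 1] by (simp add: pconst_hom)

lemma ce_x_eval: "ce_diff (X i) [u, v] = - pconst (crd i (bracket u v))"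
  by (simp add: contract_x_gen ce_pconst) (simp add: poly_form_def x_gen_def)

lemma ce_y_eval: "ce_diff (y_gen i) [u] = act u (pvar i)"
  by (simp add: y_gen_def ce_linear) (simp add: poly_form_def)

lemma ce_x_in_Forms: "ce_diff (X i) \<in> Forms 0 2"
  using ce_in_Forms[OF x_gen_in_Forms] by simp

lemma ce_y_in_Forms: "i < n \<Longrightarrow> ce_diff (y_gen i) \<in> Forms 1 1"
  using ce_in_Forms[OF y_gen_in_Forms] by simp

lemma Forms_eval_zero: "a \<in> Forms s t \<Longrightarrow> int (length us) \<noteq> t \<Longrightarrow> a us = 0"
  by (simp add: alt_forms_iff hom_form_def)

lemma ce_three:
  assumes "\<And>x ys. act x (b ys) = 0"
  shows "ce_diff b [u, v, w] = - b [v, bracket u w] - b [bracket u v, w] + b [u, bracket v w]"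
  by (simp add: contract_def assms)

text \<open>The Jacobi identity, evaluated with the coordinate \<open>x\<^sub>i\<close>.\<close>
lemma ce_ce_x: "ce_diff (ce_diff (X i)) = 0"
proof
  fix us
  show "ce_diff (ce_diff (X i)) us = 0 us"
  proof (cases "length us = 3")
    case False
    then show ?thesis using Forms_eval_zero[OF ce_in_Forms[OF ce_x_in_Forms]] by simp
  next
    case True
    then obtain u v w where us: "us = [u, v, w]" by (auto simp: length_Suc_conv numeral_3_eq_3)
    have "bracket v (bracket u w) = - bracket v (bracket w u)"
      using bracket_linear(4)[of v "-1" "bracket w u"] bracket_skew[of u w] by simp
    moreover have "bracket (bracket u v) w = - bracket w (bracket u v)" by (rule bracket_skew)
    ultimately have J: "bracket u (bracket v w) = bracket v (bracket u w) + bracket (bracket u v) w"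
      using jacobi[of u v w] by (simp add: algebra_simps) (metis add.assoc add.commute minus_add_cancel neg_eq_iff_add_eq_0)
    have ac: "act x (ce_diff (X i) ys) = 0" for x ys
      using ce_x_in_Forms[of i] sym_power_0 unfolding alt_forms_iff by (metis act_pconst(1))
    have "ce_diff (ce_diff (X i)) us = - ce_diff (X i) [v, bracket u w] - ce_diff (X i) [bracket u v, w] + ce_diff (X i) [u, bracket v w]"
      unfolding us by (rule ce_three) (rule ac)
    also have "\<dots> = 0"
      unfolding ce_x_eval J by (simp add: coord_add pconst_hom)
    finally show ?thesis by simp
  qed
qed

text \<open>The polynomials form a module over the Lie algebra; on variables this is \<open>act_bracket_pvar\<close>.\<close>
lemma ce_ce_y:
  assumes "i < n"
  shows "ce_diff (ce_diff (y_gen i)) = 0"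
proof
  fix us
  show "ce_diff (ce_diff (y_gen i)) us = 0 us"
  proof (cases "length us = 2")
    case False
    then show ?thesis using Forms_eval_zero[OF ce_in_Forms[OF ce_y_in_Forms[OF assms]]] by simp
  next
    case True
    then obtain u v where us: "us = [u, v]" by (auto simp: length_Suc_conv numeral_2_eq_2)
    have "ce_diff (ce_diff (y_gen i)) us =
        act u (ce_diff (y_gen i) [v]) - ce_diff (y_gen i) [bracket u v] - act v (ce_diff (y_gen i) [u])"
      unfolding us by (simp only: ce_diff.simps lie_deriv.simps contract_def) simp
    also have "\<dots> = 0"
      unfolding ce_y_eval act_bracket_pvar[OF assms] by simp
    finally show ?thesis by simp
  qed
qed

text \<open>The square of an odd derivation is a derivation, so that the generators suffice.\<close>
lemma ce_square: "a \<in> Forms s t \<Longrightarrow> ce_diff (ce_diff a) = 0"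
proof (induction rule: Forms_induct)
  case (wedge s t s' t' a b)
  then show ?case
    by (simp only: ce_wedge ce_linear bar_simps wedge_uminus wedge_0) simp
qed (simp_all only: ce_one ce_linear ce_ce_x ce_ce_y forms.scale_zero_right add_0_left)

section \<open>The Koszul differential\<close>

text \<open>This is \<open>\<Sum>\<^sub>i y\<^sub>i \<iota>\<^sub>e\<^sub>i\<close>, an antiderivation because the contractions are.\<close>
definition koszul_diff :: "('l, 'k) form \<Rightarrow> ('l, 'k) form" where
  "koszul_diff a = (\<lambda>us. \<Sum>i<n. pvar i * a (e i # us))"

lemma koszul_eq: "koszul_diff a = (\<Sum>i<n. wedge (y_gen i) (contract (e i) a))"
  by (auto simp: koszul_diff_def y_gen_def wedge_poly_form contract_def sum_fun_apply)

lemma koszul_linear: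
  "koszul_diff (a + b) = koszul_diff a + koszul_diff b" "koszul_diff (- a) = - koszul_diff a" "koszul_diff 0 = 0"
  "koszul_diff (form_scale c a) = form_scale c (koszul_diff a)" "koszul_diff (bar a) = - bar (koszul_diff a)"
  by (auto simp: koszul_diff_def form_scale_def bar_def distrib_left sum.distrib sum_negf sum_distrib_left
      mult.left_commute intro!: sum.cong ext)

lemma koszul_wedge: "koszul_diff (wedge a b) = wedge (koszul_diff a) b + wedge (bar a) (koszul_diff b)"
  unfolding koszul_eq wedge_sum sum.distrib[symmetric]
  by (intro sum.cong refl)
     (simp add: contract_wedge wedge_add y_gen_def wedge_poly_form wedge_poly_mult)

lemma contract_in_Forms: "a \<in> Forms s t \<Longrightarrow> contract u a \<in> Forms s (t - 1)"
  by (simp add: alt_forms_iff multilinear_contract alternating_contract hom_form_contract)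
     (simp add: contract_def)

lemma koszul_in_Forms: "a \<in> Forms s t \<Longrightarrow> koszul_diff a \<in> Forms (s + 1) (t - 1)"
  unfolding koszul_eq
  by (rule forms.subspace_sum[OF subspace_alt_forms])
     (use wedge_in_alt_forms[OF y_gen_in_Forms contract_in_Forms] in \<open>simp add: add.commute[of s]\<close>)

lemma koszul_pconst: "koszul_diff (poly_form p) = 0"
  by (auto simp: koszul_diff_def poly_form_def)

lemma koszul_y: "koszul_diff (y_gen i) = 0"
  by (simp add: y_gen_def koszul_pconst)

lemma koszul_x:
  assumes "i < n"
  shows "koszul_diff (X i) = y_gen i"
proof
  fix us
  have "koszul_diff (X i) us = (\<Sum>j<n. if j = i then y_gen i us else 0)"
    unfolding koszul_diff_def
  proof (rule sum.cong)
    fix j assume "j \<in> {..<n}"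
    then show "pvar j * X i (e j # us) = (if j = i then y_gen i us else 0)"
      using assms by (auto simp: x_gen_def coord_e y_gen_def poly_form_def pconst_hom)
  qed simp
  also have "\<dots> = y_gen i us" using assms by simp
  finally show "koszul_diff (X i) us = y_gen i us" .
qed

lemma koszul_square: "a \<in> Forms s t \<Longrightarrow> koszul_diff (koszul_diff a) = 0"
proof (induction rule: Forms_induct)
  case (wedge s t s' t' a b)
  then show ?case
    by (simp only: koszul_wedge koszul_linear bar_simps wedge_uminus wedge_0) simp
qed (simp_all only: koszul_x koszul_y koszul_pconst koszul_linear forms.scale_zero_right add_0_left)

text \<open>On a vector \<open>u\<close> both terms are, up to sign, the linear polynomial \<open>v \<mapsto> x\<^sub>i [v, u]\<close>: the first is the action of
  \<open>u\<close> on \<open>y\<^sub>i\<close>, and the second comes from \<open>d x\<^sub>i (v, u) = - x\<^sub>i [v, u]\<close>.\<close>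
lemma ce_koszul_x:
  assumes "i < n"
  shows "ce_diff (koszul_diff (X i)) + koszul_diff (ce_diff (X i)) = 0"
proof
  fix us
  have mem: "ce_diff (koszul_diff (X i)) + koszul_diff (ce_diff (X i)) \<in> Forms 1 1"
    using koszul_in_Forms[OF ce_x_in_Forms[of i]] ce_y_in_Forms[OF assms]
    by (intro forms.subspace_add[OF subspace_alt_forms]) (simp_all add: koszul_x assms)
  show "(ce_diff (koszul_diff (X i)) + koszul_diff (ce_diff (X i))) us = 0 us"
  proof (cases "length us = 1")
    case True
    then obtain u where us: "us = [u]" by (auto simp: length_Suc_conv)
    have "ce_diff (koszul_diff (X i)) us = (\<Sum>j<n. pconst (crd i (bracket (e j) u)) * pvar j)"
      unfolding us koszul_x[OF assms] ce_y_eval act_pvar[OF assms] by (simp add: linear_poly_def)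
    moreover have "koszul_diff (ce_diff (X i)) us = - (\<Sum>j<n. pconst (crd i (bracket (e j) u)) * pvar j)"
      unfolding us koszul_diff_def ce_x_eval by (simp add: sum_negf mult.commute)
    ultimately show ?thesis by simp
  qed (use Forms_eval_zero[OF mem] in auto)
qed

text \<open>The anticommutator of two odd derivations is a derivation, and only the generators have to be
  checked.\<close>
lemma ce_koszul_anticommute: "a \<in> Forms s t \<Longrightarrow> ce_diff (koszul_diff a) + koszul_diff (ce_diff a) = 0"
proof (induction rule: Forms_induct)
  case one
  show ?case by (simp only: ce_one koszul_pconst koszul_linear ce_linear add_0_left)
next
  case (x i)
  then show ?case by (rule ce_koszul_x)
next
  case (y i)
  \<comment> \<open>Since \<open>y\<^sub>i = d\<^sub>1 x\<^sub>i\<close>, this case follows from the one of \<open>x\<^sub>i\<close> and from \<open>d\<^sub>1 d\<^sub>1 = 0\<close>.\<close>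
  have "ce_diff (koszul_diff (X i)) = - koszul_diff (ce_diff (X i))"
    using ce_koszul_x[OF y] by (simp only: eq_neg_iff_add_eq_0)
  then have "koszul_diff (ce_diff (y_gen i)) = 0"
    using koszul_square[OF ce_x_in_Forms[of i]] y by (simp add: koszul_x koszul_linear)
  then show ?case by (simp only: koszul_y ce_linear add_0_left)
next
  case (add s t a b)
  have "ce_diff (koszul_diff (a + b)) + koszul_diff (ce_diff (a + b)) = (ce_diff (koszul_diff a) + koszul_diff (ce_diff a)) + (ce_diff (koszul_diff b) + koszul_diff (ce_diff b))"
    by (simp only: koszul_linear ce_linear ac_simps)
  then show ?case by (simp only: add add_0_left)
next
  case (scale s t c a)
  have "ce_diff (koszul_diff (form_scale c a)) + koszul_diff (ce_diff (form_scale c a)) = form_scale c (ce_diff (koszul_diff a) + koszul_diff (ce_diff a))"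
    by (simp only: koszul_linear ce_linear forms.scale_right_distrib)
  then show ?case by (simp only: scale forms.scale_zero_right)
next
  case (wedge s t s' t' a b)
  have "ce_diff (koszul_diff (wedge a b)) + koszul_diff (ce_diff (wedge a b)) =
      wedge (ce_diff (koszul_diff a) + koszul_diff (ce_diff a)) b + wedge a (ce_diff (koszul_diff b) + koszul_diff (ce_diff b))"
    by (simp only: koszul_wedge ce_wedge koszul_linear ce_linear bar_simps wedge_add wedge_uminus
        add.assoc minus_minus) (simp add: algebra_simps)
  then show ?case by (simp only: wedge wedge_0 add_0_left)
qed

end

context based_lie_algebra begin

lemma bar_Forms: "a \<in> Forms s t \<Longrightarrow> bar a = sgn_deg (tot s t) a"
  by (auto simp: alt_forms_iff tot_def sgn_deg_def dest: bar_hom_form)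

lemma graded_derivation_ce:
  "graded_derivation form_scale Forms wedge 0 1 (CE_diff scale bracket n e)"
  unfolding graded_derivation_def
proof (intro conjI allI ballI)
  fix s t a b s' t' c
  assume a: "a \<in> Forms s t"
  note CE = CE_diff_Forms[OF a]
  show "CE_diff scale bracket n e a \<in> Forms (s + 0) (t + 1)"
    using ce_in_Forms[OF a] by (simp add: CE)
  show "CE_diff scale bracket n e (form_scale c a) = form_scale c (CE_diff scale bracket n e a)"
    using CE_diff_Forms[OF form_scale_in_alt_forms[OF a]] by (simp add: CE ce_linear)
  show "CE_diff scale bracket n e (a + b) = CE_diff scale bracket n e a + CE_diff scale bracket n e b"
    if b: "b \<in> Forms s t"
    using CE_diff_Forms[OF forms.subspace_add[OF subspace_alt_forms a b]] CE_diff_Forms[OF b]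
    by (simp only: CE ce_linear)
  show "CE_diff scale bracket n e (wedge a b) =
      wedge (CE_diff scale bracket n e a) b + sgn_deg (tot s t) (wedge a (CE_diff scale bracket n e b))"
    if b: "b \<in> Forms s' t'"
    using CE_diff_Forms[OF wedge_in_alt_forms[OF a b]] CE_diff_Forms[OF b]
    by (simp only: CE ce_wedge bar_Forms[OF a] sgn_deg_simps)
qed

lemma graded_derivation_koszul_diff: "graded_derivation form_scale Forms wedge 1 (- 1) koszul_diff"
  unfolding graded_derivation_def
proof (intro conjI allI ballI)
  fix s t a b s' t' c
  assume a: "a \<in> Forms s t"
  show "koszul_diff a \<in> Forms (s + 1) (t + - 1)" using koszul_in_Forms[OF a] by simp
  show "koszul_diff (form_scale c a) = form_scale c (koszul_diff a)" by (rule koszul_linear)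
  show "koszul_diff (a + b) = koszul_diff a + koszul_diff b" by (rule koszul_linear)
  show "koszul_diff (wedge a b) = wedge (koszul_diff a) b + sgn_deg (tot s t) (wedge a (koszul_diff b))"
    by (simp only: koszul_wedge bar_Forms[OF a] sgn_deg_simps)
qed

lemma graded_derivation_wedge:
  assumes "graded_derivation form_scale Forms wedge p q \<delta>" "a \<in> Forms s t" "b \<in> Forms s' t'"
  shows "\<delta> (wedge a b) = wedge (\<delta> a) b + sgn_deg (tot s t) (wedge a (\<delta> b))"
  using assms unfolding graded_derivation_def by blast

lemma graded_derivation_one:
  assumes "graded_derivation form_scale Forms wedge p q \<delta>"
  shows "\<delta> (poly_form 1) = 0"
proof -
  have one: "wedge (poly_form 1) a = a" "wedge a (poly_form 1) = a" for a :: "('l, 'k) form"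
    by (simp_all add: wedge_poly_form wedge_poly_form_right)
  have "\<delta> (wedge (poly_form 1) (poly_form 1)) =
      wedge (\<delta> (poly_form 1)) (poly_form 1) + sgn_deg (tot 0 0) (wedge (poly_form 1) (\<delta> (poly_form 1)))"
    using assms one_in_Forms unfolding graded_derivation_def by blast
  then have "\<delta> (poly_form 1) = \<delta> (poly_form 1) + \<delta> (poly_form 1)"
    by (simp only: one sgn_deg_def tot_def) simp
  then show ?thesis by (metis add_cancel_right_right)
qed

lemma graded_derivation_unique:
  assumes \<delta>: "graded_derivation form_scale Forms wedge p q \<delta>"
    and \<delta>': "graded_derivation form_scale Forms wedge p q \<delta>'"
    and x: "\<And>i. i < n \<Longrightarrow> \<delta>' (X i) = \<delta> (X i)" and y: "\<And>i. i < n \<Longrightarrow> \<delta>' (y_gen i) = \<delta> (y_gen i)"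
    and a: "a \<in> Forms s t"
  shows "\<delta>' a = \<delta> a"
  using a
proof (induction rule: Forms_induct)
  case one
  show ?case using graded_derivation_one[OF \<delta>] graded_derivation_one[OF \<delta>'] by simp
next
  case (add s t a b)
  then show ?case using \<delta> \<delta>' unfolding graded_derivation_def by metis
next
  case (scale s t c a)
  then show ?case using \<delta> \<delta>' unfolding graded_derivation_def by metis
next
  case (wedge s t s' t' a b)
  have "\<delta> (wedge a b) = wedge (\<delta> a) b + sgn_deg (tot s t) (wedge a (\<delta> b))"
    "\<delta>' (wedge a b) = wedge (\<delta>' a) b + sgn_deg (tot s t) (wedge a (\<delta>' b))"
    by (rule graded_derivation_wedge[OF \<delta> wedge.hyps] graded_derivation_wedge[OF \<delta>' wedge.hyps])+
  then show ?case by (simp only: wedge)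
qed (use x y in auto)

lemma x_wedge_eval:
  assumes "j < k" "k < n" "a < b" "b < n"
  shows "wedge (X j) (X k) [e a, e b] = (if j = a \<and> k = b then 1 else 0)"
  using x_prod_eval[of "[j, k]" "[a, b]"] assms
  by (simp add: x_prod_simps wedge_poly_form_right)

lemma ce_x_formula:
  assumes "i < n"
  shows "ce_diff (X i) = - (\<Sum>k<n. \<Sum>j<k. form_scale (struct_const scale bracket n e j k i) (wedge (X j) (X k)))"
    (is "_ = - ?S")
proof (rule alt_forms_eqI[OF ce_x_in_Forms])
  have "wedge (X j) (X k) \<in> Forms 0 2" for j k
    using wedge_in_alt_forms[OF x_gen_in_Forms x_gen_in_Forms] by simp
  then show S: "- ?S \<in> Forms 0 2"
    by (intro forms.subspace_neg[OF subspace_alt_forms] forms.subspace_sum[OF subspace_alt_forms]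
        form_scale_in_alt_forms)
  fix js assume js: "sorted_wrt (<) js" "set js \<subseteq> {..<n}"
  show "ce_diff (X i) (map e js) = (- ?S) (map e js)"
  proof (cases "length js = 2")
    case True
    then obtain a b where ab: "js = [a, b]" by (auto simp: length_Suc_conv numeral_2_eq_2)
    with js have "a < b" "b < n" by auto
    have "?S [e a, e b] = (\<Sum>k<n. \<Sum>j<k. if j = a \<and> k = b then pconst (struct_const scale bracket n e a b i) else 0)"
      unfolding sum_fun_apply form_scale_def
      using \<open>a < b\<close> \<open>b < n\<close> by (intro sum.cong refl) (auto simp: x_wedge_eval)
    also have "\<dots> = (\<Sum>k<n. if k = b then pconst (struct_const scale bracket n e a b i) else 0)"
      using \<open>a < b\<close> by (intro sum.cong refl) auto
    also have "\<dots> = pconst (struct_const scale bracket n e a b i)"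
      using \<open>b < n\<close> by simp
    finally show ?thesis
      unfolding ab by (simp add: ce_x_eval struct_const_def del: ce_diff.simps)
  next
    case False
    then show ?thesis
      using Forms_eval_zero[OF ce_x_in_Forms, of "map e js"] Forms_eval_zero[OF S, of "map e js"] by simp
  qed
qed

lemma ce_y_formula:
  assumes "i < n"
  shows "ce_diff (y_gen i) = (\<Sum>j<n. \<Sum>k<n. form_scale (struct_const scale bracket n e j k i) (wedge (y_gen j) (X k)))"
    (is "_ = ?S")
proof (rule alt_forms_eqI[OF ce_y_in_Forms[OF assms]])
  have "wedge (y_gen j) (X k) \<in> Forms 1 1" if "j < n" for j k
    using wedge_in_alt_forms[OF y_gen_in_Forms[OF that] x_gen_in_Forms] by simp
  then show S: "?S \<in> Forms 1 1"
    by (intro forms.subspace_sum[OF subspace_alt_forms] form_scale_in_alt_forms) auto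
  fix js assume js: "sorted_wrt (<) js" "set js \<subseteq> {..<n}"
  show "ce_diff (y_gen i) (map e js) = ?S (map e js)"
  proof (cases "length js = 1")
    case True
    then obtain k where k: "js = [k]" "k < n" using js by (auto simp: length_Suc_conv)
    have "?S [e k] = (\<Sum>j<n. \<Sum>k'<n. if k' = k then pconst (struct_const scale bracket n e j k i) * pvar j else 0)"
      unfolding sum_fun_apply form_scale_def
      using k by (intro sum.cong refl) (auto simp: y_gen_def wedge_poly_form x_gen_def coord_e pconst_hom)
    also have "\<dots> = (\<Sum>j<n. pconst (struct_const scale bracket n e j k i) * pvar j)"
      using k by simp
    finally show ?thesis
      using k by (simp add: ce_y_eval act_pvar[OF assms] linear_poly_def struct_const_def del: ce_diff.simps)
  next
    case False
    then show ?thesis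
      using Forms_eval_zero[OF ce_y_in_Forms[OF assms], of "map e js"] Forms_eval_zero[OF S, of "map e js"] by simp
  qed
qed

section \<open>Exactness of the Koszul differential\<close>

definition quot_form :: "nat \<Rightarrow> ('l, 'k) form \<Rightarrow> ('l, 'k) form" where
  "quot_form j a = (\<lambda>us. var_quot j (a us))"

definition set_var_0 :: "nat \<Rightarrow> ('l, 'k) form \<Rightarrow> ('l, 'k) form" where
  "set_var_0 j a = a - wedge (y_gen j) (quot_form j a)"

text \<open>The Koszul complex is the tensor product of the complexes \<open>k[y\<^sub>j] x\<^sub>j \<rightarrow> k[y\<^sub>j]\<close>. The next operator contracts
  the factor of index \<open>j\<close> onto the constants: it divides by \<open>y\<^sub>j\<close> and multiplies by \<open>x\<^sub>j\<close>.\<close>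
definition homotopy :: "nat \<Rightarrow> ('l, 'k) form \<Rightarrow> ('l, 'k) form" where
  "homotopy j a = wedge (X j) (quot_form j a)"

text \<open>The projection that sets \<open>x\<^sub>j\<close> and \<open>y\<^sub>j\<close> to \<open>0\<close>.\<close>
definition drop_var :: "nat \<Rightarrow> ('l, 'k) form \<Rightarrow> ('l, 'k) form" where
  "drop_var j a = set_var_0 j a - wedge (X j) (contract (e j) (set_var_0 j a))"

text \<open>Neither \<open>y\<^sub>j\<close> nor \<open>x\<^sub>j\<close> occurs in the form.\<close>
definition free_of :: "nat \<Rightarrow> ('l, 'k) form \<Rightarrow> bool" where
  "free_of j a \<longleftrightarrow> quot_form j a = 0 \<and> contract (e j) a = 0"

lemma quot_form_in_Forms: "a \<in> Forms s t \<Longrightarrow> j < n \<Longrightarrow> quot_form j a \<in> Forms (s - 1) t"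
  by (auto simp: alt_forms_iff quot_form_def var_quot_in_sym_power multilinear_def alternating_def
      hom_form_def var_quot_add)

lemma set_var_0_in_Forms:
  assumes "a \<in> Forms s t" "j < n"
  shows "set_var_0 j a \<in> Forms s t"
  unfolding set_var_0_def
  using wedge_in_alt_forms[OF y_gen_in_Forms[OF assms(2)] quot_form_in_Forms[OF assms]] assms(1)
  by (intro forms.subspace_diff[OF subspace_alt_forms]) simp_all

lemma homotopy_in_Forms:
  assumes "a \<in> Forms s t" "j < n"
  shows "homotopy j a \<in> Forms (s - 1) (t + 1)"
  unfolding homotopy_def
  using wedge_in_alt_forms[OF x_gen_in_Forms quot_form_in_Forms[OF assms]] by (simp add: add.commute[of t])

lemma drop_var_in_Forms:
  assumes "a \<in> Forms s t" "j < n"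
  shows "drop_var j a \<in> Forms s t"
  unfolding drop_var_def
  using wedge_in_alt_forms[OF x_gen_in_Forms contract_in_Forms[OF set_var_0_in_Forms[OF assms]]]
    set_var_0_in_Forms[OF assms]
  by (intro forms.subspace_diff[OF subspace_alt_forms]) simp_all

lemma quot_form_linear:
  "quot_form j (a + b) = quot_form j a + quot_form j b" "quot_form j (a - b) = quot_form j a - quot_form j b"
  "quot_form j 0 = 0"
  by (auto simp: quot_form_def var_quot_add var_quot_diff)

lemma quot_form_commute: "quot_form i (quot_form j a) = quot_form j (quot_form i a)"
  by (simp add: quot_form_def var_quot_commute)

lemma contract_quot_form: "contract u (quot_form j a) = quot_form j (contract u a)"
  by (simp add: quot_form_def contract_def)

lemma quot_form_y:
  "quot_form j (wedge (y_gen j) a) = a"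
  "i \<noteq> j \<Longrightarrow> quot_form j (wedge (y_gen i) a) = wedge (y_gen i) (quot_form j a)"
  by (auto simp: quot_form_def y_gen_def wedge_poly_form var_quot_pvar)

lemma quot_form_x: "quot_form j (wedge (X i) a) = wedge (X i) (quot_form j a)"
proof
  fix us
  show "quot_form j (wedge (X i) a) us = wedge (X i) (quot_form j a) us"
  proof (induction us arbitrary: a)
    case Nil
    show ?case by (simp add: quot_form_def wedge_Nil)
  next
    case (Cons u us)
    have eq: "wedge (X i) b (u # us) = pconst (crd i u) * b us - wedge (X i) (contract u b) us" for b
      using contract_x_wedge[of u i b, THEN fun_cong, of us] by (simp add: contract_def[of u "wedge _ _"] form_scale_def)
    have "quot_form j (wedge (X i) a) (u # us) =
        pconst (crd i u) * quot_form j a us - quot_form j (wedge (X i) (contract u a)) us"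
      by (simp add: quot_form_def eq var_quot_diff)
    also have "\<dots> = wedge (X i) (quot_form j a) (u # us)"
      unfolding Cons by (simp add: eq contract_quot_form)
    finally show ?case .
  qed
qed

lemma contract_y_wedge: "contract u (wedge (y_gen j) a) = wedge (y_gen j) (contract u a)"
  by (auto simp: y_gen_def wedge_poly_form contract_def)

text \<open>Division by \<open>y\<^sub>j\<close> commutes with multiplication by the other variables. Hence only the summand
  \<open>y\<^sub>j \<iota>\<^sub>e\<^sub>j\<close> of the Koszul differential contributes to the commutator.\<close>
lemma quot_form_koszul_diff:
  assumes "j < n"
  shows "quot_form j (koszul_diff a) - koszul_diff (quot_form j a) = contract (e j) (set_var_0 j a)"
proof -
  have "quot_form j (koszul_diff a) us - koszul_diff (quot_form j a) us =
      (\<Sum>i<n. if i = j then contract (e j) (set_var_0 j a) us else 0)" for us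
    unfolding quot_form_def koszul_diff_def var_quot_sum sum_subtractf[symmetric]
    by (intro sum.cong refl)
       (auto simp: var_quot_pvar set_var_0_def contract_def quot_form_def y_gen_def wedge_poly_form)
  then show ?thesis using assms by (auto simp: fun_eq_iff)
qed

text \<open>The contraction of one tensor factor, up to the projection to the constants in that factor. No
  coefficients are inverted, in contrast to the homotopy given by the Euler vector field.\<close>
lemma homotopy_formula:
  assumes "j < n"
  shows "a = koszul_diff (homotopy j a) + homotopy j (koszul_diff a) + drop_var j a"
proof -
  have "koszul_diff (homotopy j a) + homotopy j (koszul_diff a) =
      wedge (y_gen j) (quot_form j a) + wedge (X j) (quot_form j (koszul_diff a) - koszul_diff (quot_form j a))"
    unfolding homotopy_def koszul_wedge koszul_x[OF assms] bar_x_gen wedge_uminus wedge_diff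
    by (simp only: diff_conv_add_uminus add.assoc add.commute add.left_commute)
  also have "\<dots> = wedge (y_gen j) (quot_form j a) + wedge (X j) (contract (e j) (set_var_0 j a))"
    unfolding quot_form_koszul_diff[OF assms] ..
  finally show ?thesis unfolding drop_var_def
    by (simp add: set_var_0_def fun_eq_iff)
qed

lemma koszul_drop_var:
  assumes "a \<in> Forms s t" "koszul_diff a = 0" "j < n"
  shows "a = koszul_diff (homotopy j a) + drop_var j a" "koszul_diff (drop_var j a) = 0"
proof -
  have "homotopy j (koszul_diff a) = 0"
    unfolding assms(2) homotopy_def quot_form_linear wedge_0 ..
  with homotopy_formula[OF assms(3), of a] show *: "a = koszul_diff (homotopy j a) + drop_var j a"
    by (simp only: add_0_right)
  have "koszul_diff a = koszul_diff (koszul_diff (homotopy j a)) + koszul_diff (drop_var j a)"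
    using arg_cong[OF *, of koszul_diff] by (simp only: koszul_linear)
  then show "koszul_diff (drop_var j a) = 0"
    unfolding koszul_square[OF homotopy_in_Forms[OF assms(1,3)]] assms(2) by simp
qed

lemma free_of_drop_var_same:
  assumes "a \<in> Forms s t" "j < n"
  shows "free_of j (drop_var j a)"
proof -
  have q: "quot_form j (set_var_0 j a) = 0"
    unfolding set_var_0_def quot_form_linear quot_form_y by simp
  have "alternating (set_var_0 j a)" using set_var_0_in_Forms[OF assms] by (simp add: alt_forms_iff)
  then have cc: "contract (e j) (contract (e j) (set_var_0 j a)) = 0"
    by (rule alternating_contract_contract)
  have "quot_form j (drop_var j a) = 0"
    unfolding drop_var_def quot_form_linear quot_form_x contract_quot_form[symmetric] q
    by (simp only: contract_simps wedge_0 diff_self)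
  moreover have "contract (e j) (drop_var j a) = 0"
    unfolding drop_var_def contract_simps contract_x_wedge cc coord_e[OF assms(2) assms(2)]
    by (simp only: wedge_0 if_True forms.scale_one diff_0_right diff_self refl)
  ultimately show ?thesis by (simp add: free_of_def)
qed

lemma free_of_drop_var:
  assumes a: "a \<in> Forms s t" "j < n" and i: "i < n" "i \<noteq> j" "free_of i a"
  shows "free_of i (drop_var j a)"
proof -
  have q: "quot_form i (set_var_0 j a) = 0"
    using i unfolding set_var_0_def quot_form_linear quot_form_y(2)[OF i(2)[symmetric]]
      quot_form_commute[of i] free_of_def
    by (simp only: quot_form_linear wedge_0 diff_self)
  have c: "contract (e i) (set_var_0 j a) = 0"
    using i(3) unfolding set_var_0_def contract_simps contract_y_wedge contract_quot_form free_of_def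
    by (simp only: quot_form_linear wedge_0 diff_self)
  have "multilinear scale (set_var_0 j a)" "alternating (set_var_0 j a)"
    using set_var_0_in_Forms[OF a] by (simp_all add: alt_forms_iff)
  then have cc: "contract (e i) (contract (e j) (set_var_0 j a)) = 0"
    using contract_swap[of scale "set_var_0 j a" "e i" "e j"] c by (simp only: contract_simps neg_0_equal_iff_equal neg_equal_0_iff_equal)
  have "quot_form i (drop_var j a) = 0"
    unfolding drop_var_def quot_form_linear quot_form_x contract_quot_form[symmetric] q
    by (simp only: contract_simps wedge_0 diff_self)
  moreover have "contract (e i) (drop_var j a) = 0"
    unfolding drop_var_def contract_simps contract_x_wedge c cc coord_e[OF a(2) i(1)]
    by (simp only: wedge_0 if_False forms.scale_zero_left diff_self i(2)[symmetric])
  ultimately show ?thesis by (simp add: free_of_def)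
qed

lemma free_of_all:
  assumes a: "a \<in> Forms s t" "(s, t) \<noteq> (0, 0)" and free: "\<And>j. j < n \<Longrightarrow> free_of j a"
  shows "a = 0"
proof
  fix us
  show "a us = 0 us"
  proof (cases us)
    case (Cons u us')
    have "multilinear scale a" using a(1) by (simp add: alt_forms_iff)
    then have "contract u a us' = (\<Sum>i<n. form_scale (crd i u) (contract (e i) a)) us'"
      using contract_expand[of a u] by simp
    also have "\<dots> = 0"
      unfolding sum_fun_apply using free by (intro sum.neutral) (simp add: free_of_def form_scale_def)
    finally show ?thesis by (simp add: Cons contract_def)
  next
    case Nil
    show ?thesis
    proof (cases "t = 0")
      case True
      have "a [] \<in> sym_power n s" using a(1) by (simp add: alt_forms_iff)
      moreover have "var_quot j (a []) = 0" if "j < n" for j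
        using free[OF that] by (auto simp: free_of_def quot_form_def fun_eq_iff)
      moreover have "s \<noteq> 0" using a(2) True by simp
      ultimately have "a [] = 0" by (rule sym_power_no_vars)
      then show ?thesis using Nil by simp
    qed (use Forms_eval_zero[OF a(1), of "[]"] Nil in simp)
  qed
qed

text \<open>A cocycle is changed by coboundaries until the variables of index \<open>0, \<dots>, k - 1\<close> have
  disappeared. When all variables are gone, the form lies in bidegree \<open>(0, 0)\<close> or vanishes.\<close>
lemma koszul_exact:
  assumes a: "a \<in> Forms s t" "(s, t) \<noteq> (0, 0)" "koszul_diff a = 0"
  shows "\<exists>b\<in>Forms (s - 1) (t + 1). koszul_diff b = a"
proof -
  have "\<exists>b\<in>Forms (s - 1) (t + 1). \<exists>a'\<in>Forms s t. a = koszul_diff b + a' \<and> koszul_diff a' = 0 \<and> (\<forall>j<k. free_of j a')"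
    if "k \<le> n" for k
    using that
  proof (induction k)
    case 0
    have "a = koszul_diff 0 + a" by (simp only: koszul_linear add_0_left)
    then show ?case using a forms.subspace_0[OF subspace_alt_forms] by blast
  next
    case (Suc k)
    then obtain b a' where b: "b \<in> Forms (s - 1) (t + 1)" and a': "a' \<in> Forms s t"
      and eq: "a = koszul_diff b + a'" "koszul_diff a' = 0" and free: "\<forall>j<k. free_of j a'"
      using Suc_leD by blast
    have k: "k < n" using Suc.prems by simp
    note r = koszul_drop_var[OF a' eq(2) k]
    have "a = koszul_diff (b + homotopy k a') + drop_var k a'"
      using eq(1) r(1) by (simp only: koszul_linear add.assoc)
    moreover have "b + homotopy k a' \<in> Forms (s - 1) (t + 1)"
      by (rule forms.subspace_add[OF subspace_alt_forms b homotopy_in_Forms[OF a' k]])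
    moreover have "free_of j (drop_var k a')" if "j < Suc k" for j
      using that free k free_of_drop_var_same[OF a' k] free_of_drop_var[OF a' k]
      by (cases "j = k") auto
    ultimately show ?case using drop_var_in_Forms[OF a' k] r(2) by blast
  qed
  from this[of n] obtain b a' where "b \<in> Forms (s - 1) (t + 1)" "a' \<in> Forms s t"
    "a = koszul_diff b + a'" "\<forall>j<n. free_of j a'" by blast
  moreover from this have "a' = 0" using free_of_all[OF _ a(2)] by blast
  ultimately show ?thesis by auto
qed

end

section \<open>The spectral sequence of a double complex\<close>

lemma (in module) coset_eq_iff:
  assumes "subspace B"
  shows "x +o B = y +o B \<longleftrightarrow> x - y \<in> B"
proof
  assume "x +o B = y +o B"
  moreover have "x \<in> x +o B" using subspace_0[OF assms] by (auto simp: elt_set_plus_def)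
  ultimately show "x - y \<in> B" by (auto intro: set_plus_imp_minus)
next
  assume xy: "x - y \<in> B"
  have *: "u +o B \<subseteq> v +o B" if "u - v \<in> B" for u v
  proof
    fix w assume "w \<in> u +o B"
    then have "w - u \<in> B" by (rule set_plus_imp_minus)
    then have "(w - u) + (u - v) \<in> B" using that by (rule subspace_add[OF assms])
    then show "w \<in> v +o B" by (intro set_minus_imp_plus) simp
  qed
  have "y - x \<in> B" using subspace_neg[OF assms xy] by simp
  with xy * show "x +o B = y +o B" by blast
qed

lemma (in module) coset_eq_self_iff: "subspace B \<Longrightarrow> x +o B = B \<longleftrightarrow> x \<in> B"
  using coset_eq_iff[of B x 0] by simp

lemma (in module) coset_self: "subspace B \<Longrightarrow> x \<in> x +o B"
  using subspace_0 by (auto simp: elt_set_plus_def)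

lemma (in module) coset_add:
  assumes "subspace B"
  shows "(x +o B) + (y +o B) = (x + y) +o B"
proof -
  have "B + B = B"
  proof
    show "B + B \<subseteq> B" using subspace_add[OF assms] by (auto simp: set_plus_def)
    show "B \<subseteq> B + B" by (rule set_zero_plus2[OF subspace_0[OF assms]])
  qed
  then show ?thesis by (simp add: set_plus_rearrange)
qed

lemma (in module) quot_scale_coset:
  assumes "subspace B"
  shows "quot_scale scale B c (x +o B) = scale c x +o B"
proof -
  have "scale c y +o B = scale c x +o B" if "y \<in> x +o B" for y
    using subspace_scale[OF assms set_plus_imp_minus[OF that], of c]
    by (simp add: coset_eq_iff[OF assms] scale_right_diff_distrib)
  then show ?thesis unfolding quot_scale_def using coset_self[OF assms, of x] by blast
qed

lemma (in module) sgn_deg_coset: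
  assumes "subspace B"
  shows "sgn_deg k ` (x +o B) = sgn_deg k x +o B"
proof -
  have "uminus ` (x +o B) = (- x) +o B"
  proof (intro equalityI subsetI)
    fix y assume "y \<in> uminus ` (x +o B)"
    then obtain b where "b \<in> B" "y = - x + (- b)" by (auto simp: elt_set_plus_def)
    then show "y \<in> (- x) +o B" using subspace_neg[OF assms] by blast
  next
    fix y assume "y \<in> (- x) +o B"
    then obtain b where "b \<in> B" "y = - (x + (- b))" by (auto simp: elt_set_plus_def)
    then show "y \<in> uminus ` (x +o B)" using subspace_neg[OF assms] by blast
  qed
  then show ?thesis by (simp add: sgn_deg_def[abs_def])
qed

lemma sgn_deg_add: "sgn_deg k (x + y) = sgn_deg k x + sgn_deg k y"
  by (simp add: sgn_deg_def)

lemma sgn_deg_sum: "sgn_deg k (sum f A) = (\<Sum>i\<in>A. sgn_deg k (f i))"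
  by (simp add: sgn_deg_def sum_negf)

lemma sgn_deg_0 [simp]: "sgn_deg k 0 = 0"
  by (simp add: sgn_deg_def)

text \<open>The bidegree is that of the polynomial and the exterior degree, so that the differentials have bidegree
  \<open>(0, 1)\<close> and \<open>(1, -1)\<close> and raise the total degree \<open>2 s + t\<close> by one.\<close>
locale double_complex = module scale
  for scale :: "'k::comm_ring_1 \<Rightarrow> 'x::ab_group_add \<Rightarrow> 'x" +
  fixes E :: "int \<Rightarrow> int \<Rightarrow> 'x set" and d0 d1 :: "'x \<Rightarrow> 'x"
  assumes subspace_E: "subspace (E s t)"
    and E_neg: "s < 0 \<or> t < 0 \<Longrightarrow> E s t = {0}"
    and d0_hom: "module_hom scale scale d0" and d1_hom: "module_hom scale scale d1"
    and d0_in: "a \<in> E s t \<Longrightarrow> d0 a \<in> E s (t + 1)"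
    and d1_in: "a \<in> E s t \<Longrightarrow> d1 a \<in> E (s + 1) (t - 1)"
    and d0_d0: "a \<in> E s t \<Longrightarrow> d0 (d0 a) = 0"
    and d1_d1: "a \<in> E s t \<Longrightarrow> d1 (d1 a) = 0"
    and d0_d1: "a \<in> E s t \<Longrightarrow> d0 (d1 a) + d1 (d0 a) = 0"
begin

lemmas d0_simps = module_hom.add[OF d0_hom] module_hom.scale[OF d0_hom] module_hom.zero[OF d0_hom]
  module_hom.diff[OF d0_hom] module_hom.sum[OF d0_hom]
lemmas d1_simps = module_hom.add[OF d1_hom] module_hom.scale[OF d1_hom] module_hom.zero[OF d1_hom]
  module_hom.diff[OF d1_hom] module_hom.sum[OF d1_hom]

text \<open>The cochains of the total complex of filtration at least \<open>s\<close> and total degree \<open>2 s + t\<close>.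
  Infinite sequences avoid a bound on the length, although almost all of their entries are zero.\<close>
definition Seq :: "int \<Rightarrow> int \<Rightarrow> (nat \<Rightarrow> 'x) set" where
  "Seq s t = {z. \<forall>i. z i \<in> E (s + int i) (t - 2 * int i)}"

text \<open>The total differential, indexed by filtration relative to the start of the sequence.\<close>
definition D :: "(nat \<Rightarrow> 'x) \<Rightarrow> nat \<Rightarrow> 'x" where
  "D z k = d0 (z k) + (case k of 0 \<Rightarrow> 0 | Suc j \<Rightarrow> d1 (z j))"

text \<open>The inclusion of the next step of the filtration.\<close>
definition delay :: "(nat \<Rightarrow> 'x) \<Rightarrow> nat \<Rightarrow> 'x" where
  "delay w i = (case i of 0 \<Rightarrow> 0 | Suc j \<Rightarrow> w j)"

lemma E_zero: "0 \<in> E s t" by (rule subspace_0[OF subspace_E])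

lemma D_simps: "D z 0 = d0 (z 0)" "D z (Suc j) = d0 (z (Suc j)) + d1 (z j)"
  by (simp_all add: D_def)

lemma delay_simps: "delay w 0 = 0" "delay w (Suc j) = w j"
  by (simp_all add: delay_def)

lemma D_linear:
  "D (\<lambda>i. z i + w i) k = D z k + D w k" "D (\<lambda>i. z i - w i) k = D z k - D w k"
  "D (\<lambda>i. scale c (z i)) k = scale c (D z k)" "D (\<lambda>i. 0) k = 0"
  by (cases k; simp add: D_simps d0_simps d1_simps scale_right_distrib)+

lemma D_delay: "D (delay w) = delay (D w)"
proof
  fix k show "D (delay w) k = delay (D w) k"
    by (cases k rule: nat.exhaust; cases "k - 1")
       (auto simp: D_simps delay_simps d0_simps d1_simps)
qed

lemma Seq_linear:
  "z \<in> Seq s t \<Longrightarrow> w \<in> Seq s t \<Longrightarrow> (\<lambda>i. z i + w i) \<in> Seq s t"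
  "z \<in> Seq s t \<Longrightarrow> w \<in> Seq s t \<Longrightarrow> (\<lambda>i. z i - w i) \<in> Seq s t"
  "z \<in> Seq s t \<Longrightarrow> (\<lambda>i. scale c (z i)) \<in> Seq s t"
  "(\<lambda>i. 0) \<in> Seq s t"
  by (auto simp: Seq_def subspace_add[OF subspace_E] subspace_diff[OF subspace_E]
      subspace_scale[OF subspace_E] E_zero)

lemma Seq_delay: "w \<in> Seq (s + 1) (t - 2) \<Longrightarrow> delay w \<in> Seq s t"
  unfolding Seq_def mem_Collect_eq
proof
  fix i assume w: "\<forall>i. w i \<in> E (s + 1 + int i) (t - 2 - 2 * int i)"
  show "delay w i \<in> E (s + int i) (t - 2 * int i)"
    by (cases i) (use w in \<open>auto simp: delay_simps E_zero algebra_simps\<close>)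
qed

lemma Seq_drop: "z \<in> Seq s t \<Longrightarrow> (\<lambda>i. z (i + q)) \<in> Seq (s + int q) (t - 2 * int q)"
  unfolding Seq_def mem_Collect_eq
proof
  fix i assume "\<forall>i. z i \<in> E (s + int i) (t - 2 * int i)"
  then have "z (i + q) \<in> E (s + int (i + q)) (t - 2 * int (i + q))" by blast
  then show "z (i + q) \<in> E (s + int q + int i) (t - 2 * int q - 2 * int i)"
    by (simp add: algebra_simps)
qed

lemma Seq_D: "z \<in> Seq s t \<Longrightarrow> D z \<in> Seq s (t + 1)"
  unfolding Seq_def mem_Collect_eq
proof
  fix k assume z: "\<forall>i. z i \<in> E (s + int i) (t - 2 * int i)"
  have d0: "d0 (z k) \<in> E (s + int k) (t + 1 - 2 * int k)"
    using d0_in[OF z[rule_format, of k]] by (simp add: algebra_simps)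
  show "D z k \<in> E (s + int k) (t + 1 - 2 * int k)"
  proof (cases k)
    case (Suc j)
    have "d1 (z j) \<in> E (s + int k) (t + 1 - 2 * int k)"
      using d1_in[OF z[rule_format, of j]] Suc by (simp add: algebra_simps)
    then show ?thesis using d0 subspace_add[OF subspace_E] by (simp add: Suc D_simps)
  qed (use d0 in \<open>simp add: D_simps\<close>)
qed

lemma D_D:
  assumes "z \<in> Seq s t"
  shows "D (D z) k = 0"
proof -
  have z: "z i \<in> E (s + int i) (t - 2 * int i)" for i using assms by (simp add: Seq_def)
  note [simp] = D_simps d0_simps d1_simps d0_d0[OF z] d1_d1[OF z]
  show ?thesis
  proof (cases k)
    case (Suc j)
    then show ?thesis using d0_d1[OF z[of j]] by (cases j) (simp_all add: add.commute)
  qed simp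
qed

text \<open>The cochains whose coboundary lies \<open>r\<close> steps further in the filtration. The classes on page \<open>r\<close> are
  their leading entries.\<close>
definition Zseq :: "nat \<Rightarrow> int \<Rightarrow> int \<Rightarrow> (nat \<Rightarrow> 'x) set" where
  "Zseq r s t = {z \<in> Seq s t. \<forall>i<r. D z i = 0}"

definition Zpage :: "nat \<Rightarrow> int \<Rightarrow> int \<Rightarrow> 'x set" where
  "Zpage r s t = (\<lambda>z. z 0) ` Zseq r s t"

text \<open>A class of page \<open>q + 1\<close> is zero if it is the leading entry of a coboundary that starts at most \<open>q\<close>
  steps lower in the filtration. The entry \<open>w q\<close> accounts for the boundaries of \<open>d\<^sub>0\<close>.\<close>
fun Bpage :: "nat \<Rightarrow> int \<Rightarrow> int \<Rightarrow> 'x set" where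
  "Bpage 0 s t = {0}"
| "Bpage (Suc q) s t = (\<lambda>w. D w q) ` Zseq q (s - int q) (t + 2 * int q - 1)"

definition dpage :: "nat \<Rightarrow> int \<Rightarrow> int \<Rightarrow> 'x set \<Rightarrow> 'x set" where
  "dpage r s t X = (\<Union>z\<in>{z \<in> Zseq r s t. z 0 \<in> X}. D z r +o Bpage r (s + int r) (t - (2 * int r - 1)))"

lemma Zpage_I: "z \<in> Zseq r s t \<Longrightarrow> z 0 \<in> Zpage r s t"
  by (simp add: Zpage_def)

lemma Zpage_subset_E: "Zpage r s t \<subseteq> E s t"
proof -
  have "z 0 \<in> E s t" if "\<forall>i. z i \<in> E (s + int i) (t - 2 * int i)" for z
    using that[rule_format, of 0] by simp
  then show ?thesis by (auto simp: Zpage_def Zseq_def Seq_def)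
qed

lemma Zseq_linear:
  "z \<in> Zseq r s t \<Longrightarrow> w \<in> Zseq r s t \<Longrightarrow> (\<lambda>i. z i + w i) \<in> Zseq r s t"
  "z \<in> Zseq r s t \<Longrightarrow> w \<in> Zseq r s t \<Longrightarrow> (\<lambda>i. z i - w i) \<in> Zseq r s t"
  "z \<in> Zseq r s t \<Longrightarrow> (\<lambda>i. scale c (z i)) \<in> Zseq r s t"
  "(\<lambda>i. 0) \<in> Zseq r s t"
  by (auto simp: Zseq_def Seq_linear D_linear)

lemma subspace_Zpage: "subspace (Zpage r s t)"
  unfolding Zpage_def
  by (rule subspaceI)
     (use Zseq_linear in \<open>fastforce simp: image_iff\<close>)+

lemma subspace_Bpage: "subspace (Bpage r s t)"
proof (cases r)
  case (Suc q)
  have "subspace ((\<lambda>w. D w q) ` Zseq q s' t')" for s' t'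
  proof (rule subspaceI)
    show "0 \<in> (\<lambda>w. D w q) ` Zseq q s' t'"
      using Zseq_linear(4) D_linear(4) by (metis image_eqI)
    show "x + y \<in> (\<lambda>w. D w q) ` Zseq q s' t'"
      if "x \<in> (\<lambda>w. D w q) ` Zseq q s' t'" "y \<in> (\<lambda>w. D w q) ` Zseq q s' t'" for x y
      using that by (auto simp: D_linear(1)[symmetric] intro: Zseq_linear)
    show "scale c x \<in> (\<lambda>w. D w q) ` Zseq q s' t'" if "x \<in> (\<lambda>w. D w q) ` Zseq q s' t'" for c x
      using that by (auto simp: D_linear(3)[symmetric] intro: Zseq_linear)
  qed
  then show ?thesis by (simp add: Suc)
qed (simp add: subspace_single_0)

lemma Zseq_delay: "w \<in> Zseq q (s + 1) (t - 2) \<Longrightarrow> delay w \<in> Zseq (Suc q) s t"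
  by (auto simp: Zseq_def Seq_delay D_delay delay_def split: nat.split)

lemma Bpage_mono: "Bpage r s t \<subseteq> Bpage (Suc r) s t"
proof (cases r)
  case 0
  then show ?thesis using subspace_0[OF subspace_Bpage, of "Suc r" s t] by simp
next
  case (Suc q)
  show ?thesis
  proof
    fix b assume "b \<in> Bpage r s t"
    then obtain w where w: "w \<in> Zseq q (s - int q) (t + 2 * int q - 1)" "b = D w q"
      by (auto simp: Suc)
    then have "delay w \<in> Zseq r (s - int r) (t + 2 * int r - 1)"
      unfolding Suc by (intro Zseq_delay) (simp add: algebra_simps)
    moreover have "D (delay w) r = b" by (simp add: D_delay delay_simps Suc w(2))
    ultimately show "b \<in> Bpage (Suc r) s t" by force
  qed
qed

lemma Bpage_mono_le: "r \<le> r' \<Longrightarrow> Bpage r s t \<subseteq> Bpage r' s t"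
  by (rule lift_Suc_mono_le[of "\<lambda>r. Bpage r s t"]) (rule Bpage_mono)

lemma Zpage_antimono: "r \<le> r' \<Longrightarrow> Zpage r' s t \<subseteq> Zpage r s t"
  by (auto simp: Zpage_def Zseq_def)

text \<open>The rest of \<open>D w\<close> from its first nonzero entry on is a cocycle, as \<open>D\<close> has square zero.\<close>
lemma D_tail:
  assumes "w \<in> Zseq q s t"
  obtains v where "v \<in> Seq (s + int q) (t + 1 - 2 * int q)" "\<And>k. D v k = 0" "v 0 = D w q"
proof
  let ?v = "\<lambda>i. D w (i + q)"
  from assms have w: "w \<in> Seq s t" "\<And>i. i < q \<Longrightarrow> D w i = 0" by (auto simp: Zseq_def)
  show "?v \<in> Seq (s + int q) (t + 1 - 2 * int q)" by (rule Seq_drop[OF Seq_D[OF w(1)]])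
  show "?v 0 = D w q" by simp
  show "D ?v k = 0" for k
  proof (cases k)
    case 0
    show ?thesis
    proof (cases q)
      case (Suc q')
      then have "D w q' = 0" using w(2) by simp
      then show ?thesis
        using D_D[OF w(1), of q] D_simps(1)[of ?v] D_simps(2)[of "D w" q'] 0 Suc by (simp add: d1_simps)
    qed (use D_D[OF w(1), of 0] 0 in \<open>simp add: D_simps(1)[of "D w"] D_simps(1)[of ?v]\<close>)
  next
    case (Suc j)
    then show ?thesis using D_D[OF w(1), of "k + q"]
      by (simp add: D_simps(2)[of "D w"] D_simps(2)[of ?v])
  qed
qed

lemma Bpage_cocycle:
  assumes "b \<in> Bpage r s t"
  obtains v where "v \<in> Seq s t" "\<And>k. D v k = 0" "v 0 = b"
proof (cases r)
  case 0
  then show ?thesis using that[OF Seq_linear(4)] assms by (simp add: D_linear)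
next
  case (Suc q)
  then obtain w where w: "w \<in> Zseq q (s - int q) (t + 2 * int q - 1)" "b = D w q"
    using assms by auto
  from D_tail[OF w(1)] obtain v where "v \<in> Seq (s - int q + int q) (t + 2 * int q - 1 + 1 - 2 * int q)"
    "\<And>k. D v k = 0" "v 0 = D w q" by blast
  then show ?thesis using that[of v] w(2) by simp
qed

lemma Bpage_subset_Zpage: "Bpage r s t \<subseteq> Zpage r' s t"
proof
  fix b assume "b \<in> Bpage r s t"
  then obtain v where "v \<in> Seq s t" "\<And>k. D v k = 0" "v 0 = b" by (rule Bpage_cocycle) auto
  then show "b \<in> Zpage r' s t" by (auto simp: Zpage_def Zseq_def)
qed

text \<open>The page differential does not depend on the choice of the sequence. If \<open>u 0\<close> is the leading entry of a
  coboundary, that coboundary is subtracted from \<open>u\<close>; this does not affect \<open>D u\<close>, and the rest of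
  \<open>u\<close> exhibits \<open>D u r\<close> as a boundary.\<close>
lemma D_boundary:
  assumes u: "u \<in> Zseq r s t" "u 0 \<in> Bpage r s t"
  shows "D u r \<in> Bpage r (s + int r) (t - (2 * int r - 1))"
proof (cases r)
  case 0
  then show ?thesis using u(2) by (simp add: D_simps d0_simps)
next
  case (Suc q)
  from u(2) obtain v where v: "v \<in> Seq s t" "\<And>k. D v k = 0" "v 0 = u 0"
    by (rule Bpage_cocycle) auto
  define x where "x i = u (Suc i) - v (Suc i)" for i
  have uS: "u \<in> Seq s t" "\<And>i. i < r \<Longrightarrow> D u i = 0" using u(1) by (auto simp: Zseq_def)
  have "x \<in> Seq (s + 1) (t - 2)"
    using Seq_drop[OF Seq_linear(2)[OF uS(1) v(1)], of 1] by (simp add: x_def[abs_def])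
  moreover have Dx: "D x k = D u (Suc k)" for k
  proof -
    have "D (\<lambda>i. u i - v i) (Suc k) = D u (Suc k)" by (simp add: D_linear v(2))
    moreover have "D (\<lambda>i. u i - v i) (Suc k) = D x k"
      by (cases k) (simp_all add: D_simps x_def v(3) d1_simps)
    ultimately show ?thesis by simp
  qed
  ultimately have "x \<in> Zseq q (s + 1) (t - 2)" using uS(2) Suc by (simp add: Zseq_def)
  moreover have "s + int r - int q = s + 1" "t - (2 * int r - 1) + 2 * int q - 1 = t - 2"
    by (simp_all add: Suc)
  ultimately show ?thesis unfolding Suc Bpage.simps using Dx[of q] Suc by (simp add: image_iff) metis
qed

lemma dpage_coset:
  assumes z: "z \<in> Zseq r s t"
  shows "dpage r s t (z 0 +o Bpage r s t) = D z r +o Bpage r (s + int r) (t - (2 * int r - 1))"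
proof -
  have "D z' r +o Bpage r (s + int r) (t - (2 * int r - 1)) = D z r +o Bpage r (s + int r) (t - (2 * int r - 1))"
    if "z' \<in> Zseq r s t" "z' 0 \<in> z 0 +o Bpage r s t" for z'
    unfolding coset_eq_iff[OF subspace_Bpage]
    using D_boundary[OF Zseq_linear(2)[OF that(1) z]] set_plus_imp_minus[OF that(2)]
    by (simp add: D_linear)
  moreover have "z 0 \<in> z 0 +o Bpage r s t" by (rule coset_self[OF subspace_Bpage])
  ultimately show ?thesis using z unfolding dpage_def by blast
qed

lemma quot_cases:
  assumes "X \<in> quot (Zpage r s t) (Bpage r s t)"
  obtains z where "z \<in> Zseq r s t" "X = z 0 +o Bpage r s t"
  using assms by (auto simp: quot_def Zpage_def)

lemma D_in_Zpage:
  assumes "z \<in> Zseq r s t"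
  shows "D z r \<in> Zpage r' (s + int r) (t - (2 * int r - 1))"
proof -
  obtain v where "v \<in> Seq (s + int r) (t + 1 - 2 * int r)" "\<And>k. D v k = 0" "v 0 = D z r"
    using D_tail[OF assms] by blast
  moreover have "t + 1 - 2 * int r = t - (2 * int r - 1)" by simp
  ultimately have "v \<in> Zseq r' (s + int r) (t - (2 * int r - 1))" by (simp add: Zseq_def)
  from Zpage_I[OF this] show ?thesis by (simp add: \<open>v 0 = D z r\<close>)
qed

text \<open>The kernel of the page differential. If \<open>D z r\<close> is a boundary, the cochain responsible for it starts one
  step after \<open>z\<close>, so that it can be subtracted from \<open>z\<close> without changing \<open>z 0\<close>.\<close>
lemma Zpage_Suc_iff:
  assumes z: "z \<in> Zseq r s t"
  shows "z 0 \<in> Zpage (Suc r) s t \<longleftrightarrow> D z r \<in> Bpage r (s + int r) (t - (2 * int r - 1))"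
proof
  assume "z 0 \<in> Zpage (Suc r) s t"
  then obtain z' where z': "z' \<in> Zseq (Suc r) s t" "z' 0 = z 0" by (auto simp: Zpage_def)
  have "(\<lambda>i. z i - z' i) \<in> Zseq r s t"
    using z' z by (intro Zseq_linear) (auto simp: Zseq_def)
  from D_boundary[OF this] show "D z r \<in> Bpage r (s + int r) (t - (2 * int r - 1))"
    using z' subspace_0[OF subspace_Bpage] by (simp add: D_linear Zseq_def)
next
  assume B: "D z r \<in> Bpage r (s + int r) (t - (2 * int r - 1))"
  show "z 0 \<in> Zpage (Suc r) s t"
  proof (cases r)
    case 0
    then have "z \<in> Zseq (Suc r) s t" using z B by (simp add: Zseq_def)
    then show ?thesis by (auto simp: Zpage_def)
  next
    case (Suc q)
    have "s + int r - int q = s + 1" "t - (2 * int r - 1) + 2 * int q - 1 = t - 2"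
      by (simp_all add: Suc)
    with B obtain w where w: "w \<in> Zseq q (s + 1) (t - 2)" "D z r = D w q"
      unfolding Suc Bpage.simps by auto
    define y where "y i = z i - delay w i" for i
    have "y \<in> Zseq r s t"
      unfolding y_def Suc using z[unfolded Suc] by (intro Zseq_linear Zseq_delay[OF w(1)])
    moreover have "D y r = 0"
      by (simp add: y_def[abs_def] D_linear D_delay w(2)) (simp add: Suc delay_simps)
    ultimately have "y \<in> Zseq (Suc r) s t" by (auto simp: Zseq_def less_Suc_eq)
    moreover have "y 0 = z 0" by (simp add: y_def delay_simps)
    ultimately show ?thesis using Zpage_I by metis
  qed
qed

lemma spectral_sequence: "spectral_sequence scale Zpage Bpage dpage"
proof unfold_locales
  fix r s t c
  let ?B = "Bpage r s t" and ?B' = "Bpage r (s + int r) (t - (2 * int r - 1))"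
  show "subspace (Zpage r s t)" "subspace ?B" "?B \<subseteq> Zpage r s t"
    by (rule subspace_Zpage subspace_Bpage Bpage_subset_Zpage)+
  show "quot (Zpage r s t) ?B = {?B}" if "s < 0 \<or> t < 0"
  proof -
    have "Zpage r s t \<subseteq> {0}" using E_neg[OF that] Zpage_subset_E by metis
    then have "Zpage r s t = {0}" using subspace_0[OF subspace_Zpage] by blast
    then show ?thesis by (simp add: quot_def)
  qed
  show "dpage r s t (X + Y) = dpage r s t X + dpage r s t Y"
    if X: "X \<in> quot (Zpage r s t) ?B" and Y: "Y \<in> quot (Zpage r s t) ?B" for X Y
  proof -
    obtain z w where z: "z \<in> Zseq r s t" "X = z 0 +o ?B" and w: "w \<in> Zseq r s t" "Y = w 0 +o ?B"
      using X Y by (meson quot_cases)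
    show ?thesis
      using dpage_coset[OF Zseq_linear(1)[OF z(1) w(1)]]
      by (simp add: z(2) w(2) dpage_coset[OF z(1)] dpage_coset[OF w(1)] coset_add[OF subspace_Bpage] D_linear)
  qed
  show "Zpage (Suc r) s t = {z \<in> Zpage r s t. dpage r s t (z +o ?B) = ?B'}"
  proof -
    have "Zpage (Suc r) s t \<subseteq> Zpage r s t" by (rule Zpage_antimono) simp
    moreover have "a \<in> Zpage (Suc r) s t \<longleftrightarrow> dpage r s t (a +o ?B) = ?B'" if a: "a \<in> Zpage r s t" for a
    proof -
      obtain z where "z \<in> Zseq r s t" "a = z 0" using a by (auto simp: Zpage_def)
      then show ?thesis by (simp only: Zpage_Suc_iff dpage_coset coset_eq_self_iff[OF subspace_Bpage])
    qed
    ultimately show ?thesis by blast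
  qed
  show "Bpage (Suc r) (s + int r) (t - (2 * int r - 1)) = \<Union> (dpage r s t ` quot (Zpage r s t) ?B)"
  proof -
    have eq: "Bpage (Suc r) (s + int r) (t - (2 * int r - 1)) = (\<lambda>z. D z r) ` Zseq r s t"
      by simp
    have "\<Union> (dpage r s t ` quot (Zpage r s t) ?B) = (\<Union>z\<in>Zseq r s t. D z r +o ?B')"
      unfolding quot_def Zpage_def using dpage_coset[of _ r s t] by force
    also have "\<dots> = Bpage (Suc r) (s + int r) (t - (2 * int r - 1))"
    proof
      show "(\<Union>z\<in>Zseq r s t. D z r +o ?B') \<subseteq> Bpage (Suc r) (s + int r) (t - (2 * int r - 1))"
      proof
        fix x assume "x \<in> (\<Union>z\<in>Zseq r s t. D z r +o ?B')"
        then obtain z b where x: "z \<in> Zseq r s t" "b \<in> ?B'" "x = D z r + b"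
          by (auto simp: elt_set_plus_def)
        have "D z r \<in> Bpage (Suc r) (s + int r) (t - (2 * int r - 1))" unfolding eq using x(1) by simp
        then show "x \<in> Bpage (Suc r) (s + int r) (t - (2 * int r - 1))"
          unfolding x(3) using x(2) Bpage_mono by (intro subspace_add[OF subspace_Bpage]) blast+
      qed
      show "Bpage (Suc r) (s + int r) (t - (2 * int r - 1)) \<subseteq> (\<Union>z\<in>Zseq r s t. D z r +o ?B')"
        unfolding eq using coset_self[OF subspace_Bpage] by blast
    qed
    finally show ?thesis by simp
  qed
  fix X assume "X \<in> quot (Zpage r s t) ?B"
  then obtain z where z: "z \<in> Zseq r s t" "X = z 0 +o ?B" by (rule quot_cases)
  show "dpage r s t X \<in> quot (Zpage r (s + int r) (t - (2 * int r - 1))) ?B'"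
    unfolding z(2) dpage_coset[OF z(1)] using D_in_Zpage[OF z(1)] by (simp add: quot_def)
  show "dpage r s t (quot_scale scale ?B c X) = quot_scale scale ?B' c (dpage r s t X)"
    using dpage_coset[OF Zseq_linear(3)[OF z(1)]]
    by (simp add: z(2) dpage_coset[OF z(1)] quot_scale_coset[OF subspace_Bpage] D_linear)
  show "dpage r (s + int r) (t - (2 * int r - 1)) (dpage r s t X) = Bpage r (s + 2 * int r) (t - 2 * (2 * int r - 1))"
  proof -
    obtain v where v: "v \<in> Seq (s + int r) (t + 1 - 2 * int r)" "\<And>k. D v k = 0" "v 0 = D z r"
      using D_tail[OF z(1)] by blast
    have idx: "t + 1 - 2 * int r = t - (2 * int r - 1)" by simp
    have "v \<in> Zseq r (s + int r) (t - (2 * int r - 1))"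
      using v(1)[unfolded idx] v(2) by (simp only: Zseq_def mem_Collect_eq simp_thms)
    from dpage_coset[OF this] show ?thesis
      unfolding z(2) dpage_coset[OF z(1)] v(2,3) by (simp add: algebra_simps)
  qed
qed

lemma Zpage_0: "Zpage 0 s t = E s t"
proof
  show "E s t \<subseteq> Zpage 0 s t"
  proof
    fix a assume a: "a \<in> E s t"
    define z where "z i = (if i = 0 then a else 0)" for i :: nat
    have "z \<in> Zseq 0 s t" using a by (auto simp: z_def Zseq_def Seq_def E_zero)
    from Zpage_I[OF this] show "a \<in> Zpage 0 s t" by (simp add: z_def)
  qed
qed (rule Zpage_subset_E)

lemma dpage_0:
  assumes "a \<in> E s t"
  shows "dpage 0 s t {a} = {d0 a}"
proof -
  define z where "z i = (if i = 0 then a else 0)" for i :: nat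
  have "z \<in> Zseq 0 s t" using assms by (auto simp: z_def Zseq_def Seq_def E_zero)
  from dpage_coset[OF this] show ?thesis by (simp add: z_def D_simps elt_set_plus_def)
qed

subsection \<open>Zig-zags\<close>

lemma Zseq_zigzag:
  assumes "z \<in> Zseq r s t" "r \<ge> 1"
  shows "zigzag E d0 d1 r s t z"
  unfolding zigzag_def
proof (intro conjI allI impI)
  from assms have D: "\<And>i. i < r \<Longrightarrow> D z i = 0" and z: "z \<in> Seq s t" by (auto simp: Zseq_def)
  show "z i \<in> E (s + int i) (t - 2 * int i)" for i using z by (simp add: Seq_def)
  show "d0 (z 0) = 0" using D[of 0] assms(2) by (simp add: D_simps)
  show "d1 (z i) + d0 (z (Suc i)) = 0" if "Suc i < r" for i
    using D[OF that] by (simp add: D_simps add.commute)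
qed

lemma zigzag_Zseq:
  assumes "zigzag E d0 d1 r s t z" "r \<ge> 1"
  shows "(\<lambda>i. if i < r then z i else 0) \<in> Zseq r s t" (is "?z \<in> _")
proof -
  have "D ?z i = 0" if "i < r" for i
    using that assms by (cases i) (auto simp: D_simps zigzag_def add.commute)
  moreover have "?z \<in> Seq s t" using assms(1) by (auto simp: Seq_def zigzag_def E_zero)
  ultimately show ?thesis by (simp add: Zseq_def)
qed

lemma Zpage_zigzag:
  assumes "r \<ge> 1"
  shows "Zpage r s t = {z 0 | z. zigzag E d0 d1 r s t z}"
proof (intro equalityI subsetI)
  fix a assume "a \<in> Zpage r s t"
  then obtain z where "z \<in> Zseq r s t" "a = z 0" by (auto simp: Zpage_def)
  then show "a \<in> {z 0 | z. zigzag E d0 d1 r s t z}" using Zseq_zigzag assms by blast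
next
  fix a assume "a \<in> {z 0 | z. zigzag E d0 d1 r s t z}"
  then obtain z where "zigzag E d0 d1 r s t z" "a = z 0" by blast
  with Zpage_I[OF zigzag_Zseq[OF this(1) assms]] assms show "a \<in> Zpage r s t" by simp
qed

lemma dpage_zigzag:
  assumes "zigzag E d0 d1 r s t z" "r \<ge> 1"
  shows "dpage r s t (z 0 +o Bpage r s t) = d1 (z (r - 1)) +o Bpage r (s + int r) (t - (2 * int r - 1))"
proof -
  have "D (\<lambda>i. if i < r then z i else 0) r = d1 (z (r - 1))"
    using assms(2) by (cases r) (simp_all add: D_simps d0_simps)
  then show ?thesis using dpage_coset[OF zigzag_Zseq[OF assms]] assms(2) by simp
qed

lemma dpage_1:
  assumes "a \<in> Zpage 1 s t"
  shows "dpage 1 s t (a +o Bpage 1 s t) = d1 a +o Bpage 1 (s + 1) (t - 1)"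
proof -
  obtain z where "a = z 0" "zigzag E d0 d1 1 s t z"
    using assms Zpage_zigzag[of 1 s t] by auto
  then show ?thesis using dpage_zigzag[of 1 s t z] by simp
qed

subsection \<open>Convergence\<close>

text \<open>The components of \<open>D z\<close> from index \<open>t + 2\<close> on have negative exterior degree and vanish.\<close>
lemma Zpage_stable:
  assumes "t + 2 \<le> int r"
  shows "Zpage r s t \<subseteq> Zpage r' s t"
proof
  fix a assume "a \<in> Zpage r s t"
  then obtain z where z: "z \<in> Seq s t" "\<And>i. i < r \<Longrightarrow> D z i = 0" "a = z 0"
    by (auto simp: Zpage_def Zseq_def)
  have "D z i = 0" for i
  proof (cases "i < r")
    case False
    have "D z i \<in> E (s + int i) (t + 1 - 2 * int i)" using Seq_D[OF z(1)] by (simp add: Seq_def)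
    moreover have "t + 1 - 2 * int i < 0" using False assms by linarith
    ultimately show ?thesis using E_neg by blast
  qed (use z in blast)
  then have "z \<in> Zseq r' s t" using z(1) by (simp add: Zseq_def)
  then show "a \<in> Zpage r' s t" unfolding z(3) by (rule Zpage_I)
qed

text \<open>A cochain that starts in negative filtration has leading entry zero, so it may start later.\<close>
lemma Bpage_stable_Suc:
  assumes "s < int q" "q \<ge> 1"
  shows "Bpage (Suc q) s t \<subseteq> Bpage q s t"
proof
  fix b assume "b \<in> Bpage (Suc q) s t"
  then obtain w where w: "w \<in> Seq (s - int q) (t + 2 * int q - 1)" "\<And>i. i < q \<Longrightarrow> D w i = 0" "b = D w q"
    by (auto simp: Zseq_def)
  obtain p where p: "q = Suc p" using assms(2) by (cases q) auto
  have "w 0 \<in> E (s - int q) (t + 2 * int q - 1)" using w(1) by (auto simp: Seq_def dest: spec[of _ 0])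
  then have w0: "w 0 = 0" using E_neg[of "s - int q"] assms(1) by auto
  define v where "v i = w (Suc i)" for i
  have "v \<in> Seq (s - int p) (t + 2 * int p - 1)"
    using Seq_drop[OF w(1), of 1] by (simp add: v_def[abs_def] p algebra_simps)
  moreover have Dv: "D v k = D w (Suc k)" for k
    by (cases k) (simp_all add: D_simps v_def w0 d1_simps)
  ultimately have "v \<in> Zseq p (s - int p) (t + 2 * int p - 1)" using w(2) p by (simp add: Zseq_def)
  then show "b \<in> Bpage q s t" unfolding p Bpage.simps using w(3) Dv[of p] p by (metis image_eqI)
qed

lemma Bpage_stable:
  assumes "s < int r" "r \<ge> 1"
  shows "Bpage r' s t \<subseteq> Bpage r s t"
proof (cases "r' \<le> r")
  case False
  then have "r \<le> r'" by simp
  then show ?thesis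
  proof (induction r' rule: dec_induct)
    case (step m)
    then show ?case using Bpage_stable_Suc[of s m t] assms by auto
  qed simp
qed (rule Bpage_mono_le)

lemma pages_stable:
  obtains R where "\<And>r. r \<ge> R \<Longrightarrow> Zpage r s t = Z_inf Zpage s t"
    and "\<And>r. r \<ge> R \<Longrightarrow> Bpage r s t = B_inf Bpage s t"
proof
  let ?R = "Suc (nat (max (t + 2) (s + 1)))"
  fix r assume "r \<ge> ?R"
  then have r: "t + 2 \<le> int r" "s < int r" "r \<ge> 1" by linarith+
  show "Zpage r s t = Z_inf Zpage s t"
    using Zpage_stable[OF r(1), of s] by (auto simp: Z_inf_def)
  show "Bpage r s t = B_inf Bpage s t"
    using Bpage_stable[OF r(2,3), of _ t] by (auto simp: B_inf_def)
qed

text \<open>The last component of a cocycle is closed for \<open>d\<^sub>1\<close>, hence equal to \<open>d\<^sub>1 b\<close>. Subtracting the total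
  coboundary of \<open>b\<close> shortens the cocycle by one. The bidegree \<open>(0, 0)\<close>, where \<open>d\<^sub>1\<close> is not exact,
  does not occur for \<open>N \<noteq> 0\<close>.\<close>
lemma total_exact:
  assumes exact: "\<And>s t a. a \<in> E s t \<Longrightarrow> (s, t) \<noteq> (0, 0) \<Longrightarrow> d1 a = 0 \<Longrightarrow> \<exists>b\<in>E (s - 1) (t + 1). d1 b = a"
    and "N \<noteq> 0"
  shows "z \<in> Seq 0 N \<Longrightarrow> (\<And>k. D z k = 0) \<Longrightarrow> (\<And>i. i \<ge> m \<Longrightarrow> z i = 0) \<Longrightarrow>
    \<exists>w\<in>Seq 0 (N - 1). \<forall>k. D w k = z k"
proof (induction m arbitrary: z)
  case 0
  then show ?case using Seq_linear(4) D_linear(4) by (metis bot_nat_0.extremum)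
next
  case (Suc m)
  have zm: "z m \<in> E (int m) (N - 2 * int m)" using Suc.prems(1) by (simp add: Seq_def)
  have "d1 (z m) = 0"
    using Suc.prems(2)[of "Suc m"] Suc.prems(3)[of "Suc m"] by (simp add: D_simps d0_simps)
  with exact[OF zm] assms(2) obtain b where b: "b \<in> E (int m - 1) (N - 2 * int m + 1)" "d1 b = z m"
    by (cases "m = 0") auto
  show ?case
  proof (cases m)
    case 0
    then have "z 0 = 0" using b E_neg[of "-1"] by (auto simp: d1_simps)
    then have "z i = 0" for i using Suc.prems(3)[of i] 0 by (cases i) auto
    then show ?thesis using Seq_linear(4) D_linear(4) by metis
  next
    case (Suc p)
    define v where "v i = (if i = p then b else 0)" for i
    have v: "v \<in> Seq 0 (N - 1)" using b(1) by (auto simp: v_def Seq_def Suc E_zero algebra_simps)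
    have Dv: "D v m = z m" "D v i = 0" if "i > m" for i
      using b(2) that by (auto simp: Suc D_simps v_def d0_simps)
         (cases i; auto simp: Suc D_simps v_def d0_simps d1_simps)
    have Dvm: "D v m = z m" using b(2) by (simp add: Suc D_simps v_def d0_simps)
    define y where "y i = z i - D v i" for i
    have "y \<in> Seq 0 N" unfolding y_def using Seq_linear(2)[OF Suc.prems(1) Seq_D[OF v, simplified]] by simp
    moreover have "D y k = 0" for k
      unfolding y_def D_linear D_D[OF v] using Suc.prems(2) by simp
    moreover have "y i = 0" if "i \<ge> m" for i
      using that Dvm Dv(2)[of i] Suc.prems(3)[of i] by (cases "i = m") (auto simp: y_def)
    ultimately obtain w where w: "w \<in> Seq 0 (N - 1)" "\<forall>k. D w k = y k" using Suc.IH by blast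
    have "(\<lambda>i. w i + v i) \<in> Seq 0 (N - 1)" by (rule Seq_linear(1)[OF w(1) v])
    moreover have "D (\<lambda>i. w i + v i) k = z k" for k using w(2) by (simp add: D_linear y_def)
    ultimately show ?thesis by blast
  qed
qed

text \<open>A permanent cycle extends to a cocycle of the total complex. Padded with zeros, it starts in filtration
  \<open>0\<close> and is the coboundary of a cochain that starts there as well. So the class has become zero on
  page \<open>s + 1\<close>.\<close>
lemma Z_inf_subset_B_inf:
  assumes exact: "\<And>s t a. a \<in> E s t \<Longrightarrow> (s, t) \<noteq> (0, 0) \<Longrightarrow> d1 a = 0 \<Longrightarrow> \<exists>b\<in>E (s - 1) (t + 1). d1 b = a"
    and st: "(s, t) \<noteq> (0, 0)"
  shows "Z_inf Zpage s t \<subseteq> B_inf Bpage s t"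
proof (cases "s < 0 \<or> t < 0")
  case True
  have "Z_inf Zpage s t \<subseteq> Zpage 0 s t" by (auto simp: Z_inf_def)
  then have "Z_inf Zpage s t \<subseteq> {0}" using Zpage_subset_E[of 0 s t] E_neg[OF True] by blast
  moreover have "0 \<in> B_inf Bpage s t" using subspace_0[OF subspace_Bpage] by (auto simp: B_inf_def)
  ultimately show ?thesis by blast
next
  case False
  then obtain p where p: "s = int p" by (metis not_less zero_le_imp_eq_int)
  define N where "N = 2 * s + t"
  have N: "N \<noteq> 0" using False st by (auto simp: N_def)
  show ?thesis
  proof
    fix a assume "a \<in> Z_inf Zpage s t"
    then have "a \<in> Zpage (nat (t + 2)) s t" by (auto simp: Z_inf_def)
    then obtain x where x: "x \<in> Seq s t" "\<And>i. i < nat (t + 2) \<Longrightarrow> D x i = 0" "a = x 0"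
      by (auto simp: Zpage_def Zseq_def)
    have Dx: "D x i = 0" for i
    proof (cases "i < nat (t + 2)")
      case False
      have "D x i \<in> E (s + int i) (t + 1 - 2 * int i)" using Seq_D[OF x(1)] by (simp add: Seq_def)
      moreover have "t + 1 - 2 * int i < 0" using False by linarith
      ultimately show ?thesis using E_neg by blast
    qed (use x in blast)
    define z where "z i = (if i < p then 0 else x (i - p))" for i
    have zS: "z \<in> Seq 0 N"
    proof -
      have "z i \<in> E (0 + int i) (N - 2 * int i)" for i
      proof (cases "i < p")
        case False
        have "x (i - p) \<in> E (s + int (i - p)) (t - 2 * int (i - p))" using x(1) by (simp add: Seq_def)
        then show ?thesis using False by (simp add: z_def p N_def of_nat_diff algebra_simps)
      qed (simp add: z_def E_zero)
      then show ?thesis by (simp add: Seq_def)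
    qed
    have Dz: "D z i = 0" for i
    proof (cases "i < p")
      case True
      then show ?thesis by (cases i) (auto simp: D_simps z_def d0_simps d1_simps)
    next
      case False
      show ?thesis
      proof (cases "i = p")
        case True
        then show ?thesis using Dx[of 0] by (cases i) (auto simp: D_simps z_def d1_simps)
      next
        case neq: False
        then obtain j where j: "i = Suc (p + j)" using False by (metis less_imp_Suc_add linorder_neqE_nat)
        then show ?thesis using Dx[of "Suc j"] by (simp add: D_simps z_def Suc_diff_le)
      qed
    qed
    have "z i = 0" if "i \<ge> nat (N + 1)" for i
    proof -
      have "z i \<in> E (int i) (N - 2 * int i)" using zS by (simp add: Seq_def)
      moreover have "N - 2 * int i < 0" using that by linarith
      ultimately show ?thesis using E_neg by blast
    qed
    from total_exact[OF exact N zS Dz this] obtain w where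
      w: "w \<in> Seq 0 (N - 1)" "\<forall>k. D w k = z k" by blast
    have "w \<in> Zseq p (s - int p) (t + 2 * int p - 1)"
      using w by (simp add: Zseq_def p N_def z_def algebra_simps)
    moreover have "D w p = a" using w(2) by (simp add: z_def x(3))
    ultimately have "a \<in> Bpage (Suc p) s t" by force
    then show "a \<in> B_inf Bpage s t" unfolding B_inf_def by blast
  qed
qed

lemma quot_inf_trivial:
  assumes exact: "\<And>s t a. a \<in> E s t \<Longrightarrow> (s, t) \<noteq> (0, 0) \<Longrightarrow> d1 a = 0 \<Longrightarrow> \<exists>b\<in>E (s - 1) (t + 1). d1 b = a"
    and st: "(s, t) \<noteq> (0, 0)"
  shows "quot (Z_inf Zpage s t) (B_inf Bpage s t) = {B_inf Bpage s t}"
proof -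
  obtain R where R: "Zpage R s t = Z_inf Zpage s t" "Bpage R s t = B_inf Bpage s t"
    using pages_stable[of s t] by (metis order_refl)
  have sub: "subspace (B_inf Bpage s t)" "subspace (Z_inf Zpage s t)"
    unfolding R[symmetric] by (rule subspace_Bpage subspace_Zpage)+
  have "z +o B_inf Bpage s t = B_inf Bpage s t" if "z \<in> Z_inf Zpage s t" for z
    using Z_inf_subset_B_inf[OF exact st] that coset_eq_self_iff[OF sub(1)] by blast
  moreover have "0 \<in> Z_inf Zpage s t" by (rule subspace_0[OF sub(2)])
  ultimately show ?thesis by (auto simp: quot_def image_iff)
qed

text \<open>No differential enters the bidegree \<open>(0, 0)\<close>, as the sources have negative degrees, and \<open>d\<^sub>1\<close> leaves the
  quadrant there.\<close>
lemma corner: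
  assumes "\<And>a. a \<in> E 0 0 \<Longrightarrow> d0 a = 0"
  shows "Z_inf Zpage 0 0 = E 0 0" "B_inf Bpage 0 0 = {0}"
proof -
  have "a \<in> Zpage r 0 0" if a: "a \<in> E 0 0" for a r
  proof -
    define z where "z i = (if i = 0 then a else 0)" for i :: nat
    have "d1 a = 0" using d1_in[OF a] E_neg[of 1 "-1"] by simp
    then have "D z i = 0" for i
      by (cases i) (auto simp: z_def D_simps assms[OF a] d0_simps d1_simps)
    then have "z \<in> Zseq r 0 0" using a by (auto simp: z_def Zseq_def Seq_def E_zero)
    from Zpage_I[OF this] show ?thesis by (simp add: z_def)
  qed
  moreover have "Z_inf Zpage 0 0 \<subseteq> Zpage 0 0 0" by (auto simp: Z_inf_def)
  ultimately show "Z_inf Zpage 0 0 = E 0 0" unfolding Z_inf_def using Zpage_subset_E[of 0 0 0] by blast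
  have "Bpage r 0 0 \<subseteq> {0}" for r
  proof (cases r)
    case (Suc q)
    have "D w q = 0" if "w \<in> Seq (- int q) (2 * int q - 1)" for w
    proof -
      have w: "w i \<in> E (- int q + int i) (2 * int q - 1 - 2 * int i)" for i
        using that by (simp add: Seq_def)
      have "w q = 0" using w[of q] E_neg[of 0 "-1"] by simp
      moreover have "w p = 0" if "q = Suc p" for p
        using w[of p] E_neg[of "-1" 1] that by simp
      ultimately show ?thesis by (cases q) (simp_all add: D_simps d0_simps d1_simps)
    qed
    then show ?thesis by (auto simp: Suc Zseq_def)
  qed simp
  moreover have "0 \<in> Bpage 0 0 0" by simp
  ultimately show "B_inf Bpage 0 0 = {0}" unfolding B_inf_def by blast
qed

end

section \<open>Multiplicative structure\<close>

locale multiplicative_double_complex = double_complex scale E d0 d1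
  for scale :: "'k::comm_ring_1 \<Rightarrow> 'x::ab_group_add \<Rightarrow> 'x" and E d0 d1 +
  fixes mult :: "'x \<Rightarrow> 'x \<Rightarrow> 'x"  (infixl \<open>\<star>\<close> 70)
  assumes mult_in: "a \<in> E s t \<Longrightarrow> b \<in> E s' t' \<Longrightarrow> a \<star> b \<in> E (s + s') (t + t')"
    and mult_add: "(a + b) \<star> c = a \<star> c + b \<star> c" "c \<star> (a + b) = c \<star> a + c \<star> b"
    and d0_mult: "a \<in> E s t \<Longrightarrow> d0 (a \<star> b) = d0 a \<star> b + sgn_deg (tot s t) (a \<star> d0 b)"
    and d1_mult: "a \<in> E s t \<Longrightarrow> d1 (a \<star> b) = d1 a \<star> b + sgn_deg (tot s t) (a \<star> d1 b)"
begin

lemma mult_zero: "0 \<star> c = 0" "c \<star> 0 = 0"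
  using mult_add(1)[of 0 0 c] mult_add(2)[of c 0 0] by simp_all

text \<open>The product of the total complex, sorted by filtration.\<close>
definition conv :: "(nat \<Rightarrow> 'x) \<Rightarrow> (nat \<Rightarrow> 'x) \<Rightarrow> nat \<Rightarrow> 'x" where
  "conv z w k = (\<Sum>i\<le>k. z i \<star> w (k - i))"

lemma Seq_conv:
  assumes "z \<in> Seq s t" "w \<in> Seq s' t'"
  shows "conv z w \<in> Seq (s + s') (t + t')"
  unfolding Seq_def mem_Collect_eq conv_def
proof (intro allI subspace_sum[OF subspace_E])
  fix k i :: nat assume "i \<in> {..k}"
  have "z i \<star> w (k - i) \<in> E (s + int i + (s' + int (k - i))) (t - 2 * int i + (t' - 2 * int (k - i)))"
    using assms by (intro mult_in) (simp_all add: Seq_def)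
  then show "z i \<star> w (k - i) \<in> E (s + s' + int k) (t + t' - 2 * int k)"
    using \<open>i \<in> {..k}\<close> by (simp add: of_nat_diff algebra_simps)
qed

text \<open>All entries of \<open>z\<close> have the same total degree \<open>2 s + t\<close>, hence the same sign in the Leibniz rules.\<close>
lemma D_conv:
  assumes "z \<in> Seq s t"
  shows "D (conv z w) k = conv (D z) w k + sgn_deg (tot s t) (conv z (D w) k)"
proof -
  have z: "z i \<in> E (s + int i) (t - 2 * int i)" for i using assms by (simp add: Seq_def)
  have sg: "sgn_deg (tot (s + int i) (t - 2 * int i)) y = sgn_deg (tot s t) y" for i :: nat and y :: 'x
    by (simp add: sgn_deg_def tot_def)
  note lm = d0_mult[OF z, unfolded sg] d1_mult[OF z, unfolded sg]
  let ?\<sigma> = "sgn_deg (tot s t)"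
  show ?thesis
  proof (cases k)
    case 0
    then show ?thesis by (simp add: D_simps conv_def lm)
  next
    case (Suc j)
    have "conv (D z) w k = (\<Sum>i\<le>k. d0 (z i) \<star> w (k - i)) + (\<Sum>i\<le>j. d1 (z i) \<star> w (j - i))"
    proof -
      have "conv (D z) w k = (\<Sum>i\<le>k. d0 (z i) \<star> w (k - i)) +
          (\<Sum>i\<le>Suc j. (case i of 0 \<Rightarrow> 0 | Suc i' \<Rightarrow> d1 (z i')) \<star> w (Suc j - i))"
        by (simp only: conv_def D_def mult_add sum.distrib Suc)
      also have "(\<Sum>i\<le>Suc j. (case i of 0 \<Rightarrow> 0 | Suc i' \<Rightarrow> d1 (z i')) \<star> w (Suc j - i)) =
          (\<Sum>i\<le>j. d1 (z i) \<star> w (j - i))"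
        by (subst sum.atMost_Suc_shift) (simp add: mult_zero)
      finally show ?thesis .
    qed
    moreover have "conv z (D w) k = (\<Sum>i\<le>k. z i \<star> d0 (w (k - i))) + (\<Sum>i\<le>j. z i \<star> d1 (w (j - i)))"
    proof -
      have "conv z (D w) k = (\<Sum>i\<le>k. z i \<star> d0 (w (k - i))) +
          (\<Sum>i\<le>Suc j. z i \<star> (case Suc j - i of 0 \<Rightarrow> 0 | Suc i' \<Rightarrow> d1 (w i')))"
        by (simp only: conv_def D_def mult_add sum.distrib Suc)
      also have "(\<Sum>i\<le>Suc j. z i \<star> (case Suc j - i of 0 \<Rightarrow> 0 | Suc i' \<Rightarrow> d1 (w i'))) =
          (\<Sum>i\<le>j. z i \<star> d1 (w (j - i)))"
        by (simp add: mult_zero Suc_diff_le)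
      finally show ?thesis .
    qed
    moreover have "D (conv z w) k =
        (\<Sum>i\<le>k. d0 (z i) \<star> w (k - i) + ?\<sigma> (z i \<star> d0 (w (k - i)))) +
        (\<Sum>i\<le>j. d1 (z i) \<star> w (j - i) + ?\<sigma> (z i \<star> d1 (w (j - i))))"
      by (simp only: Suc D_simps conv_def d0_simps d1_simps lm)
    ultimately show ?thesis
      by (simp add: sum.distrib sgn_deg_add sgn_deg_sum algebra_simps)
  qed
qed

lemma conv_vanish_left:
  assumes "\<And>i. i < q \<Longrightarrow> y i = 0"
  shows "i < q \<Longrightarrow> conv y w i = 0" "conv y w q = y q \<star> w 0"
proof -
  show "i < q \<Longrightarrow> conv y w i = 0"
    unfolding conv_def using assms by (intro sum.neutral) (auto simp: mult_zero)
  have "conv y w q = (\<Sum>i\<le>q. if i = q then y q \<star> w 0 else 0)"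
    unfolding conv_def using assms by (intro sum.cong) (auto simp: mult_zero)
  then show "conv y w q = y q \<star> w 0" by simp
qed

lemma conv_vanish_right:
  assumes "\<And>i. i < q \<Longrightarrow> y i = 0"
  shows "i < q \<Longrightarrow> conv w y i = 0" "conv w y q = w 0 \<star> y q"
proof -
  show "i < q \<Longrightarrow> conv w y i = 0"
    unfolding conv_def using assms by (intro sum.neutral) (auto simp: mult_zero)
  have "conv w y q = (\<Sum>i\<le>q. if i = 0 then w 0 \<star> y q else 0)"
    unfolding conv_def using assms by (intro sum.cong) (auto simp: mult_zero)
  then show "conv w y q = w 0 \<star> y q" by simp
qed

lemma Zseq_conv:
  assumes z: "z \<in> Zseq r s t" and w: "w \<in> Zseq r s' t'"
  shows "conv z w \<in> Zseq r (s + s') (t + t')"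
    and "D (conv z w) r = D z r \<star> w 0 + sgn_deg (tot s t) (z 0 \<star> D w r)"
proof -
  have zS: "z \<in> Seq s t" "\<And>i. i < r \<Longrightarrow> D z i = 0" and wS: "w \<in> Seq s' t'" "\<And>i. i < r \<Longrightarrow> D w i = 0"
    using z w by (auto simp: Zseq_def)
  note van = conv_vanish_left[of r "D z", OF zS(2)] conv_vanish_right[of r "D w", OF wS(2)]
  show "conv z w \<in> Zseq r (s + s') (t + t')"
    using Seq_conv[OF zS(1) wS(1)] by (simp add: Zseq_def D_conv[OF zS(1)] van)
  show "D (conv z w) r = D z r \<star> w 0 + sgn_deg (tot s t) (z 0 \<star> D w r)"
    by (simp add: D_conv[OF zS(1)] van)
qed

lemma conv_0: "conv z w 0 = z 0 \<star> w 0"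
  by (simp add: conv_def)

lemma Zpage_mult:
  assumes "a \<in> Zpage r s t" "b \<in> Zpage r s' t'"
  shows "a \<star> b \<in> Zpage r (s + s') (t + t')"
proof -
  obtain z w where "z \<in> Zseq r s t" "a = z 0" "w \<in> Zseq r s' t'" "b = w 0"
    using assms by (auto simp: Zpage_def)
  with Zpage_I[OF Zseq_conv(1), of z r s t w s' t'] show ?thesis by (simp add: conv_0)
qed

lemma Bpage_mult_left:
  assumes "a \<in> Bpage r s t" "b \<in> Zpage r s' t'"
  shows "a \<star> b \<in> Bpage r (s + s') (t + t')"
proof (cases r)
  case 0
  then show ?thesis using assms(1) by (simp add: mult_zero)
next
  case (Suc q)
  obtain z where z: "z \<in> Zseq q (s - int q) (t + 2 * int q - 1)" "a = D z q"
    using assms(1) by (auto simp: Suc)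
  obtain w where w: "w \<in> Zseq (Suc q) s' t'" "b = w 0"
    using assms(2) by (auto simp: Zpage_def Suc)
  then have wq: "w \<in> Zseq q s' t'" "D w q = 0" by (auto simp: Zseq_def)
  have "conv z w \<in> Zseq q (s - int q + s') (t + 2 * int q - 1 + t')" "D (conv z w) q = a \<star> b"
    using Zseq_conv[OF z(1) wq(1)] by (simp_all add: z(2) w(2) wq(2) mult_zero)
  moreover have "s - int q + s' = s + s' - int q" "t + 2 * int q - 1 + t' = t + t' + 2 * int q - 1"
    by simp_all
  ultimately show ?thesis unfolding Suc Bpage.simps by (metis image_eqI)
qed

lemma Bpage_mult_right:
  assumes "a \<in> Zpage r s t" "b \<in> Bpage r s' t'"
  shows "a \<star> b \<in> Bpage r (s + s') (t + t')"
proof (cases r)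
  case 0
  then show ?thesis using assms(2) by (simp add: mult_zero)
next
  case (Suc q)
  obtain z where z: "z \<in> Zseq (Suc q) s t" "a = z 0"
    using assms(1) by (auto simp: Zpage_def Suc)
  obtain w where w: "w \<in> Zseq q (s' - int q) (t' + 2 * int q - 1)" "b = D w q"
    using assms(2) by (auto simp: Suc)
  have zq: "z \<in> Zseq q s t" "D z q = 0" using z(1) by (auto simp: Zseq_def)
  have "conv z w \<in> Zseq q (s + (s' - int q)) (t + (t' + 2 * int q - 1))"
    "D (conv z w) q = sgn_deg (tot s t) (a \<star> b)"
    using Zseq_conv[OF zq(1) w(1)] by (simp_all add: z(2) w(2) zq(2) mult_zero)
  moreover have "s + (s' - int q) = s + s' - int q" "t + (t' + 2 * int q - 1) = t + t' + 2 * int q - 1"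
    by simp_all
  ultimately have "sgn_deg (tot s t) (a \<star> b) \<in> Bpage r (s + s') (t + t')"
    unfolding Suc Bpage.simps by (metis image_eqI)
  then show ?thesis
    using subspace_neg[OF subspace_Bpage] by (cases "even (tot s t)") (fastforce simp: sgn_deg_def)+
qed

lemma quot_mult_coset:
  assumes a: "a \<in> Zpage r s t" and b: "b \<in> Zpage r s' t'"
  shows "quot_mult (\<star>) (Bpage r (s + s') (t + t')) (a +o Bpage r s t) (b +o Bpage r s' t') =
    (a \<star> b) +o Bpage r (s + s') (t + t')"
proof -
  have "x \<star> y +o Bpage r (s + s') (t + t') = a \<star> b +o Bpage r (s + s') (t + t')"
    if xy: "x \<in> a +o Bpage r s t" "y \<in> b +o Bpage r s' t'" for x y
  proof -
    obtain u v where u: "u \<in> Bpage r s t" "x = a + u" and v: "v \<in> Bpage r s' t'" "y = b + v"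
      using xy unfolding elt_set_plus_def by blast
    have "y \<in> Zpage r s' t'"
      unfolding v(2) using v(1) Bpage_subset_Zpage by (intro subspace_add[OF subspace_Zpage b]) blast
    then have "u \<star> y + a \<star> v \<in> Bpage r (s + s') (t + t')"
      by (intro subspace_add[OF subspace_Bpage] Bpage_mult_left[OF u(1)] Bpage_mult_right[OF a v(1)])
    then show ?thesis
      unfolding coset_eq_iff[OF subspace_Bpage] by (simp add: u(2) v(2) mult_add algebra_simps)
  qed
  moreover have "a \<in> a +o Bpage r s t" "b \<in> b +o Bpage r s' t'" by (rule coset_self[OF subspace_Bpage])+
  ultimately show ?thesis unfolding quot_mult_def by blast
qed

lemma multiplicative_spectral_sequence: "multiplicative_spectral_sequence scale Zpage Bpage dpage (\<star>)"
proof (intro multiplicative_spectral_sequence.intro spectral_sequence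
    multiplicative_spectral_sequence_axioms.intro)
  show "a \<in> Zpage r s t \<Longrightarrow> b \<in> Zpage r s' t' \<Longrightarrow> a \<star> b \<in> Zpage r (s + s') (t + t')"
    "a \<in> Bpage r s t \<Longrightarrow> b \<in> Zpage r s' t' \<Longrightarrow> a \<star> b \<in> Bpage r (s + s') (t + t')"
    "a \<in> Zpage r s t \<Longrightarrow> b \<in> Bpage r s' t' \<Longrightarrow> a \<star> b \<in> Bpage r (s + s') (t + t')" for a b r s t s' t'
    by (rule Zpage_mult Bpage_mult_left Bpage_mult_right; assumption)+
  fix X Y r s t s' t'
  assume X: "X \<in> quot (Zpage r s t) (Bpage r s t)" and Y: "Y \<in> quot (Zpage r s' t') (Bpage r s' t')"
  obtain z where z: "z \<in> Zseq r s t" "X = z 0 +o Bpage r s t" using X by (rule quot_cases)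
  obtain w where w: "w \<in> Zseq r s' t'" "Y = w 0 +o Bpage r s' t'" using Y by (rule quot_cases)
  define B' where "B' = Bpage r (s + s' + int r) (t + t' - (2 * int r - 1))"
  have idx: "s + int r + s' = s + s' + int r" "s + (s' + int r) = s + s' + int r"
    "t - (2 * int r - 1) + t' = t + t' - (2 * int r - 1)" "t + (t' - (2 * int r - 1)) = t + t' - (2 * int r - 1)"
    by simp_all
  have sub: "subspace B'" unfolding B'_def by (rule subspace_Bpage)
  have "dpage r (s + s') (t + t') (quot_mult (\<star>) (Bpage r (s + s') (t + t')) X Y) =
      (D z r \<star> w 0 + sgn_deg (tot s t) (z 0 \<star> D w r)) +o B'"
    using dpage_coset[OF Zseq_conv(1)[OF z(1) w(1)]]
    by (simp only: z(2) w(2) quot_mult_coset[OF Zpage_I[OF z(1)] Zpage_I[OF w(1)]] conv_0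
        Zseq_conv(2)[OF z(1) w(1)] B'_def)
  moreover have "quot_mult (\<star>) B' (dpage r s t X) Y = (D z r \<star> w 0) +o B'"
    using quot_mult_coset[OF D_in_Zpage[OF z(1)] Zpage_I[OF w(1)]]
    by (simp only: z(2) w(2) dpage_coset[OF z(1)] B'_def idx)
  moreover have "quot_mult (\<star>) B' X (dpage r s' t' Y) = (z 0 \<star> D w r) +o B'"
    using quot_mult_coset[OF Zpage_I[OF z(1)] D_in_Zpage[OF w(1)]]
    by (simp only: z(2) w(2) dpage_coset[OF w(1)] B'_def idx)
  ultimately show "dpage r (s + s') (t + t') (quot_mult (\<star>) (Bpage r (s + s') (t + t')) X Y) =
      (let B' = Bpage r (s + s' + int r) (t + t' - (2 * int r - 1)) in
        quot_mult (\<star>) B' (dpage r s t X) Y + sgn_deg (tot s t) ` quot_mult (\<star>) B' X (dpage r s' t' Y))"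
    unfolding Let_def B'_def[symmetric] by (simp add: sgn_deg_coset[OF sub] coset_add[OF sub])
qed

end

section \<open>The double complex of forms\<close>

context based_lie_algebra begin

lemma forms_double_complex:
  "multiplicative_double_complex form_scale Forms ce_diff koszul_diff wedge"
proof (intro multiplicative_double_complex.intro double_complex.intro module_form_scale
    double_complex_axioms.intro multiplicative_double_complex_axioms.intro subspace_alt_forms
    alt_forms_neg ce_in_Forms koszul_in_Forms ce_square koszul_square ce_koszul_anticommute wedge_in_alt_forms wedge_add)
  show "module_hom form_scale form_scale ce_diff" "module_hom form_scale form_scale koszul_diff"
    by (intro module_hom.intro module_hom_axioms.intro module_form_scale ce_linear koszul_linear)+
  show "ce_diff (wedge a b) = wedge (ce_diff a) b + sgn_deg (tot s t) (wedge a (ce_diff b))"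
    "koszul_diff (wedge a b) = wedge (koszul_diff a) b + sgn_deg (tot s t) (wedge a (koszul_diff b))"
    if "a \<in> Forms s t" for a b s t
    by (simp_all only: ce_wedge koszul_wedge bar_Forms[OF that] sgn_deg_simps)
qed

text \<open>The recursive differential agrees with \<open>CE_diff\<close> on alternating forms only; the entries of a zig-zag are
  such forms.\<close>
lemma zigzag_CE_diff:
  "zigzag Forms (CE_diff scale bracket n e) koszul_diff r s t z \<longleftrightarrow> zigzag Forms ce_diff koszul_diff r s t z" if "r \<ge> 1"
proof -
  have "CE_diff scale bracket n e (z i) = ce_diff (z i)" if "\<forall>i<r. z i \<in> Forms (s + int i) (t - 2 * int i)" "i < r" for i
    using that by (blast intro: CE_diff_Forms)
  then show ?thesis using that unfolding zigzag_def by (metis Suc_le_eq One_nat_def)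
qed

lemma Forms_corner: "Forms 0 0 = range (\<lambda>c. poly_form (pconst c))"
proof (intro equalityI subsetI)
  fix a assume a: "a \<in> Forms 0 0"
  then have "a [] \<in> sym_power n 0" by (simp add: alt_forms_iff)
  then obtain c where "a [] = pconst c" using sym_power_0 by blast
  moreover have "a us = 0" if "us \<noteq> []" for us
    using that by (intro Forms_eval_zero[OF a]) simp
  ultimately have "a = poly_form (pconst c)" by (auto simp: poly_form_def)
  then show "a \<in> range (\<lambda>c. poly_form (pconst c))" by blast
qed (auto intro: poly_form_in_alt_forms)

end

theorem theoremA4:
  fixes scale :: "'k::idom \<Rightarrow> 'l::ab_group_add \<Rightarrow> 'l"
    and bracket :: "'l \<Rightarrow> 'l \<Rightarrow> 'l"
    and n :: nat
    and e :: "nat \<Rightarrow> 'l"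
  assumes "is_PID TYPE('k)"
    and "lie_algebra scale bracket"
    and "is_basis scale n e"
  shows "\<exists>(Z :: nat \<Rightarrow> int \<Rightarrow> int \<Rightarrow> ('l, 'k) form set) B d d1.
    (let E0 = alt_forms scale n;
         d0 = CE_diff scale bracket n e;
         x = x_gen scale n e;
         y = y_gen;
         c = struct_const scale bracket n e
     in
      bigraded_algebra form_scale E0 wedge (poly_form 1) \<and>
      (\<forall>s t. \<forall>a\<in>E0 s t. \<exists>!p.
         (\<forall>I. p I \<in> sym_power n s \<and> (\<not> (I \<subseteq> {..<n} \<and> int (card I) = t) \<longrightarrow> p I = 0)) \<and>
         a = (\<Sum>I\<in>Pow {..<n}. wedge (poly_form (p I)) (x_monomial scale n e I))) \<and>
      (\<forall>i<n. x i \<in> E0 0 1 \<and> y i \<in> E0 1 0) \<and>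

      multiplicative_spectral_sequence form_scale Z B d wedge \<and>
      (\<forall>s t. Z 0 s t = E0 s t \<and> B 0 s t = {0}) \<and>

      (\<forall>s t. \<exists>R. \<forall>r\<ge>R. Z r s t = Z_inf Z s t \<and> B r s t = B_inf B s t) \<and>
      bij_betw (\<lambda>r. poly_form (pconst r) +o B_inf B 0 0) UNIV (quot (Z_inf Z 0 0) (B_inf B 0 0)) \<and>
      (\<forall>s t. (s, t) \<noteq> (0, 0) \<longrightarrow> quot (Z_inf Z s t) (B_inf B s t) = {B_inf B s t}) \<and>

      (\<forall>s t. \<forall>a\<in>E0 s t. d 0 s t {a} = {d0 a}) \<and>
      is_the_derivation form_scale E0 wedge 0 1
        (\<lambda>\<delta>. \<forall>i<n.
           \<delta> (x i) = - (\<Sum>k<n. \<Sum>j<k. form_scale (c j k i) (wedge (x j) (x k))) \<and>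
           \<delta> (y i) = (\<Sum>j<n. \<Sum>k<n. form_scale (c j k i) (wedge (y j) (x k)))) d0 \<and>
      is_the_derivation form_scale E0 wedge 1 (- 1)
        (\<lambda>\<delta>. \<forall>i<n. \<delta> (x i) = y i \<and> \<delta> (y i) = 0) d1 \<and>
      (\<forall>s t. \<forall>a\<in>E0 s t. d0 (d1 a) + d1 (d0 a) = 0) \<and>
      (\<forall>s t. \<forall>a\<in>Z 1 s t. d 1 s t (a +o B 1 s t) = d1 a +o B 1 (s + 1) (t - 1)) \<and>
      (\<forall>r\<ge>1. \<forall>s t.
         Z r s t = {z 0 | z. zigzag E0 d0 d1 r s t z} \<and>
         (\<forall>z. zigzag E0 d0 d1 r s t z \<longrightarrow>
            d r s t (z 0 +o B r s t) =
            d1 (z (r - 1)) +o B r (s + int r) (t - (2 * int r - 1)))))"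
proof -
  interpret lie_algebra scale bracket by fact
  interpret L: based_lie_algebra scale bracket n e
    by unfold_locales fact
  interpret C: multiplicative_double_complex form_scale "alt_forms scale n" L.ce_diff L.koszul_diff wedge
    by (rule L.forms_double_complex)
  let ?E = "alt_forms scale n" and ?d0 = "CE_diff scale bracket n e"
  let ?x = "x_gen scale n e" and ?c = "struct_const scale bracket n e"
  have derivation_d0: "is_the_derivation form_scale ?E wedge 0 1
      (\<lambda>\<delta>. \<forall>i<n. \<delta> (?x i) = - (\<Sum>k<n. \<Sum>j<k. form_scale (?c j k i) (wedge (?x j) (?x k))) \<and>
         \<delta> (y_gen i) = (\<Sum>j<n. \<Sum>k<n. form_scale (?c j k i) (wedge (y_gen j) (?x k)))) ?d0"
    unfolding is_the_derivation_def
  proof (intro conjI allI impI ballI)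
    show "graded_derivation form_scale ?E wedge 0 1 ?d0" by (rule L.graded_derivation_ce)
    fix i assume i: "i < n"
    show x: "?d0 (?x i) = - (\<Sum>k<n. \<Sum>j<k. form_scale (?c j k i) (wedge (?x j) (?x k)))"
      unfolding L.CE_diff_Forms[OF L.x_gen_in_Forms] by (rule L.ce_x_formula[OF i])
    show y: "?d0 (y_gen i) = (\<Sum>j<n. \<Sum>k<n. form_scale (?c j k i) (wedge (y_gen j) (?x k)))"
      unfolding L.CE_diff_Forms[OF L.y_gen_in_Forms[OF i]] by (rule L.ce_y_formula[OF i])
  next
    fix \<delta>' s t a assume "a \<in> ?E s t"
      and "graded_derivation form_scale ?E wedge 0 1 \<delta>' \<and>
        (\<forall>i<n. \<delta>' (?x i) = - (\<Sum>k<n. \<Sum>j<k. form_scale (?c j k i) (wedge (?x j) (?x k))) \<and>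
           \<delta>' (y_gen i) = (\<Sum>j<n. \<Sum>k<n. form_scale (?c j k i) (wedge (y_gen j) (?x k))))"
    then show "\<delta>' a = ?d0 a"
      by (intro L.graded_derivation_unique[OF L.graded_derivation_ce, of \<delta>' a s t])
         (simp_all only: L.CE_diff_Forms[OF L.x_gen_in_Forms] L.CE_diff_Forms[OF L.y_gen_in_Forms]
            L.ce_x_formula L.ce_y_formula)
  qed
  have derivation_d1: "is_the_derivation form_scale ?E wedge 1 (- 1)
      (\<lambda>\<delta>. \<forall>i<n. \<delta> (?x i) = y_gen i \<and> \<delta> (y_gen i) = 0) L.koszul_diff"
    unfolding is_the_derivation_def
  proof (intro conjI allI impI ballI)
    show "graded_derivation form_scale ?E wedge 1 (- 1) L.koszul_diff" by (rule L.graded_derivation_koszul_diff)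
    show "L.koszul_diff (?x i) = y_gen i" "L.koszul_diff (y_gen i) = 0" if "i < n" for i
      by (rule L.koszul_x[OF that] L.koszul_y)+
  next
    fix \<delta>' s t a assume "a \<in> ?E s t"
      and "graded_derivation form_scale ?E wedge 1 (- 1) \<delta>' \<and>
        (\<forall>i<n. \<delta>' (?x i) = y_gen i \<and> \<delta>' (y_gen i) = 0)"
    then show "\<delta>' a = L.koszul_diff a"
      by (intro L.graded_derivation_unique[OF L.graded_derivation_koszul_diff, of \<delta>' a s t])
         (simp_all only: L.koszul_x L.koszul_y)
  qed
  have anticommute: "?d0 (L.koszul_diff a) + L.koszul_diff (?d0 a) = 0" if "a \<in> ?E s t" for a s t
    unfolding L.CE_diff_Forms[OF that] L.CE_diff_Forms[OF L.koszul_in_Forms[OF that]]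
    by (rule L.ce_koszul_anticommute[OF that])
  have corner: "Z_inf C.Zpage 0 0 = range (\<lambda>c. poly_form (pconst c))" "B_inf C.Bpage 0 0 = {0}"
    using C.corner L.Forms_corner L.ce_pconst by auto
  have bij: "bij_betw (\<lambda>r. poly_form (pconst r) +o B_inf C.Bpage 0 0) UNIV
      (quot (Z_inf C.Zpage 0 0) (B_inf C.Bpage 0 0))"
  proof -
    have "inj (\<lambda>r. poly_form (pconst r) +o B_inf C.Bpage 0 0)"
    proof (rule injI)
      fix r r' :: 'k
      assume "poly_form (pconst r) +o B_inf C.Bpage 0 0 = poly_form (pconst r') +o B_inf C.Bpage 0 0"
      then have "(poly_form (pconst r) :: ('l, 'k) form) = poly_form (pconst r')"
        unfolding corner by (simp add: elt_set_plus_def)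
      then have "pconst r = pconst r'" by (metis poly_form_def)
      then show "r = r'" by (simp add: pconst_inj)
    qed
    then show ?thesis unfolding bij_betw_def quot_def corner(1) image_image by simp
  qed
  have stable: "\<exists>R. \<forall>r\<ge>R. C.Zpage r s t = Z_inf C.Zpage s t \<and> C.Bpage r s t = B_inf C.Bpage s t" for s t
    using C.pages_stable[of s t] by metis
  have trivial: "quot (Z_inf C.Zpage s t) (B_inf C.Bpage s t) = {B_inf C.Bpage s t}" if "(s, t) \<noteq> (0, 0)" for s t
    by (rule C.quot_inf_trivial[OF L.koszul_exact that])
  have Zpage_zigzag: "C.Zpage r s t = {z 0 | z. zigzag ?E ?d0 L.koszul_diff r s t z}" if "1 \<le> r" for r s t
    unfolding L.zigzag_CE_diff[OF that] by (rule C.Zpage_zigzag[OF that])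
  have dpage_zigzag: "C.dpage r s t (z 0 +o C.Bpage r s t) =
      L.koszul_diff (z (r - 1)) +o C.Bpage r (s + int r) (t - (2 * int r - 1))"
    if "1 \<le> r" "zigzag ?E ?d0 L.koszul_diff r s t z" for r s t z
    using that(2) unfolding L.zigzag_CE_diff[OF that(1)] by (rule C.dpage_zigzag[OF _ that(1)])
  have dpage_0: "C.dpage 0 s t {a} = {?d0 a}" if "a \<in> ?E s t" for a s t
    unfolding L.CE_diff_Forms[OF that] by (rule C.dpage_0[OF that])
  show ?thesis
    unfolding Let_def
    by (rule exI[of _ C.Zpage], rule exI[of _ C.Bpage], rule exI[of _ C.dpage], rule exI[of _ L.koszul_diff])
       (intro conjI allI ballI impI bigraded_algebra_forms L.expansion_unique L.x_gen_in_Forms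
         L.y_gen_in_Forms C.multiplicative_spectral_sequence C.Zpage_0 C.Bpage.simps(1) stable bij trivial
         dpage_0 derivation_d0 derivation_d1 anticommute C.dpage_1 Zpage_zigzag dpage_zigzag)
qed

end
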